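(* Let $\lambda\in P^+$, let $w_\lambda\in W$ be the unique shortest element with $\overline\lambda:=w_\lambda\cdot\lambda\in\mathcal O$, fix a reduced expression $w_\lambda=s_{i_1}\cdots s_{i_m}$, and let $c_1,\dots,c_m\in\mathbb F$ be the associated ($k$-dependent) elements defined in the context. Then the Heckman–Opdam polynomial $P_\lambda$ is given by $$P_\lambda=\frac{|W_0\cdot\lambda|}{|W_0|}\sum_{w\in W_0}w\,(s_{i_m}+c_m)\cdots(s_{i_1}+c_1)\,e^{\overline\lambda}.$$
   Context: Let $R_0$ be the root system of a (complex) simple Lie algebra, and let $V_0$ be the real Euclidean space spanned by $R_0$, with $W_0$-invariant inner product $(\cdot,\cdot)$. Put $\alpha^\vee=2\alpha/(\alpha,\alpha)$. Fix positive roots $R_0^+$ with simple roots $\alpha_1,\dots,\alpha_n$, and let $\beta$ be the highest short root (if all roots have the same length, all are considered short). Let $V=\mathbb R\delta\oplus V_0$ be the space of affine linear functions on $V_0$, via $(r\delta+x,y)=r+(x,y)$ for $r\in\mathbb R$, $x,y\in V_0$. Put $a_0=\delta-\beta^\vee$ and $a_i=\alpha_i^\vee$ for $1\le i\le n$; let $s_i$ be the orthogonal (affine) reflection of $V_0$ in the hyperplane $\{x: (a_i,x)=0\}$, so $s_0\cdot x=x-((\beta^\vee,x)-1)\beta$ and $s_i\cdot x=x-(\alpha_i^\vee,x)\alpha_i$ for $i\ge1$. Let $W$ be the Coxeter group generated by $s_0,\dots,s_n$ (the dual affine Weyl group) and $W_0$ the finite Weyl group generated by $s_1,\dots,s_n$.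 The length of an element of $W$ is the length of a shortest (reduced) expression in the $s_i$. $P\subset V_0$ is the weight lattice, which is preserved by $W$, and $P^+$ is the set of dominant weights. Let $k_\alpha$ ($\alpha\in R_0$) be parameters (indeterminates) with $k_{w\cdot\alpha}=k_\alpha$ for $w\in W_0$ (one indeterminate per $W_0$-orbit of roots), and $\mathbb F=\mathbb R(k_\alpha)$ the field of rational functions in them. Put $k_0=k_\beta$ and $k_i=k_{\alpha_i}$ for $i\ge1$. Let $\mathcal R$ be the $\mathbb F$-span of the exponentials $e^\mu$, $\mu\in P$ (the group algebra of $P$ over $\mathbb F$); $W$ acts $\mathbb F$-linearly on $\mathcal R$ by $w\,e^\mu=e^{w\cdot\mu}$. All pairings are extended $\mathbb F$-linearly. Each $W$-orbit in $P$ contains exactly one element of $\mathcal O=\{\lambda\in P: (\alpha^\vee,\lambda)\in\{0,1\}\ \text{for all }\alpha\in R_0^+\}$. For $t\in\mathbb R$ put $\varepsilon_t=1$ if $t>0$ and $\varepsilon_t=-1$ if $t\le0$. For $\lambda\in P$ put $\widetilde\lambda=\lambda+\frac12\sum_{\alpha\in R_0^+}k_\alpha\,\varepsilon_{(\alpha^\vee,\lambda)}\,\alpha\in\mathbb F\otimes V_0$. For $\lambda\in P$, $w_\lambda$ is the unique shortest element of $W$ with $\overline\lambda:=w_\lambda\cdot\lambda\in\mathcal O$. Given a fixed reduced expression $w_\lambda=s_{i_1}\cdots s_{i_m}$, put $c_j=k_{i_j}\,(a_{i_j},\widetilde{\lambda_{(j)}})^{-1}$, where $\lambda_{(j)}=s_{i_{j-1}}\cdots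 s_{i_1}\cdot\overline\lambda$ (so $\lambda_{(1)}=\overline\lambda$). Heckman–Opdam (generalized Jacobi) polynomials: for $\lambda\in P^+$ let $m_\lambda=\sum_{\mu\in W_0\cdot\lambda}e^\mu$, and let $\rho=\frac12\sum_{\alpha\in R_0^+}k_\alpha\alpha$. For $y\in V_0$ let $\partial_y e^\mu=(y,\mu)e^\mu$. Let $L=\sum_i\partial_{\xi_i}^2+\sum_{\alpha\in R_0^+}k_\alpha\frac{1+e^{-\alpha}}{1-e^{-\alpha}}\partial_\alpha$, with $\{\xi_i\}$ an orthonormal basis of $V_0$; $L$ preserves $\mathcal R^{W_0}$. Then $P_\lambda\in\mathcal R^{W_0}$ is the unique element of the form $P_\lambda=m_\lambda+\sum_{\mu\in P^+,\,\mu<\lambda}d_{\mu}m_\mu$ with $d_\mu\in\mathbb F$ (where $\mu<\lambda$ means that $\lambda-\mu$ is a nonzero sum of positive roots) such that $LP_\lambda=(\lambda,\lambda+2\rho)P_\lambda$. *)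

theory Defs
  imports
    "HOL-Analysis.Analysis"
    "HOL-Library.Poly_Mapping"
    "HOL-Computational_Algebra.Fraction_Field"
begin

section \<open>Root systems\<close>

text \<open>
  The Euclidean space spanned by the roots is the whole type \<open>'a :: euclidean_space\<close>, whose dimension
  \<open>DIM('a)\<close> is therefore the rank.
\<close>

definition coroot :: "'a::euclidean_space \<Rightarrow> 'a" where
  "coroot \<gamma> = (2 / (\<gamma> \<bullet> \<gamma>)) *\<^sub>R \<gamma>"

definition refl :: "'a::euclidean_space \<Rightarrow> 'a \<Rightarrow> 'a" where
  "refl \<gamma> x = x - (coroot \<gamma> \<bullet> x) *\<^sub>R \<gamma>"

text \<open>
  The root systems of the complex simple Lie algebras, given by the usual axioms: finite, spanning,
  stable under the reflections, crystallographic, reduced and irreducible. The set is nonempty since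
  it spans a space of positive dimension.
\<close>

definition simple_lie_root_system :: "'a::euclidean_space set \<Rightarrow> bool" where
  "simple_lie_root_system R \<longleftrightarrow>
     finite R \<and> 0 \<notin> R \<and> span R = UNIV \<and>
     (\<forall>\<gamma>\<in>R. \<forall>\<eta>\<in>R. refl \<gamma> \<eta> \<in> R) \<and>
     (\<forall>\<gamma>\<in>R. \<forall>\<eta>\<in>R. coroot \<gamma> \<bullet> \<eta> \<in> \<int>) \<and>
     (\<forall>\<gamma>\<in>R. \<forall>r. r *\<^sub>R \<gamma> \<in> R \<longrightarrow> r = 1 \<or> r = -1) \<and>
     \<not> (\<exists>A B. A \<noteq> {} \<and> B \<noteq> {} \<and> R = A \<union> B \<and> (\<forall>\<gamma>\<in>A. \<forall>\<eta>\<in>B. \<gamma> \<bullet> \<eta> = 0))"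

text \<open>
  A system of simple roots \<open>\<alpha> 1, \<dots>, \<alpha> n\<close> with \<open>n = DIM('a)\<close>; the values of \<open>\<alpha>\<close> at other indices are
  never used. The choice of positive roots is the one determined by the simple roots.
\<close>

definition simple_roots :: "'a::euclidean_space set \<Rightarrow> (nat \<Rightarrow> 'a) \<Rightarrow> bool" where
  "simple_roots R \<alpha> \<longleftrightarrow>
     \<alpha> ` {1..DIM('a)} \<subseteq> R \<and> inj_on \<alpha> {1..DIM('a)} \<and> independent (\<alpha> ` {1..DIM('a)}) \<and>
     (\<forall>\<gamma>\<in>R. \<exists>c::nat \<Rightarrow> nat. \<gamma> = (\<Sum>i=1..DIM('a). real (c i) *\<^sub>R \<alpha> i) \<or>
                          - \<gamma> = (\<Sum>i=1..DIM('a). real (c i) *\<^sub>R \<alpha> i))"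

definition pos_roots :: "'a::euclidean_space set \<Rightarrow> (nat \<Rightarrow> 'a) \<Rightarrow> 'a set" where
  "pos_roots R \<alpha> = {\<gamma>\<in>R. \<exists>c::nat \<Rightarrow> nat. \<gamma> = (\<Sum>i=1..DIM('a). real (c i) *\<^sub>R \<alpha> i)}"

definition dom_le :: "'a::euclidean_space set \<Rightarrow> (nat \<Rightarrow> 'a) \<Rightarrow> 'a \<Rightarrow> 'a \<Rightarrow> bool" where
  "dom_le R \<alpha> \<mu> \<nu> \<longleftrightarrow> (\<exists>c::'a \<Rightarrow> nat. \<nu> - \<mu> = (\<Sum>\<gamma>\<in>pos_roots R \<alpha>. real (c \<gamma>) *\<^sub>R \<gamma>))"

definition dom_less :: "'a::euclidean_space set \<Rightarrow> (nat \<Rightarrow> 'a) \<Rightarrow> 'a \<Rightarrow> 'a \<Rightarrow> bool" where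
  "dom_less R \<alpha> \<mu> \<nu> \<longleftrightarrow> \<mu> \<noteq> \<nu> \<and> dom_le R \<alpha> \<mu> \<nu>"

definition short_roots :: "'a::euclidean_space set \<Rightarrow> 'a set" where
  "short_roots R = {\<gamma>\<in>R. \<forall>\<eta>\<in>R. norm \<gamma> \<le> norm \<eta>}"

definition highest_short_root :: "'a::euclidean_space set \<Rightarrow> (nat \<Rightarrow> 'a) \<Rightarrow> 'a \<Rightarrow> bool" where
  "highest_short_root R \<alpha> \<beta> \<longleftrightarrow> \<beta> \<in> short_roots R \<and> (\<forall>\<gamma>\<in>short_roots R. dom_le R \<alpha> \<gamma> \<beta>)"


section \<open>The finite and the dual affine Weyl group\<close>

text \<open>The affine function \<open>r\<delta> + x\<close> on the Euclidean space is the pair \<open>(r, x)\<close>.\<close>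

definition affine_root :: "(nat \<Rightarrow> 'a::euclidean_space) \<Rightarrow> 'a \<Rightarrow> nat \<Rightarrow> real \<times> 'a" where
  "affine_root \<alpha> \<beta> i = (if i = 0 then (1, - coroot \<beta>) else (0, coroot (\<alpha> i)))"

definition srefl :: "(nat \<Rightarrow> 'a::euclidean_space) \<Rightarrow> 'a \<Rightarrow> nat \<Rightarrow> 'a \<Rightarrow> 'a" where
  "srefl \<alpha> \<beta> i x = (if i = 0 then x - (coroot \<beta> \<bullet> x - 1) *\<^sub>R \<beta> else refl (\<alpha> i) x)"

definition word_map :: "(nat \<Rightarrow> 'a \<Rightarrow> 'a) \<Rightarrow> nat list \<Rightarrow> 'a \<Rightarrow> 'a" where
  "word_map s ws = foldr (\<lambda>i f. s i \<circ> f) ws id"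

text \<open>
  Both groups are realised as groups of transformations of the Euclidean space. Words in the
  generators suffice because these are involutions.
\<close>

definition W0 :: "(nat \<Rightarrow> 'a::euclidean_space) \<Rightarrow> ('a \<Rightarrow> 'a) set" where
  "W0 \<alpha> = {word_map (\<lambda>i. refl (\<alpha> i)) ws | ws. set ws \<subseteq> {1..DIM('a)}}"

definition W :: "(nat \<Rightarrow> 'a::euclidean_space) \<Rightarrow> 'a \<Rightarrow> ('a \<Rightarrow> 'a) set" where
  "W \<alpha> \<beta> = {word_map (srefl \<alpha> \<beta>) ws | ws. set ws \<subseteq> {0..DIM('a)}}"

definition expression :: "(nat \<Rightarrow> 'a::euclidean_space) \<Rightarrow> 'a \<Rightarrow> nat list \<Rightarrow> ('a \<Rightarrow> 'a) \<Rightarrow> bool" where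
  "expression \<alpha> \<beta> ws w \<longleftrightarrow> set ws \<subseteq> {0..DIM('a)} \<and> w = word_map (srefl \<alpha> \<beta>) ws"

definition wlen :: "(nat \<Rightarrow> 'a::euclidean_space) \<Rightarrow> 'a \<Rightarrow> ('a \<Rightarrow> 'a) \<Rightarrow> nat" where
  "wlen \<alpha> \<beta> w = (LEAST m. \<exists>ws. expression \<alpha> \<beta> ws w \<and> length ws = m)"

definition reduced_expression ::
    "(nat \<Rightarrow> 'a::euclidean_space) \<Rightarrow> 'a \<Rightarrow> nat list \<Rightarrow> ('a \<Rightarrow> 'a) \<Rightarrow> bool" where
  "reduced_expression \<alpha> \<beta> ws w \<longleftrightarrow> expression \<alpha> \<beta> ws w \<and> length ws = wlen \<alpha> \<beta> w"

definition W0_orbit :: "(nat \<Rightarrow> 'a::euclidean_space) \<Rightarrow> 'a \<Rightarrow> 'a set" where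
  "W0_orbit \<alpha> \<mu> = (\<lambda>w. w \<mu>) ` W0 \<alpha>"


section \<open>Weights\<close>

definition weight_lattice :: "'a::euclidean_space set \<Rightarrow> 'a set" where
  "weight_lattice R = {\<mu>. \<forall>\<gamma>\<in>R. coroot \<gamma> \<bullet> \<mu> \<in> \<int>}"

definition dominant_weights :: "'a::euclidean_space set \<Rightarrow> (nat \<Rightarrow> 'a) \<Rightarrow> 'a set" where
  "dominant_weights R \<alpha> = {\<mu>\<in>weight_lattice R. \<forall>\<gamma>\<in>pos_roots R \<alpha>. 0 \<le> coroot \<gamma> \<bullet> \<mu>}"

definition minuscule_weights :: "'a::euclidean_space set \<Rightarrow> (nat \<Rightarrow> 'a) \<Rightarrow> 'a set" where
  "minuscule_weights R \<alpha> = {\<mu>\<in>weight_lattice R. \<forall>\<gamma>\<in>pos_roots R \<alpha>. coroot \<gamma> \<bullet> \<mu> \<in> {0, 1}}"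

definition shortest_to_minuscule ::
    "'a::euclidean_space set \<Rightarrow> (nat \<Rightarrow> 'a) \<Rightarrow> 'a \<Rightarrow> 'a \<Rightarrow> ('a \<Rightarrow> 'a) \<Rightarrow> bool" where
  "shortest_to_minuscule R \<alpha> \<beta> \<mu> w \<longleftrightarrow>
     w \<in> W \<alpha> \<beta> \<and> w \<mu> \<in> minuscule_weights R \<alpha> \<and>
     (\<forall>v\<in>W \<alpha> \<beta>. v \<mu> \<in> minuscule_weights R \<alpha> \<longrightarrow> wlen \<alpha> \<beta> w \<le> wlen \<alpha> \<beta> v)"


section \<open>The field of rational functions in the parameters\<close>

text \<open>
  Real rational functions in indeterminates indexed by \<open>'o\<close>. The index type is required to be linearly
  ordered only because the library's proof that polynomials form an integral domain uses an order
  on the indeterminates.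
\<close>

type_synonym 'o ratfun = "(('o \<Rightarrow>\<^sub>0 nat) \<Rightarrow>\<^sub>0 real) fract"

definition const :: "real \<Rightarrow> 'o::linorder ratfun" where
  "const r = Fract (Poly_Mapping.single 0 r) 1"

definition indet :: "'o \<Rightarrow> 'o::linorder ratfun" where
  "indet x = Fract (Poly_Mapping.single (Poly_Mapping.single x 1) 1) 1"

text \<open>
  \<open>orb\<close> identifies the set of \<open>W0\<close>-orbits of roots with the index type, so that there is exactly one
  indeterminate for each orbit.
\<close>

definition orbit_labelling ::
    "'a::euclidean_space set \<Rightarrow> (nat \<Rightarrow> 'a) \<Rightarrow> ('a \<Rightarrow> 'o) \<Rightarrow> bool" where
  "orbit_labelling R \<alpha> orb \<longleftrightarrow>
     orb ` R = UNIV \<and> (\<forall>\<gamma>\<in>R. \<forall>\<eta>\<in>R. orb \<gamma> = orb \<eta> \<longleftrightarrow> \<eta> \<in> W0_orbit \<alpha> \<gamma>)"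

definition kpar :: "('a \<Rightarrow> 'o) \<Rightarrow> 'a \<Rightarrow> 'o::linorder ratfun" where
  "kpar orb \<gamma> = indet (orb \<gamma>)"

definition kidx :: "(nat \<Rightarrow> 'a) \<Rightarrow> 'a \<Rightarrow> ('a \<Rightarrow> 'o) \<Rightarrow> nat \<Rightarrow> 'o::linorder ratfun" where
  "kidx \<alpha> \<beta> orb i = (if i = 0 then kpar orb \<beta> else kpar orb (\<alpha> i))"

text \<open>
  An element of the scalar extension of the Euclidean space to rational functions is given by its
  coordinates with respect to the orthonormal basis \<open>Basis\<close>, that is, by a function of which only
  the values on \<open>Basis\<close> matter. \<open>pairF\<close> and \<open>affpairF\<close> are the linear extensions of the pairings.
\<close>

definition pairF :: "'a::euclidean_space \<Rightarrow> ('a \<Rightarrow> 'o ratfun) \<Rightarrow> 'o::linorder ratfun" where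
  "pairF x v = (\<Sum>b\<in>Basis. const (x \<bullet> b) * v b)"

definition affpairF :: "real \<times> 'a::euclidean_space \<Rightarrow> ('a \<Rightarrow> 'o ratfun) \<Rightarrow> 'o::linorder ratfun" where
  "affpairF f v = const (fst f) + pairF (snd f) v"

definition eps :: "real \<Rightarrow> 'o::linorder ratfun" where
  "eps t = (if t > 0 then 1 else - 1)"

definition tilde ::
    "'a::euclidean_space set \<Rightarrow> (nat \<Rightarrow> 'a) \<Rightarrow> ('a \<Rightarrow> 'o) \<Rightarrow> 'a \<Rightarrow> 'a \<Rightarrow> 'o::linorder ratfun" where
  "tilde R \<alpha> orb \<mu> = (\<lambda>b. const (\<mu> \<bullet> b) +
     1/2 * (\<Sum>\<gamma>\<in>pos_roots R \<alpha>. kpar orb \<gamma> * eps (coroot \<gamma> \<bullet> \<mu>) * const (\<gamma> \<bullet> b)))"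

definition rho ::
    "'a::euclidean_space set \<Rightarrow> (nat \<Rightarrow> 'a) \<Rightarrow> ('a \<Rightarrow> 'o) \<Rightarrow> 'a \<Rightarrow> 'o::linorder ratfun" where
  "rho R \<alpha> orb = (\<lambda>b. 1/2 * (\<Sum>\<gamma>\<in>pos_roots R \<alpha>. kpar orb \<gamma> * const (\<gamma> \<bullet> b)))"


section \<open>The group algebra of the weight lattice\<close>

text \<open>
  The product of \<open>'a \<Rightarrow>\<^sub>0 'f\<close> is convolution, so \<open>gexp \<mu> * gexp \<nu> = gexp (\<mu> + \<nu>)\<close>; the group algebra of
  the weight lattice is the subalgebra of the elements supported on it.
\<close>

definition gexp :: "'a \<Rightarrow> 'a \<Rightarrow>\<^sub>0 'f::zero_neq_one" where
  "gexp \<mu> = Poly_Mapping.single \<mu> 1"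

definition gscale :: "'f::mult_zero \<Rightarrow> ('a \<Rightarrow>\<^sub>0 'f) \<Rightarrow> 'a \<Rightarrow>\<^sub>0 'f" where
  "gscale c f = Poly_Mapping.map ((*) c) f"

definition act :: "('a \<Rightarrow> 'a) \<Rightarrow> ('a \<Rightarrow>\<^sub>0 'f) \<Rightarrow> 'a \<Rightarrow>\<^sub>0 'f::comm_monoid_add" where
  "act w f = (\<Sum>\<mu>\<in>Poly_Mapping.keys f. Poly_Mapping.single (w \<mu>) (Poly_Mapping.lookup f \<mu>))"

definition group_algebra :: "'a::euclidean_space set \<Rightarrow> ('a \<Rightarrow>\<^sub>0 'f::zero) set" where
  "group_algebra R = {f. Poly_Mapping.keys f \<subseteq> weight_lattice R}"

definition invariants ::
    "'a::euclidean_space set \<Rightarrow> (nat \<Rightarrow> 'a) \<Rightarrow> ('a \<Rightarrow>\<^sub>0 'f::comm_monoid_add) set" where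
  "invariants R \<alpha> = {f\<in>group_algebra R. \<forall>w\<in>W0 \<alpha>. act w f = f}"

definition deriv_along ::
    "'a::euclidean_space \<Rightarrow> ('a \<Rightarrow>\<^sub>0 'o ratfun) \<Rightarrow> 'a \<Rightarrow>\<^sub>0 'o::linorder ratfun" where
  "deriv_along y f =
     (\<Sum>\<mu>\<in>Poly_Mapping.keys f. Poly_Mapping.single \<mu> (const (y \<bullet> \<mu>) * Poly_Mapping.lookup f \<mu>))"


section \<open>Heckman--Opdam polynomials\<close>

text \<open>
  The quotient of \<open>f\<close> by \<open>g\<close> in the group algebra. It is used with \<open>g = 1 - exp(-\<gamma>)\<close>, which is not a
  zero divisor, and \<open>f = \<partial>\<^sub>\<gamma> h\<close>, which is divisible by \<open>g\<close> if \<open>h\<close> is \<open>W0\<close>-invariant.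
\<close>

definition exact_quot :: "('a::euclidean_space \<Rightarrow>\<^sub>0 'f) \<Rightarrow> ('a \<Rightarrow>\<^sub>0 'f) \<Rightarrow> 'a \<Rightarrow>\<^sub>0 'f::field" where
  "exact_quot f g = (THE q. g * q = f)"

definition HO_operator ::
    "'a::euclidean_space set \<Rightarrow> (nat \<Rightarrow> 'a) \<Rightarrow> ('a \<Rightarrow> 'o) \<Rightarrow>
     ('a \<Rightarrow>\<^sub>0 'o ratfun) \<Rightarrow> 'a \<Rightarrow>\<^sub>0 'o::linorder ratfun" where
  "HO_operator R \<alpha> orb f =
     (\<Sum>b\<in>Basis. deriv_along b (deriv_along b f)) +
     (\<Sum>\<gamma>\<in>pos_roots R \<alpha>. gscale (kpar orb \<gamma>)
        ((1 + gexp (- \<gamma>)) * exact_quot (deriv_along \<gamma> f) (1 - gexp (- \<gamma>))))"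

definition orbit_sum :: "(nat \<Rightarrow> 'a::euclidean_space) \<Rightarrow> 'a \<Rightarrow> 'a \<Rightarrow>\<^sub>0 'f::{comm_monoid_add,zero_neq_one}" where
  "orbit_sum \<alpha> \<mu> = (\<Sum>\<nu>\<in>W0_orbit \<alpha> \<mu>. gexp \<nu>)"

definition HO_polynomial ::
    "'a::euclidean_space set \<Rightarrow> (nat \<Rightarrow> 'a) \<Rightarrow> ('a \<Rightarrow> 'o) \<Rightarrow> 'a \<Rightarrow> 'a \<Rightarrow>\<^sub>0 'o::linorder ratfun" where
  "HO_polynomial R \<alpha> orb lam = (THE p.
     p \<in> invariants R \<alpha> \<and>
     (\<exists>d :: 'a \<Rightarrow> 'o ratfun. p = orbit_sum \<alpha> lam +
        (\<Sum>\<mu> | \<mu> \<in> dominant_weights R \<alpha> \<and> dom_less R \<alpha> \<mu> lam. gscale (d \<mu>) (orbit_sum \<alpha> \<mu>))) \<and>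
     HO_operator R \<alpha> orb p = gscale (pairF lam (\<lambda>b. const (lam \<bullet> b) + 2 * rho R \<alpha> orb b)) p)"


section \<open>The combinatorial formula\<close>

text \<open>
  Words are lists counted from \<open>0\<close>: for \<open>ws = [i\<^sub>1, \<dots>, i\<^sub>m]\<close> and \<open>x\<close> the minuscule weight, \<open>partial_weight\<close>
  and \<open>coeff_c\<close> at \<open>j\<close> are \<open>s\<^bsub>i\<^sub>j\<^esub> \<cdots> s\<^bsub>i\<^sub>1\<^esub> x\<close> and the \<open>(j+1)\<close>-st constant.
\<close>

definition partial_weight ::
    "(nat \<Rightarrow> 'a::euclidean_space) \<Rightarrow> 'a \<Rightarrow> nat list \<Rightarrow> 'a \<Rightarrow> nat \<Rightarrow> 'a" where
  "partial_weight \<alpha> \<beta> ws x j = fold (srefl \<alpha> \<beta>) (take j ws) x"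

definition coeff_c ::
    "'a::euclidean_space set \<Rightarrow> (nat \<Rightarrow> 'a) \<Rightarrow> 'a \<Rightarrow> ('a \<Rightarrow> 'o) \<Rightarrow> nat list \<Rightarrow> 'a \<Rightarrow> nat \<Rightarrow>
     'o::linorder ratfun" where
  "coeff_c R \<alpha> \<beta> orb ws x j =
     kidx \<alpha> \<beta> orb (ws ! j) *
     inverse (affpairF (affine_root \<alpha> \<beta> (ws ! j)) (tilde R \<alpha> orb (partial_weight \<alpha> \<beta> ws x j)))"

text \<open>The product \<open>(s\<^bsub>i\<^sub>m\<^esub> + c\<^sub>m) \<cdots> (s\<^bsub>i\<^sub>1\<^esub> + c\<^sub>1)\<close> applied to the exponential of \<open>x\<close>.\<close>

definition intertwined_exp ::
    "'a::euclidean_space set \<Rightarrow> (nat \<Rightarrow> 'a) \<Rightarrow> 'a \<Rightarrow> ('a \<Rightarrow> 'o) \<Rightarrow> nat list \<Rightarrow> 'a \<Rightarrow>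
     'a \<Rightarrow>\<^sub>0 'o::linorder ratfun" where
  "intertwined_exp R \<alpha> \<beta> orb ws x =
     fold (\<lambda>j f. act (srefl \<alpha> \<beta> (ws ! j)) f + gscale (coeff_c R \<alpha> \<beta> orb ws x j) f)
       [0..<length ws] (gexp x)"

end

theory Submission
  imports Defs
begin

text \<open>
  The Dunkl--Cherednik operators \<open>D\<^sub>y\<close> can be written as sums over the positive affine roots \<open>a\<close> that are
  nonpositive at a weight \<open>\<mu>\<close>, each such root contributing a multiple of \<open>exp(s\<^sub>a \<cdot> \<mu>)\<close> to
  \<open>D\<^sub>y e\<^sup>\<mu>\<close>. A simple
  affine reflection \<open>s\<^sub>i\<close> permutes the positive affine roots other than \<open>a\<^sub>i\<close>, so commuting it past
  \<open>D\<^sub>y\<close> costs a single correction term, and \<open>s\<^sub>i + c\<close> maps a joint eigenvector attached to \<open>\<mu>\<close> to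
  one attached to
  \<open>s\<^sub>i \<cdot> \<mu>\<close>. Starting from a minuscule weight, where \<open>e\<^sup>\<mu>\<close> itself is a joint eigenvector, one reaches a
  joint eigenvector \<open>E\<close> for \<open>\<lambda>\<close>. The sum of squares of the \<open>D\<^sub>y\<close> over an orthonormal basis commutes with
  \<open>W0\<close> and agrees with \<open>L\<close> up to a constant on invariants, so the symmetrization of \<open>E\<close> is an
  eigenvector of \<open>L\<close>; the Bruhat order on weights controls its support, and triangularity of \<open>L\<close>
  identifies it with the Heckman--Opdam polynomial.
\<close>

text \<open>A single operator \<open>Dunkl y\<close> does not commute with \<open>W0\<close>: moving
  a simple reflection with root \<gamma> past it leaves a correction proportional to (y, \<gamma>).
  The eigenvalues at \<mu> and s_i \<mu> differ by (y, \<gamma>) times the pairing of a_i with the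
  shifted weight, so the one choice c = k divided by that pairing absorbs the correction for all y
  at once. The pairing has constant term a_i(\<mu>) in the parameters, and minimality of w makes
  this value strictly positive at every step. That gives a nonzero denominator, and it also keeps
  each new leading exponent out of the previous support, so the leading coefficient stays 1. In the
  sum of squares the corrections cancel because 2/(\<gamma>, \<gamma>) times the squared length of
  \<gamma> is 2. Finally, the parameters are indeterminates, so an equality of eigenvalues of L
  splits into its constant and linear parts; the linear part alone forces equal pairings with the
  sum of the positive roots, which separates \<lambda> from everything strictly below it.\<close>

abbreviation coef :: "('a \<Rightarrow>\<^sub>0 'f::zero) \<Rightarrow> 'a \<Rightarrow> 'f" where
  "coef \<equiv> Poly_Mapping.lookup"

abbreviation supp :: "('a \<Rightarrow>\<^sub>0 'f::zero) \<Rightarrow> 'a set" where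
  "supp \<equiv> Poly_Mapping.keys"

section \<open>Rational functions in the parameters\<close>

text \<open>Characteristic 0 permits division by 2 and by the orders of orbits and of
  \<open>W0\<close> in the coefficient field.\<close>

instance fract :: ("{idom, ring_char_0}") field_char_0
proof
  show "inj (of_nat :: nat \<Rightarrow> 'a fract)"
    by (rule injI) (simp add: of_nat_fract eq_fract)
qed

lemma const_0 [simp]: "const 0 = 0"
  by (simp add: const_def Zero_fract_def)

lemma const_1 [simp]: "const 1 = 1"
  by (simp add: const_def One_fract_def)

lemma const_add: "const (a + b) = const a + const b"
  by (simp add: const_def single_add)

lemma const_uminus: "const (- a) = - const a"
  by (simp add: const_def single_uminus)

lemma const_diff: "const (a - b) = const a - const b"
  by (simp add: const_def single_diff)

lemma const_mult: "const (a * b) = const a * const b"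
  by (simp add: const_def mult_single)

lemma const_sum: "const (sum f A) = (\<Sum>x\<in>A. const (f x))"
  by (induction A rule: infinite_finite_induct) (simp_all add: const_add)

lemma const_of_nat [simp]: "const (of_nat n) = of_nat n"
  by (induction n) (simp_all add: const_add)

lemma const_numeral [simp]: "const (numeral n) = numeral n"
  by (metis const_of_nat of_nat_numeral)

lemma const_inverse: "const (inverse a) = inverse (const a)"
proof (cases "a = 0")
  case False
  then have "const a * const (inverse a) = (1 :: 'o::linorder ratfun)"
    by (simp flip: const_mult)
  then show ?thesis by (metis inverse_unique)
qed simp

lemma const_divide_numeral: "const (x / numeral n) = const x / numeral n"
  unfolding divide_inverse const_mult const_inverse const_numeral by (rule refl)

text \<open>Compare the coefficients of the constant and of the linear monomials. Roots with the
  same label share an indeterminate, so only the sums of \<open>x\<close> over roots with equal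
  label are forced to vanish; adding them up gives the second claim. The first claim keeps the
  denominators of the c_j nonzero, the second separates eigenvalues.\<close>

lemma affine_in_parameters_eq_0:
  assumes "finite A" and "const r + (\<Sum>\<gamma>\<in>A. kpar orb \<gamma> * const (x \<gamma>)) = (0 :: 'o::linorder ratfun)"
  shows "r = 0" and "(\<Sum>\<gamma>\<in>A. x \<gamma>) = 0"
proof -
  define m :: "'a \<Rightarrow> 'o \<Rightarrow>\<^sub>0 nat" where "m \<gamma> = Poly_Mapping.single (orb \<gamma>) 1" for \<gamma>
  define p where "p = Poly_Mapping.single 0 r + (\<Sum>\<gamma>\<in>A. Poly_Mapping.single (m \<gamma>) (x \<gamma>))"
  have "(\<Sum>\<gamma>\<in>A. kpar orb \<gamma> * const (x \<gamma>)) = Fract (\<Sum>\<gamma>\<in>A. Poly_Mapping.single (m \<gamma>) (x \<gamma>)) 1"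
    using assms(1) unfolding kpar_def indet_def const_def m_def
    by (induction A) (simp_all add: mult_single Zero_fract_def)
  then have "const r + (\<Sum>\<gamma>\<in>A. kpar orb \<gamma> * const (x \<gamma>)) = Fract p 1"
    by (simp add: p_def const_def)
  with assms(2) have p: "p = 0" by (simp add: Zero_fract_def eq_fract)
  have m: "m \<gamma> \<noteq> 0" for \<gamma>
    by (metis m_def lookup_single_eq lookup_zero zero_neq_one)
  have "coef p 0 = r" by (simp add: p_def lookup_add lookup_sum lookup_single m)
  with p show "r = 0" by simp
  have 0: "(\<Sum>\<gamma>\<in>{\<gamma>\<in>A. m \<gamma> = e}. x \<gamma>) = 0" if "e \<in> m ` A" for e
  proof -
    have "coef p e = (\<Sum>\<gamma>\<in>A. if m \<gamma> = e then x \<gamma> else 0)"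
      using that m by (auto simp: p_def lookup_add lookup_sum lookup_single when_def intro!: sum.cong)
    then show ?thesis using p assms(1) by (simp add: sum.If_cases Int_def conj_commute)
  qed
  have "(\<Sum>\<gamma>\<in>A. x \<gamma>) = (\<Sum>e\<in>m ` A. \<Sum>\<gamma>\<in>{\<gamma>\<in>A. m \<gamma> = e}. x \<gamma>)"
    by (rule sum.group[symmetric]) (use assms(1) in auto)
  then show "(\<Sum>\<gamma>\<in>A. x \<gamma>) = 0" using 0 by simp
qed


section \<open>Linear operators on the group algebra\<close>

lemma lookup_gscale [simp]: "coef (gscale c f) \<mu> = c * coef f \<mu>"
  by (simp add: gscale_def Poly_Mapping.map.rep_eq when_def)

lemma lookup_gexp: "coef (gexp \<mu>) \<nu> = (if \<mu> = \<nu> then 1 else 0)"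
  by (simp add: gexp_def lookup_single when_def)

lemma supp_gexp [simp]: "supp (gexp \<mu> :: _ \<Rightarrow>\<^sub>0 'f::zero_neq_one) = {\<mu>}"
  by (simp add: gexp_def)

lemma gscale_conv_mult: "gscale (c::'f::field) (f :: 'a::comm_monoid_add \<Rightarrow>\<^sub>0 'f)
    = Poly_Mapping.single 0 c * f"
  by (simp add: gscale_def mult_map_scale_conv_mult)

lemma gscale_0_left [simp]: "gscale 0 f = 0"
  and gscale_0_right [simp]: "gscale c 0 = 0"
  and gscale_1 [simp]: "gscale 1 g = g"
  for f :: "'a \<Rightarrow>\<^sub>0 'f::semiring_0" and g :: "'a \<Rightarrow>\<^sub>0 'g::semiring_1"
  by (rule poly_mapping_eqI, simp)+

lemma gscale_gscale [simp]: "gscale a (gscale b f) = gscale (a * b) f"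
  for f :: "'a \<Rightarrow>\<^sub>0 'f::semiring_0"
  by (rule poly_mapping_eqI) (simp add: mult.assoc)

lemma gscale_add_right: "gscale c (f + g) = gscale c f + gscale c g"
  and gscale_add_left: "gscale (c + d) f = gscale c f + gscale d f"
  for f :: "'a \<Rightarrow>\<^sub>0 'f::semiring_0"
  by (rule poly_mapping_eqI, simp add: lookup_add algebra_simps)+

lemma gscale_uminus_left: "gscale (- c) f = - gscale c f"
  and gscale_uminus_right: "gscale c (- f) = - gscale c f"
  and gscale_diff_right: "gscale c (f - g) = gscale c f - gscale c g"
  and gscale_diff_left: "gscale (c - d) f = gscale c f - gscale d f"
  for f :: "'a \<Rightarrow>\<^sub>0 'f::ring"
  by (rule poly_mapping_eqI, simp add: lookup_minus algebra_simps)+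

lemma gscale_sum_left: "gscale (sum c A) f = (\<Sum>x\<in>A. gscale (c x) f)"
  and gscale_sum_right: "gscale d (sum h A) = (\<Sum>x\<in>A. gscale d (h x))"
  for f :: "'a \<Rightarrow>\<^sub>0 'f::semiring_0" and h :: "'b \<Rightarrow> 'c \<Rightarrow>\<^sub>0 'g::semiring_0"
  by (induction A rule: infinite_finite_induct) (simp_all add: gscale_add_left gscale_add_right)

lemmas gscale_lin = gscale_add_right gscale_add_left gscale_uminus_left gscale_uminus_right
  gscale_diff_right gscale_diff_left

lemma group_algebra_expansion:
  "f = (\<Sum>\<mu>\<in>supp f. gscale (coef f \<mu>) (gexp \<mu>))" for f :: "'a \<Rightarrow>\<^sub>0 'f::semiring_1"
  by (rule poly_mapping_eqI)
     (simp add: lookup_sum lookup_gexp if_distrib[of "(*) _"] in_keys_iff cong: if_cong)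

definition linop :: "(('a \<Rightarrow>\<^sub>0 'f) \<Rightarrow> ('b \<Rightarrow>\<^sub>0 'f::semiring_0)) \<Rightarrow> bool" where
  "linop T \<longleftrightarrow> (\<forall>f g. T (f + g) = T f + T g) \<and> (\<forall>c f. T (gscale c f) = gscale c (T f))"

lemma linopI:
  "(\<And>f g. T (f + g) = T f + T g) \<Longrightarrow> (\<And>c f. T (gscale c f) = gscale c (T f)) \<Longrightarrow> linop T"
  by (simp add: linop_def)

lemma linop_add: "linop T \<Longrightarrow> T (f + g) = T f + T g"
  and linop_gscale: "linop T \<Longrightarrow> T (gscale c f) = gscale c (T f)"
  by (simp_all add: linop_def)

lemma linop_0: "linop T \<Longrightarrow> T 0 = 0"
  using linop_gscale[of T 0 0] by simp

lemma linop_sum: "linop T \<Longrightarrow> T (sum h A) = (\<Sum>x\<in>A. T (h x))"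
  by (induction A rule: infinite_finite_induct) (simp_all add: linop_add linop_0)

lemma linop_diff: "linop T \<Longrightarrow> T (f - g) = T f - T g" for f :: "'a \<Rightarrow>\<^sub>0 'f::ring"
  using linop_add[of T "f - g" g] by (simp add: algebra_simps)

text \<open>Agreement is demanded only on the exponents of \<open>f\<close>, so that identities
  valid for weights alone transfer to elements supported on the weight lattice.\<close>

lemma linop_eq:
  fixes T U :: "('a \<Rightarrow>\<^sub>0 'f::semiring_1) \<Rightarrow> ('b \<Rightarrow>\<^sub>0 'f)"
  assumes "linop T" "linop U" "\<And>\<mu>. \<mu> \<in> supp f \<Longrightarrow> T (gexp \<mu>) = U (gexp \<mu>)"
  shows "T f = U f"
proof -
  have "T (\<Sum>\<mu>\<in>supp f. gscale (coef f \<mu>) (gexp \<mu>)) = U (\<Sum>\<mu>\<in>supp f. gscale (coef f \<mu>) (gexp \<mu>))"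
    using assms by (simp add: linop_sum linop_gscale)
  then show ?thesis using group_algebra_expansion[of f] by simp
qed

definition linext :: "('a \<Rightarrow> 'b \<Rightarrow>\<^sub>0 'f) \<Rightarrow> ('a \<Rightarrow>\<^sub>0 'f) \<Rightarrow> ('b \<Rightarrow>\<^sub>0 'f::semiring_0)" where
  "linext t f = (\<Sum>\<mu>\<in>supp f. gscale (coef f \<mu>) (t \<mu>))"

lemma linext_superset:
  assumes "finite A" "supp f \<subseteq> A"
  shows "linext t f = (\<Sum>\<mu>\<in>A. gscale (coef f \<mu>) (t \<mu>))"
  unfolding linext_def using assms
  by (intro sum.mono_neutral_left) (auto simp: in_keys_iff)

lemma linop_linext [simp]: "linop (linext t)"
proof -
  have "linext t (f + g) = linext t f + linext t g" for f g
  proof -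
    have "supp (f + g) \<subseteq> supp f \<union> supp g" by (rule keys_add)
    then show ?thesis
      by (simp add: linext_superset[of "supp f \<union> supp g"] lookup_add gscale_add_left sum.distrib)
  qed
  moreover have "linext t (gscale c f) = gscale c (linext t f)" for c f
  proof -
    have "supp (gscale c f) \<subseteq> supp f" by (auto simp: in_keys_iff)
    then show ?thesis
      by (simp add: linext_superset[of "supp f"] gscale_sum_right)
  qed
  ultimately show ?thesis by (simp add: linop_def)
qed

lemma linext_gexp [simp]: "linext t (gexp \<mu>) = t \<mu>" for t :: "_ \<Rightarrow> _ \<Rightarrow>\<^sub>0 'f::semiring_1"
  by (simp add: linext_def lookup_gexp)

lemma act_eq_linext: "act w f = linext (\<lambda>\<mu>. gexp (w \<mu>)) f" for f :: "'a \<Rightarrow>\<^sub>0 'f::semiring_1"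
  unfolding act_def linext_def
  by (intro sum.cong refl poly_mapping_eqI) (simp add: lookup_gexp lookup_single when_def)

lemma linop_act [simp]: "linop (act w :: ('a \<Rightarrow>\<^sub>0 'f::semiring_1) \<Rightarrow> _)"
  unfolding act_eq_linext[abs_def] by simp

lemma act_gexp [simp]: "act w (gexp \<mu>) = (gexp (w \<mu>) :: _ \<Rightarrow>\<^sub>0 'f::semiring_1)"
  by (simp add: act_eq_linext)

lemma deriv_along_eq_linext: "deriv_along y = linext (\<lambda>\<mu>. gscale (const (y \<bullet> \<mu>)) (gexp \<mu>))"
  unfolding deriv_along_def linext_def
  by (intro ext sum.cong refl poly_mapping_eqI) (simp add: lookup_gexp lookup_single when_def)

lemma linop_deriv_along [simp]: "linop (deriv_along y)"
  unfolding deriv_along_eq_linext by simp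

lemma deriv_along_gexp: "deriv_along y (gexp \<mu>) = gscale (const (y \<bullet> \<mu>)) (gexp \<mu>)"
  by (simp add: deriv_along_eq_linext)

lemma lookup_deriv_along: "coef (deriv_along y f) \<mu> = const (y \<bullet> \<mu>) * coef f \<mu>"
  by (simp add: deriv_along_def lookup_sum lookup_single when_def in_keys_iff)

lemma linop_comp: "linop T \<Longrightarrow> linop U \<Longrightarrow> linop (\<lambda>f. T (U f))"
  by (rule linopI) (simp_all add: linop_add linop_gscale)

lemma linop_plus: "linop T \<Longrightarrow> linop U \<Longrightarrow> linop (\<lambda>f. T f + U f)"
  by (rule linopI) (simp_all add: linop_add linop_gscale gscale_add_right add_ac)

lemma linop_minus: "linop T \<Longrightarrow> linop U \<Longrightarrow> linop (\<lambda>f. T f - U f)"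
  for T U :: "('a \<Rightarrow>\<^sub>0 'f::ring) \<Rightarrow> ('b \<Rightarrow>\<^sub>0 'f)"
  by (rule linopI) (simp_all add: linop_add linop_gscale gscale_diff_right)

lemma linop_scale: "linop T \<Longrightarrow> linop (\<lambda>f. gscale c (T f))"
  for T :: "('a \<Rightarrow>\<^sub>0 'f::comm_semiring_0) \<Rightarrow> ('b \<Rightarrow>\<^sub>0 'f)"
  by (rule linopI) (simp_all add: linop_add linop_gscale gscale_add_right mult.commute)

lemma linop_ident [simp]: "linop (\<lambda>f. f)"
  by (rule linopI) simp_all

lemma linop_sum_ops: "(\<And>x. x \<in> A \<Longrightarrow> linop (T x)) \<Longrightarrow> linop (\<lambda>f. \<Sum>x\<in>A. T x f)"
  by (rule linopI) (simp_all add: linop_add linop_gscale gscale_sum_right sum.distrib)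

lemma linop_mult_left: "linop (\<lambda>f. g * f)" for g :: "'a::comm_monoid_add \<Rightarrow>\<^sub>0 'f::field"
  by (rule linopI) (simp_all add: gscale_conv_mult distrib_left mult.left_commute)

lemma act_act: "act v (act w f) = act (v \<circ> w) f" for f :: "'a \<Rightarrow>\<^sub>0 'f::semiring_1"
  by (rule linop_eq[OF linop_comp[OF linop_act linop_act] linop_act]) simp

lemma act_id: "act id f = f" for f :: "'a \<Rightarrow>\<^sub>0 'f::semiring_1"
  by (rule linop_eq[where U = "\<lambda>f. f"]) auto

lemma lookup_act_bij:
  fixes f :: "'a \<Rightarrow>\<^sub>0 'f::semiring_1"
  assumes "bij w"
  shows "coef (act w f) (w \<mu>) = coef f \<mu>"
proof -
  have "w \<nu> = w \<mu> \<longleftrightarrow> \<nu> = \<mu>" for \<nu> using assms by (metis bij_def inj_eq)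
  then show ?thesis
    by (simp add: act_def lookup_sum lookup_single when_def in_keys_iff)
qed

lemma supp_act: "supp (act w f) \<subseteq> w ` supp f" for f :: "'a \<Rightarrow>\<^sub>0 'f::semiring_1"
  unfolding act_def by (rule order.trans[OF Poly_Mapping.keys_sum]) auto

lemma supp_sum_subset: "(\<And>x. x \<in> A \<Longrightarrow> supp (h x) \<subseteq> B) \<Longrightarrow> supp (sum h A) \<subseteq> B"
  by (rule order.trans[OF Poly_Mapping.keys_sum]) auto

lemma supp_gscale: "supp (gscale c f) \<subseteq> supp f" for f :: "'a \<Rightarrow>\<^sub>0 'f::semiring_0"
  by (auto simp: in_keys_iff)

lemma supp_deriv_along: "supp (deriv_along y f) \<subseteq> supp f"
  by (auto simp: in_keys_iff lookup_deriv_along)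

section \<open>Division by \<open>1 - gexp (- \<gamma>)\<close>\<close>

lemma lookup_gexp_mult: "coef (gexp \<nu> * f) \<mu> = coef f (\<mu> - \<nu>)"
  for f :: "'a::ab_group_add \<Rightarrow>\<^sub>0 'f::field"
proof -
  have "gexp \<nu> * f = linext (\<lambda>\<kappa>. gexp (\<nu> + \<kappa>)) f"
    by (rule linop_eq[OF linop_mult_left]) (simp_all, simp add: gexp_def mult_single)
  also have "coef \<dots> \<mu> = (\<Sum>\<kappa>\<in>supp f. if \<kappa> = \<mu> - \<nu> then coef f \<kappa> else 0)"
    unfolding linext_def lookup_sum
    by (intro sum.cong) (auto simp: lookup_gexp)
  finally show ?thesis by (simp add: in_keys_iff)
qed

lemma lookup_one_minus_gexp_mult:
  "coef ((1 - gexp (- \<gamma>)) * f) \<mu> = coef f \<mu> - coef f (\<mu> + \<gamma>)"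
  for f :: "'a::ab_group_add \<Rightarrow>\<^sub>0 'f::field"
  by (simp add: left_diff_distrib lookup_minus lookup_gexp_mult)

text \<open>Finiteness of the support: a nonzero coefficient would be repeated at infinitely many
  exponents.\<close>

lemma lookup_vanishes_along_string:
  fixes f :: "'a::real_vector \<Rightarrow>\<^sub>0 'f::zero"
  assumes "\<gamma> \<noteq> 0" and step: "\<And>j. coef f (\<mu> + real j *\<^sub>R \<gamma>) = coef f (\<mu> + real (Suc j) *\<^sub>R \<gamma>)"
  shows "coef f \<mu> = 0"
proof (rule ccontr)
  assume "coef f \<mu> \<noteq> 0"
  moreover have "coef f (\<mu> + real j *\<^sub>R \<gamma>) = coef f \<mu>" for j
    by (induction j) (simp_all del: of_nat_Suc flip: step)
  ultimately have "range (\<lambda>j. \<mu> + real j *\<^sub>R \<gamma>) \<subseteq> supp f" by (auto simp: in_keys_iff)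
  moreover have "inj (\<lambda>j. \<mu> + real j *\<^sub>R \<gamma>)" using assms(1) by (auto intro!: injI)
  ultimately show False using finite_keys finite_subset range_inj_infinite by blast
qed

lemma one_minus_gexp_cancel:
  fixes f g :: "'a::real_vector \<Rightarrow>\<^sub>0 'f::field"
  assumes "\<gamma> \<noteq> 0" "(1 - gexp (- \<gamma>)) * f = (1 - gexp (- \<gamma>)) * g"
  shows "f = g"
proof (rule poly_mapping_eqI)
  fix \<mu>
  have "(1 - gexp (- \<gamma>)) * (f - g) = 0" using assms(2) by (simp add: right_diff_distrib)
  then have eq: "coef (f - g) \<nu> = coef (f - g) (\<nu> + \<gamma>)" for \<nu>
    using lookup_one_minus_gexp_mult[of \<gamma> "f - g" \<nu>] by simp
  have "coef (f - g) \<mu> = 0"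
  proof (rule lookup_vanishes_along_string[OF assms(1)])
    show "coef (f - g) (\<mu> + real j *\<^sub>R \<gamma>) = coef (f - g) (\<mu> + real (Suc j) *\<^sub>R \<gamma>)" for j
      using eq[of "\<mu> + real j *\<^sub>R \<gamma>"] by (simp add: scaleR_left_distrib add_ac)
  qed
  then show "coef f \<mu> = coef g \<mu>" by (simp add: lookup_minus)
qed

text \<open>Cancellation makes the quotient unique, so exhibiting one solution evaluates the
  definite description.\<close>

lemma exact_quot_eq:
  fixes h :: "'a::euclidean_space \<Rightarrow>\<^sub>0 'f::field"
  assumes "\<gamma> \<noteq> 0" "(1 - gexp (- \<gamma>)) * h = f"
  shows "exact_quot f (1 - gexp (- \<gamma>)) = h"
  unfolding exact_quot_def
proof (rule the_equality)
  show "q = h" if "(1 - gexp (- \<gamma>)) * q = f" for q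
    by (rule one_minus_gexp_cancel[OF assms(1)]) (simp add: assms(2) that)
qed (rule assms(2))


section \<open>Affine reflections\<close>

lemma coroot_uminus [simp]: "coroot (- \<gamma>) = - coroot \<gamma>"
  by (simp add: coroot_def)

lemma coroot_self: "\<gamma> \<noteq> 0 \<Longrightarrow> coroot \<gamma> \<bullet> \<gamma> = 2"
  by (simp add: coroot_def)

lemma refl_uminus_root [simp]: "refl (- \<gamma>) = refl \<gamma>"
  by (simp add: refl_def fun_eq_iff)

lemma linear_refl: "linear (refl \<gamma>)"
  by (rule linearI) (simp_all add: refl_def algebra_simps)

lemma refl_refl [simp]: "refl \<gamma> (refl \<gamma> x) = x"
  by (cases "\<gamma> = 0") (simp_all add: refl_def inner_diff_right coroot_self algebra_simps)

lemma refl_self: "refl \<gamma> \<gamma> = - \<gamma>"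
  by (cases "\<gamma> = 0") (simp_all add: refl_def coroot_self algebra_simps scaleR_2)

lemma refl_inner_commute: "refl \<gamma> x \<bullet> y = x \<bullet> refl \<gamma> y"
  by (simp add: refl_def coroot_def inner_diff_left inner_diff_right inner_commute)

lemma refl_inner: "refl \<gamma> x \<bullet> refl \<gamma> y = x \<bullet> y"
  by (simp add: refl_inner_commute)

lemma coroot_orthogonal:
  assumes "linear u" "\<And>x y. u x \<bullet> u y = x \<bullet> y"
  shows "coroot (u \<gamma>) = u (coroot \<gamma>)"
  using assms by (simp add: coroot_def linear_scale)

lemma coroot_refl: "coroot (refl \<eta> \<gamma>) = refl \<eta> (coroot \<gamma>)"
  by (rule coroot_orthogonal) (simp_all add: linear_refl refl_inner)

text \<open>The pair \<open>(r, \<gamma>)\<close> encodes the affine root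
  \<open>r\<delta> + \<gamma>\<^sup>\<or>\<close>, so that \<open>aff_refl\<close> is the reflection in its zero
  hyperplane and \<open>aff_image b a\<close> is the image of the affine root \<open>a\<close> under \<open>aff_refl b\<close>.\<close>

definition ev :: "real \<times> 'a::euclidean_space \<Rightarrow> 'a \<Rightarrow> real" where
  "ev a x = fst a + coroot (snd a) \<bullet> x"

definition aff_refl :: "real \<times> 'a::euclidean_space \<Rightarrow> 'a \<Rightarrow> 'a" where
  "aff_refl a x = x - ev a x *\<^sub>R snd a"

definition aff_image :: "real \<times> 'a::euclidean_space \<Rightarrow> real \<times> 'a \<Rightarrow> real \<times> 'a" where
  "aff_image b a = (fst a - fst b * (coroot (snd a) \<bullet> snd b), refl (snd b) (snd a))"

lemma aff_refl_eq_refl: "aff_refl b x = refl (snd b) x - fst b *\<^sub>R snd b"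
  by (simp add: aff_refl_def ev_def refl_def algebra_simps)

lemma aff_refl_add: "aff_refl b (x + v) = aff_refl b x + refl (snd b) v"
  by (simp add: aff_refl_eq_refl linear_add[OF linear_refl])

lemma ev_aff_image: "ev (aff_image b a) x = ev a (aff_refl b x)"
  by (simp add: ev_def aff_image_def coroot_refl aff_refl_eq_refl refl_inner_commute inner_diff_right)

lemma ev_aff_refl_self: "snd b \<noteq> 0 \<Longrightarrow> ev b (aff_refl b x) = - ev b x"
  by (simp add: ev_def aff_refl_def inner_diff_right coroot_self)

lemma aff_refl_aff_refl: "snd b \<noteq> 0 \<Longrightarrow> aff_refl b (aff_refl b x) = x"
  by (simp add: aff_refl_def[of b "aff_refl b x"] ev_aff_refl_self) (simp add: aff_refl_def)

lemma aff_image_aff_image: "snd b \<noteq> 0 \<Longrightarrow> aff_image b (aff_image b a) = a"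
  by (simp add: aff_image_def coroot_refl refl_inner_commute refl_self prod_eq_iff)

text \<open>This is the conjugation rule that s_b s_a s_b is the reflection in the image of a under
  s_b.\<close>

lemma aff_refl_aff_image: "snd b \<noteq> 0 \<Longrightarrow> aff_refl (aff_image b a) (aff_refl b x)
    = aff_refl b (aff_refl a x)"
proof -
  assume b: "snd b \<noteq> 0"
  have "aff_refl b (aff_refl a x) = aff_refl b (x + (- ev a x) *\<^sub>R snd a)"
      by (simp add: aff_refl_def[of a])
  also have "\<dots> = aff_refl b x - ev a x *\<^sub>R refl (snd b) (snd a)"
    by (simp only: aff_refl_add linear_scale[OF linear_refl]) simp
  finally show ?thesis
    by (simp add: aff_refl_def[of "aff_image b a"] ev_aff_image aff_refl_aff_refl[OF b]) (simp add:
        aff_image_def)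
qed

lemma aff_image_self: "snd b \<noteq> 0 \<Longrightarrow> aff_image b b = (- fst b, - snd b)"
  by (simp add: aff_image_def coroot_self refl_self)

lemma aff_refl_fixed: "ev a x = 0 \<Longrightarrow> aff_refl a x = x"
  by (simp add: aff_refl_def)


section \<open>Root systems with simple roots\<close>

locale root_datum =
  fixes R :: "'a::euclidean_space set" and \<alpha> :: "nat \<Rightarrow> 'a" and \<beta> :: 'a
  assumes root_system: "simple_lie_root_system R"
    and simple: "simple_roots R \<alpha>"
    and highest_short: "highest_short_root R \<alpha> \<beta>"
begin

abbreviation "Pos \<equiv> pos_roots R \<alpha>"
abbreviation "P \<equiv> weight_lattice R"

lemma finite_R: "finite R" and zero_notin_R: "0 \<notin> R" and span_R: "span R = UNIV"
  and refl_in_R: "\<And>\<gamma> \<eta>. \<gamma> \<in> R \<Longrightarrow> \<eta> \<in> R \<Longrightarrow> refl \<gamma> \<eta> \<in> R"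
  and crystallographic: "\<And>\<gamma> \<eta>. \<gamma> \<in> R \<Longrightarrow> \<eta> \<in> R \<Longrightarrow> coroot \<gamma> \<bullet> \<eta> \<in> \<int>"
  and reduced: "\<And>\<gamma> r. \<gamma> \<in> R \<Longrightarrow> r *\<^sub>R \<gamma> \<in> R \<Longrightarrow> r = 1 \<or> r = -1"
proof -
  have axioms: "finite R \<and> 0 \<notin> R \<and> span R = UNIV \<and> (\<forall>\<gamma>\<in>R. \<forall>\<eta>\<in>R. refl \<gamma> \<eta> \<in> R) \<and>
      (\<forall>\<gamma>\<in>R. \<forall>\<eta>\<in>R. coroot \<gamma> \<bullet> \<eta> \<in> \<int>) \<and> (\<forall>\<gamma>\<in>R. \<forall>r. r *\<^sub>R \<gamma> \<in> R \<longrightarrow> r = 1 \<or> r = -1)"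
    using root_system unfolding simple_lie_root_system_def by (elim conjE) (intro conjI)
  show "finite R" "0 \<notin> R" "span R = UNIV"
    "\<And>\<gamma> \<eta>. \<gamma> \<in> R \<Longrightarrow> \<eta> \<in> R \<Longrightarrow> refl \<gamma> \<eta> \<in> R"
    "\<And>\<gamma> \<eta>. \<gamma> \<in> R \<Longrightarrow> \<eta> \<in> R \<Longrightarrow> coroot \<gamma> \<bullet> \<eta> \<in> \<int>"
    "\<And>\<gamma> r. \<gamma> \<in> R \<Longrightarrow> r *\<^sub>R \<gamma> \<in> R \<Longrightarrow> r = 1 \<or> r = -1"
    using axioms by blast+
qed

lemma root_nonzero: "\<gamma> \<in> R \<Longrightarrow> \<gamma> \<noteq> 0"
  using zero_notin_R by auto

lemma uminus_in_R: "\<gamma> \<in> R \<Longrightarrow> - \<gamma> \<in> R"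
  using refl_in_R[of \<gamma> \<gamma>] by (simp add: refl_self)

lemma Pos_subset: "Pos \<subseteq> R"
  by (auto simp: pos_roots_def)

lemma finite_Pos: "finite Pos"
  using Pos_subset finite_R finite_subset by blast

lemma simple_in_R: "i \<in> {1..DIM('a)} \<Longrightarrow> \<alpha> i \<in> R"
  using simple unfolding simple_roots_def by blast

lemma simple_independent:
  assumes "(\<Sum>i\<in>{1..DIM('a)}. c i *\<^sub>R \<alpha> i) = 0" "j \<in> {1..DIM('a)}"
  shows "c j = 0"
proof -
  have inj: "inj_on \<alpha> {1..DIM('a)}" and ind: "independent (\<alpha> ` {1..DIM('a)})"
    using simple unfolding simple_roots_def by blast+
  define u where "u = c \<circ> the_inv_into {1..DIM('a)} \<alpha>"
  have u: "u (\<alpha> i) = c i" if "i \<in> {1..DIM('a)}" for i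
    using that inj by (simp add: u_def the_inv_into_f_f)
  have "(\<Sum>v\<in>\<alpha> ` {1..DIM('a)}. u v *\<^sub>R v) = (\<Sum>i\<in>{1..DIM('a)}. c i *\<^sub>R \<alpha> i)"
    by (subst sum.reindex[OF inj]) (simp add: u)
  then have "u (\<alpha> j) = 0"
    using independentD[OF ind, of "\<alpha> ` {1..DIM('a)}" u "\<alpha> j"] assms by simp
  then show ?thesis using u assms(2) by simp
qed

lemma pos_or_neg: "\<gamma> \<in> R \<Longrightarrow> \<gamma> \<in> Pos \<or> - \<gamma> \<in> Pos"
  using simple uminus_in_R unfolding simple_roots_def pos_roots_def by blast

lemma PosE:
  assumes "\<gamma> \<in> Pos"
  obtains c :: "nat \<Rightarrow> nat" where "\<gamma> = (\<Sum>i\<in>{1..DIM('a)}. real (c i) *\<^sub>R \<alpha> i)"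
  using assms by (auto simp: pos_roots_def)

lemma simple_in_Pos:
  assumes "i \<in> {1..DIM('a)}" shows "\<alpha> i \<in> Pos"
proof -
  have "\<alpha> i = (\<Sum>j\<in>{1..DIM('a)}. real (if j = i then 1 else 0) *\<^sub>R \<alpha> j)"
    using assms by (simp add: if_distrib[of real] if_distrib[of "\<lambda>r. r *\<^sub>R _"] cong: if_cong)
  then show ?thesis using simple_in_R[OF assms] unfolding pos_roots_def
    by (intro CollectI conjI exI[of _ "\<lambda>j. if j = i then 1 else 0"])
qed

lemma Pos_not_neg:
  assumes "\<gamma> \<in> Pos" shows "- \<gamma> \<notin> Pos"
proof
  assume "- \<gamma> \<in> Pos"
  then obtain d where d: "- \<gamma> = (\<Sum>i\<in>{1..DIM('a)}. real (d i) *\<^sub>R \<alpha> i)" by (rule PosE)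
  obtain c where c: "\<gamma> = (\<Sum>i\<in>{1..DIM('a)}. real (c i) *\<^sub>R \<alpha> i)" using assms by (rule PosE)
  have "(\<Sum>i\<in>{1..DIM('a)}. (real (c i) + real (d i)) *\<^sub>R \<alpha> i) = \<gamma> + - \<gamma>"
    unfolding d by (subst c) (simp add: scaleR_left_distrib sum.distrib)
  then have "real (c i) + real (d i) = 0" if "i \<in> {1..DIM('a)}" for i
    using simple_independent[OF _ that, of "\<lambda>i. real (c i) + real (d i)"] by simp
  then have "\<gamma> = 0" by (subst c) (auto intro!: sum.neutral simp: add_nonneg_eq_0_iff)
  then show False using assms Pos_subset root_nonzero by blast
qed

text \<open>Reflecting in \<alpha> i changes only the i-th coordinate. If the image were negative,
  all other coordinates of \<gamma> would be zero, and reducedness would give \<gamma> = \<alpha>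
  i.\<close>

lemma simple_reflection_Pos:
  assumes i: "i \<in> {1..DIM('a)}" and \<gamma>: "\<gamma> \<in> Pos" "\<gamma> \<noteq> \<alpha> i"
  shows "refl (\<alpha> i) \<gamma> \<in> Pos"
proof (rule ccontr)
  assume not: "refl (\<alpha> i) \<gamma> \<notin> Pos"
  have R: "\<gamma> \<in> R" "\<alpha> i \<in> R" using i \<gamma> Pos_subset simple_in_R by auto
  obtain c where c: "\<gamma> = (\<Sum>j\<in>{1..DIM('a)}. real (c j) *\<^sub>R \<alpha> j)" using \<gamma>(1) by (rule PosE)
  have "- refl (\<alpha> i) \<gamma> \<in> Pos" using not pos_or_neg refl_in_R R by blast
  then obtain d where d: "- refl (\<alpha> i) \<gamma> = (\<Sum>j\<in>{1..DIM('a)}. real (d j) *\<^sub>R \<alpha> j)" by (rule PosE)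
  define m where "m = coroot (\<alpha> i) \<bullet> \<gamma>"
  \<comment> \<open>Coordinates of the trivial relation that \<gamma>, minus its reflection, minus
    \<open>m *\<^sub>R \<alpha> i\<close>, is zero. For j other than i two natural numbers add up to
    0.\<close>
  have "(\<Sum>j\<in>{1..DIM('a)}. (real (c j) + real (d j) - (if j = i then m else 0)) *\<^sub>R \<alpha> j)
      = (\<Sum>j\<in>{1..DIM('a)}. real (c j) *\<^sub>R \<alpha> j) + (\<Sum>j\<in>{1..DIM('a)}. real (d j) *\<^sub>R \<alpha> j) - m *\<^sub>R \<alpha> i"
    using i by (simp add: algebra_simps sum.distrib sum_subtractf if_distrib[of "\<lambda>r. r *\<^sub>R _"] cong:
        if_cong)
  also have "\<dots> = 0" by (simp only: c[symmetric] d[symmetric]) (simp add: refl_def m_def)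
  finally have 0: "(\<Sum>j\<in>{1..DIM('a)}. (real (c j) + real (d j) - (if j = i then m else 0)) *\<^sub>R \<alpha> j) = 0" .
  have "c j = 0" if "j \<in> {1..DIM('a)}" "j \<noteq> i" for j
    using simple_independent[OF 0 that(1)] that(2) by simp
  then have "\<gamma> = (\<Sum>j\<in>{1..DIM('a)}. if j = i then real (c i) *\<^sub>R \<alpha> i else 0)"
    by (subst c) (rule sum.cong, auto)
  then have "\<gamma> = real (c i) *\<^sub>R \<alpha> i" using i by simp
  moreover from this have "real (c i) = 1 \<or> real (c i) = -1"
    using reduced[OF R(2), of "real (c i)"] R(1) by simp
  ultimately show False using \<gamma>(2) by auto
qed

section \<open>The sum of the positive roots as a height function\<close>

definition two_rho :: 'a where "two_rho = \<Sum> Pos"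

text \<open>The reflection permutes the positive roots other than \<alpha> i, so their sum is fixed
  and hence orthogonal to \<alpha> i; what remains of the pairing is the squared length of \<alpha>
  i.\<close>

lemma two_rho_simple:
  assumes i: "i \<in> {1..DIM('a)}" shows "two_rho \<bullet> \<alpha> i > 0"
proof -
  let ?B = "Pos - {\<alpha> i}"
  have maps: "refl (\<alpha> i) \<gamma> \<in> ?B" if "\<gamma> \<in> ?B" for \<gamma>
  proof -
    have "refl (\<alpha> i) \<gamma> \<noteq> \<alpha> i"
    proof
      assume "refl (\<alpha> i) \<gamma> = \<alpha> i"
      then have "\<gamma> = - \<alpha> i" by (metis refl_refl refl_self)
      then show False using that Pos_not_neg simple_in_Pos i by auto
    qed
    then show ?thesis using that simple_reflection_Pos i by auto
  qed
  have "(\<Sum>\<gamma>\<in>?B. refl (\<alpha> i) \<gamma>) = \<Sum> ?B"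
    by (rule sum.reindex_bij_witness[of _ "refl (\<alpha> i)" "refl (\<alpha> i)"]) (use maps in auto)
  then have "refl (\<alpha> i) (\<Sum> ?B) = \<Sum> ?B" by (simp add: linear_sum[OF linear_refl])
  then have "\<Sum> ?B \<bullet> \<alpha> i = \<Sum> ?B \<bullet> refl (\<alpha> i) (\<alpha> i)"
    using refl_inner_commute[of "\<alpha> i" "\<Sum> ?B" "\<alpha> i"] by simp
  then have "\<Sum> ?B \<bullet> \<alpha> i = 0" by (simp add: refl_self)
  moreover have "two_rho = \<alpha> i + \<Sum> ?B"
    unfolding two_rho_def using finite_Pos simple_in_Pos[OF i] by (rule sum.remove)
  ultimately show ?thesis using root_nonzero simple_in_R i by (simp add: inner_add_left)
qed

lemma two_rho_Pos:
  assumes "\<gamma> \<in> Pos" shows "two_rho \<bullet> \<gamma> > 0"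
proof -
  obtain c where c: "\<gamma> = (\<Sum>j\<in>{1..DIM('a)}. real (c j) *\<^sub>R \<alpha> j)" using assms by (rule PosE)
  have eq: "two_rho \<bullet> \<gamma> = (\<Sum>j\<in>{1..DIM('a)}. real (c j) * (two_rho \<bullet> \<alpha> j))"
    by (subst c) (simp add: inner_sum_right)
  have "\<exists>j\<in>{1..DIM('a)}. c j \<noteq> 0"
  proof (rule ccontr)
    assume "\<not> ?thesis"
    then have "\<gamma> = 0" by (subst c) simp
    then show False using assms Pos_subset root_nonzero by auto
  qed
  then obtain j where j: "j \<in> {1..DIM('a)}" "c j \<noteq> 0" by auto
  show ?thesis unfolding eq
  proof (rule sum_pos2[OF _ j(1)])
    show "0 < real (c j) * (two_rho \<bullet> \<alpha> j)" using j two_rho_simple by simp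
    show "0 \<le> real (c k) * (two_rho \<bullet> \<alpha> k)" if "k \<in> {1..DIM('a)}" for k
      using two_rho_simple[OF that] by simp
  qed simp
qed

section \<open>The cone behind the dominance order\<close>

definition root_cone :: "'a set" where
  "root_cone = {x. \<exists>c::'a \<Rightarrow> nat. x = (\<Sum>\<gamma>\<in>Pos. real (c \<gamma>) *\<^sub>R \<gamma>)}"

lemma dom_le_iff: "dom_le R \<alpha> \<mu> \<nu> \<longleftrightarrow> \<nu> - \<mu> \<in> root_cone"
  by (simp add: dom_le_def root_cone_def)

lemma root_cone_0: "0 \<in> root_cone"
  unfolding root_cone_def by (auto intro!: exI[of _ "\<lambda>_. 0"])

lemma root_cone_add: "x \<in> root_cone \<Longrightarrow> y \<in> root_cone \<Longrightarrow> x + y \<in> root_cone"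
proof -
  assume "x \<in> root_cone" "y \<in> root_cone"
  then obtain c d :: "'a \<Rightarrow> nat" where
    "x = (\<Sum>\<gamma>\<in>Pos. real (c \<gamma>) *\<^sub>R \<gamma>)" "y = (\<Sum>\<gamma>\<in>Pos. real (d \<gamma>) *\<^sub>R \<gamma>)"
    by (auto simp: root_cone_def)
  then have "x + y = (\<Sum>\<gamma>\<in>Pos. real (c \<gamma> + d \<gamma>) *\<^sub>R \<gamma>)"
    by (simp add: scaleR_left_distrib sum.distrib)
  then show ?thesis unfolding root_cone_def by (intro CollectI exI[of _ "\<lambda>\<gamma>. c \<gamma> + d \<gamma>"])
qed

lemma root_cone_scaled_root:
  assumes "\<gamma> \<in> Pos" "r \<in> \<int>" "0 \<le> r" shows "r *\<^sub>R \<gamma> \<in> root_cone"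
proof -
  have r: "r = real (nat \<lfloor>r\<rfloor>)" using assms(2,3) by (auto elim!: Ints_cases)
  have "r *\<^sub>R \<gamma> = (\<Sum>\<eta>\<in>Pos. real (if \<eta> = \<gamma> then nat \<lfloor>r\<rfloor> else 0) *\<^sub>R \<eta>)"
    using assms(1) finite_Pos r
    by (simp add: if_distrib[of real] if_distrib[of "\<lambda>r. r *\<^sub>R _"] cong: if_cong)
  then show ?thesis unfolding root_cone_def by (intro CollectI exI[of _ "\<lambda>\<eta>. if \<eta>
      = \<gamma> then nat \<lfloor>r\<rfloor> else 0"])
qed

text \<open>Every positive root pairs strictly positively with \<open>two_rho\<close>, so a
  vanishing sum of nonnegative terms forces all coefficients to be 0. This is how strictness in the
  dominance order is detected.\<close>

lemma root_cone_two_rho: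
  assumes "x \<in> root_cone" shows "two_rho \<bullet> x \<ge> 0" "two_rho \<bullet> x = 0 \<Longrightarrow> x = 0"
proof -
  obtain c :: "'a \<Rightarrow> nat" where c: "x = (\<Sum>\<gamma>\<in>Pos. real (c \<gamma>) *\<^sub>R \<gamma>)"
    using assms by (auto simp: root_cone_def)
  have eq: "two_rho \<bullet> x = (\<Sum>\<gamma>\<in>Pos. real (c \<gamma>) * (two_rho \<bullet> \<gamma>))"
    by (simp add: c inner_sum_right)
  have nn: "0 \<le> real (c \<gamma>) * (two_rho \<bullet> \<gamma>)" if "\<gamma> \<in> Pos" for \<gamma>
    using two_rho_Pos[OF that] by simp
  show "two_rho \<bullet> x \<ge> 0" unfolding eq using nn by (rule sum_nonneg)
  assume "two_rho \<bullet> x = 0"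
  then have "\<forall>\<gamma>\<in>Pos. real (c \<gamma>) * (two_rho \<bullet> \<gamma>) = 0"
    unfolding eq using nn finite_Pos by (subst (asm) sum_nonneg_eq_0_iff) auto
  then have "\<forall>\<gamma>\<in>Pos. c \<gamma> = 0" using two_rho_Pos by fastforce
  then show "x = 0" by (simp add: c)
qed

lemma root_cone_antisym: "x \<in> root_cone \<Longrightarrow> - x \<in> root_cone \<Longrightarrow> x = 0"
  using root_cone_two_rho[of x] root_cone_two_rho(1)[of "- x"] by simp


subsection \<open>The finite Weyl group\<close>

lemma word_map_Nil [simp]: "word_map s [] = id"
  and word_map_Cons [simp]: "word_map s (i # ws) = s i \<circ> word_map s ws"
  by (simp_all add: word_map_def)

lemma word_map_append: "word_map s (vs @ ws) = word_map s vs \<circ> word_map s ws"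
  by (induction vs) (simp_all add: comp_assoc)

lemma id_in_W0: "id \<in> W0 \<alpha>"
  unfolding W0_def by (auto intro!: exI[of _ "[]"])

lemma W0_comp: "u \<in> W0 \<alpha> \<Longrightarrow> v \<in> W0 \<alpha> \<Longrightarrow> u \<circ> v \<in> W0 \<alpha>"
proof -
  assume "u \<in> W0 \<alpha>" "v \<in> W0 \<alpha>"
  then obtain us vs where "u = word_map (\<lambda>i. refl (\<alpha> i)) us" "set us \<subseteq> {1..DIM('a)}"
    "v = word_map (\<lambda>i. refl (\<alpha> i)) vs" "set vs \<subseteq> {1..DIM('a)}"
    by (auto simp: W0_def)
  then have "u \<circ> v = word_map (\<lambda>i. refl (\<alpha> i)) (us @ vs)" "set (us @ vs) \<subseteq> {1..DIM('a)}"
    by (simp_all only: word_map_append set_append Un_subset_iff simp_thms)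
  then show ?thesis unfolding W0_def by blast
qed

lemma simple_refl_in_W0: "i \<in> {1..DIM('a)} \<Longrightarrow> refl (\<alpha> i) \<in> W0 \<alpha>"
  unfolding W0_def by (auto intro!: exI[of _ "[i]"])

lemma W0_induct [consumes 1, case_names id step]:
  assumes "u \<in> W0 \<alpha>" "Q id" "\<And>i u. i \<in> {1..DIM('a)} \<Longrightarrow> u \<in> W0 \<alpha> \<Longrightarrow> Q u \<Longrightarrow> Q (refl (\<alpha> i) \<circ> u)"
  shows "Q u"
proof -
  obtain ws where "u = word_map (\<lambda>i. refl (\<alpha> i)) ws" "set ws \<subseteq> {1..DIM('a)}"
    using assms(1) by (auto simp: W0_def)
  then show ?thesis
  proof (induction ws arbitrary: u)
    case Nil
    then show ?case using assms(2) by (simp add: id_def)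
  next
    case (Cons i ws)
    then have "word_map (\<lambda>i. refl (\<alpha> i)) ws \<in> W0 \<alpha>" by (auto simp: W0_def)
    then show ?case using assms(3)[of i "word_map (\<lambda>i. refl (\<alpha> i)) ws"] Cons by (simp add: comp_def)
  qed
qed

lemma linear_W0: "u \<in> W0 \<alpha> \<Longrightarrow> linear u"
proof (induction rule: W0_induct)
  case id
  show ?case by (simp add: linear_iff)
next
  case (step i u)
  then show ?case using linear_compose linear_refl by blast
qed

lemma inner_W0: "u \<in> W0 \<alpha> \<Longrightarrow> u x \<bullet> u y = x \<bullet> y"
  by (induction rule: W0_induct) (simp_all add: refl_inner)

lemma W0_in_R: "u \<in> W0 \<alpha> \<Longrightarrow> \<gamma> \<in> R \<Longrightarrow> u \<gamma> \<in> R"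
  by (induction rule: W0_induct) (auto simp: refl_in_R simple_in_R)

lemma W0_inverse: "u \<in> W0 \<alpha> \<Longrightarrow> \<exists>v\<in>W0 \<alpha>. v \<circ> u = id \<and> u \<circ> v = id"
proof (induction rule: W0_induct)
  case id
  show ?case using id_in_W0 by (intro bexI[of _ id]) simp_all
next
  case (step i u)
  then obtain v where v: "v \<in> W0 \<alpha>" "v \<circ> u = id" "u \<circ> v = id" by blast
  have "v \<circ> refl (\<alpha> i) \<in> W0 \<alpha>" using step v W0_comp simple_refl_in_W0 by blast
  moreover have "(v \<circ> refl (\<alpha> i)) \<circ> (refl (\<alpha> i) \<circ> u) = id" "(refl (\<alpha> i) \<circ> u) \<circ> (v \<circ> refl (\<alpha> i)) = id"
    using v by (auto simp: fun_eq_iff)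
  ultimately show ?case by blast
qed

lemma coroot_W0: "u \<in> W0 \<alpha> \<Longrightarrow> coroot (u \<gamma>) = u (coroot \<gamma>)"
  using coroot_orthogonal linear_W0 inner_W0 by blast

lemma W0_weight:
  assumes "u \<in> W0 \<alpha>" "\<mu> \<in> P" shows "u \<mu> \<in> P"
proof -
  obtain v where v: "v \<in> W0 \<alpha>" "u \<circ> v = id" using W0_inverse assms by blast
  have "coroot \<gamma> \<bullet> u \<mu> \<in> \<int>" if "\<gamma> \<in> R" for \<gamma>
  proof -
    have "u (v \<gamma>) = \<gamma>" using v(2) by (metis comp_apply id_apply)
    then have "coroot \<gamma> \<bullet> u \<mu> = coroot (v \<gamma>) \<bullet> \<mu>"
      using assms(1) by (metis coroot_W0 inner_W0)
    then show ?thesis using assms(2) W0_in_R v that by (simp add: weight_lattice_def)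
  qed
  then show ?thesis by (simp add: weight_lattice_def)
qed

text \<open>An element is linear and maps the finite spanning set R into itself, so its restriction
  to R determines it.\<close>

lemma finite_W0: "finite (W0 \<alpha>)"
proof (rule finite_imageD)
  show "finite ((\<lambda>u. restrict u R) ` W0 \<alpha>)"
    by (rule finite_subset[of _ "R \<rightarrow>\<^sub>E R"]) (use W0_in_R finite_R in \<open>auto intro: finite_PiE\<close>)
  show "inj_on (\<lambda>u. restrict u R) (W0 \<alpha>)"
  proof (rule inj_onI)
    fix u v assume uv: "u \<in> W0 \<alpha>" "v \<in> W0 \<alpha>" "restrict u R = restrict v R"
    then have "u \<gamma> = v \<gamma>" if "\<gamma> \<in> R" for \<gamma> using that by (metis restrict_apply')
    then show "u = v" using linear_eq_on_span[of u v R] linear_W0 uv span_R by auto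
  qed
qed

text \<open>Induction on the height. As \<gamma> has positive square and nonnegative coordinates,
  some simple root pairs positively with it; unless \<gamma> is that root, reflecting keeps it
  positive and lowers the height.\<close>

lemma root_conjugate_simple:
  assumes "\<gamma> \<in> Pos" shows "\<exists>u\<in>W0 \<alpha>. \<exists>i\<in>{1..DIM('a)}. \<gamma> = u (\<alpha> i)"
proof -
  obtain c where "\<gamma> = (\<Sum>j\<in>{1..DIM('a)}. real (c j) *\<^sub>R \<alpha> j)" using assms by (rule PosE)
  then show ?thesis using assms
  proof (induction "\<Sum>j\<in>{1..DIM('a)}. c j" arbitrary: \<gamma> c rule: less_induct)
    case less
    note c = less.prems(1) and \<gamma> = less.prems(2)
    have \<gamma>R: "\<gamma> \<in> R" using \<gamma> Pos_subset by auto
    have "\<exists>i\<in>{1..DIM('a)}. \<alpha> i \<bullet> \<gamma> > 0"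
    proof (rule ccontr)
      assume "\<not> ?thesis"
      then have "(\<Sum>j\<in>{1..DIM('a)}. real (c j) * (\<alpha> j \<bullet> \<gamma>)) \<le> 0"
        by (intro sum_nonpos mult_nonneg_nonpos) (auto simp: not_less)
      moreover have "\<gamma> \<bullet> \<gamma> = (\<Sum>j\<in>{1..DIM('a)}. real (c j) * (\<alpha> j \<bullet> \<gamma>))"
        by (subst (1) c) (simp add: inner_sum_left)
      ultimately show False using root_nonzero[OF \<gamma>R] inner_gt_zero_iff[of \<gamma>] by linarith
    qed
    then obtain i where i: "i \<in> {1..DIM('a)}" "\<alpha> i \<bullet> \<gamma> > 0" by blast
    show ?case
    proof (cases "\<gamma> = \<alpha> i")
      case True
      then show ?thesis using i id_in_W0 by (metis id_apply)
    next
      case False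
      define m where "m = coroot (\<alpha> i) \<bullet> \<gamma>"
      let ?\<eta> = "refl (\<alpha> i) \<gamma>"
      have \<eta>: "?\<eta> \<in> Pos" using simple_reflection_Pos i \<gamma> False by blast
      have m: "m > 0" using i root_nonzero simple_in_R by (auto simp: m_def coroot_def)
      obtain d where d: "?\<eta> = (\<Sum>j\<in>{1..DIM('a)}. real (d j) *\<^sub>R \<alpha> j)" using \<eta> by (rule PosE)
      have "(\<Sum>j\<in>{1..DIM('a)}. (real (c j) - real (d j) - (if j = i then m else 0)) *\<^sub>R \<alpha> j)
          = (\<Sum>j\<in>{1..DIM('a)}. real (c j) *\<^sub>R \<alpha> j) - (\<Sum>j\<in>{1..DIM('a)}. real (d j) *\<^sub>R \<alpha> j) - m *\<^sub>R \<alpha> i"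
        using i by (simp add: algebra_simps sum.distrib sum_subtractf
          if_distrib[of "\<lambda>r. r *\<^sub>R _"] cong: if_cong)
      also have "\<dots> = 0" by (simp only: c[symmetric] d[symmetric]) (simp add: refl_def m_def)
      finally have sum_0: "(\<Sum>j\<in>{1..DIM('a)}. (real (c j) - real (d j) - (if j
          = i then m else 0)) *\<^sub>R \<alpha> j) = 0" .
      have 0: "real (c j) - real (d j) - (if j = i then m else 0) = 0" if "j \<in> {1..DIM('a)}" for j
        using simple_independent[OF sum_0 that] .
      have "(\<Sum>j\<in>{1..DIM('a)}. d j) < (\<Sum>j\<in>{1..DIM('a)}. c j)"
      proof (rule sum_strict_mono_ex1)
        show "\<forall>j\<in>{1..DIM('a)}. d j \<le> c j"
        proof
          fix j assume "j \<in> {1..DIM('a)}"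
          then show "d j \<le> c j" using 0[of j] m by (auto split: if_splits)
        qed
        have "d i < c i" using 0[of i] i m by simp
        then show "\<exists>j\<in>{1..DIM('a)}. d j < c j" using i by blast
      qed simp
      from less.hyps[OF this d \<eta>] obtain u k where u: "u \<in> W0 \<alpha>" "k \<in> {1..DIM('a)}" "?\<eta> = u (\<alpha> k)"
          by blast
      then have "\<gamma> = (refl (\<alpha> i) \<circ> u) (\<alpha> k)" by (metis comp_apply refl_refl)
      then show ?thesis using u W0_comp simple_refl_in_W0 i by blast
    qed
  qed
qed

text \<open>For \<eta> = u (\<alpha> i) the reflection in \<eta> is the conjugate by u of the one in
  \<alpha> i.\<close>

lemma refl_in_W0:
  assumes "\<gamma> \<in> R" shows "refl \<gamma> \<in> W0 \<alpha>"
proof -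
  have "refl \<eta> \<in> W0 \<alpha>" if \<eta>: "\<eta> \<in> Pos" for \<eta>
  proof -
    obtain u i where u: "u \<in> W0 \<alpha>" "i \<in> {1..DIM('a)}" "\<eta> = u (\<alpha> i)" using root_conjugate_simple \<eta>
        by blast
    obtain v where v: "v \<in> W0 \<alpha>" "u \<circ> v = id" using W0_inverse u by blast
    have uv: "u (v x) = x" for x using v(2) by (metis comp_apply id_apply)
    have "refl \<eta> x = u (refl (\<alpha> i) (v x))" for x
    proof -
      have "coroot \<eta> \<bullet> x = coroot (\<alpha> i) \<bullet> v x"
        using u by (metis coroot_W0 inner_W0 uv)
      then show ?thesis using u
        by (simp add: refl_def linear_diff[OF linear_W0] linear_scale[OF linear_W0] uv)
    qed
    then have "refl \<eta> = u \<circ> refl (\<alpha> i) \<circ> v" by auto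
    then show ?thesis using u v W0_comp simple_refl_in_W0 by metis
  qed
  then show ?thesis using pos_or_neg[OF assms] by (metis refl_uminus_root)
qed


subsection \<open>The highest short root\<close>

lemma \<beta>_in_R: "\<beta> \<in> R" and \<beta>_short: "\<gamma> \<in> R \<Longrightarrow> norm \<beta> \<le> norm \<gamma>"
  and \<beta>_highest: "\<eta> \<in> R \<Longrightarrow> norm \<eta> = norm \<beta> \<Longrightarrow> \<beta> - \<eta> \<in> root_cone"
  using highest_short by (auto simp: highest_short_root_def short_roots_def dom_le_iff)

lemma \<beta>_in_Pos: "\<beta> \<in> Pos"
proof (rule ccontr)
  assume "\<beta> \<notin> Pos"
  then have "two_rho \<bullet> - \<beta> > 0" using two_rho_Pos pos_or_neg \<beta>_in_R by blast
  moreover have "two_rho \<bullet> (\<beta> - - \<beta>) \<ge> 0"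
    using \<beta>_highest[of "- \<beta>"] uminus_in_R \<beta>_in_R root_cone_two_rho(1) by fastforce
  ultimately show False by (simp add: inner_add_right)
qed

text \<open>Otherwise reflecting \<beta> in \<gamma> would add a positive multiple of \<gamma>,
  giving a root of the same length that is not below \<beta>.\<close>

lemma \<beta>_dominant:
  assumes "\<gamma> \<in> Pos" shows "0 \<le> \<gamma> \<bullet> \<beta>"
proof (rule ccontr)
  assume neg: "\<not> ?thesis"
  have \<gamma>: "\<gamma> \<in> R" using assms Pos_subset by auto
  have "norm (refl \<gamma> \<beta>) = norm \<beta>" by (simp add: norm_eq_sqrt_inner refl_inner)
  then have "\<beta> - refl \<gamma> \<beta> \<in> root_cone" using \<beta>_highest refl_in_R \<gamma> \<beta>_in_R by blast
  then have "0 \<le> (coroot \<gamma> \<bullet> \<beta>) * (two_rho \<bullet> \<gamma>)" using root_cone_two_rho(1) by (fastforce simp: refl_def)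
  moreover have "coroot \<gamma> \<bullet> \<beta> < 0" using neg root_nonzero[OF \<gamma>]
    by (simp add: coroot_def divide_neg_pos)
  ultimately show False using two_rho_Pos[OF assms] by (simp add: zero_le_mult_iff)
qed

text \<open>If the Cartan integer were at least 2, then, \<beta> being no longer than the other
  root, the squared length of their difference would be nonpositive. The lower bound means that s_0
  lowers the level of an affine root by at most 1, except in the direction -\<beta>.\<close>

lemma coroot_\<beta>_bound:
  assumes \<gamma>: "\<gamma> \<in> R"
  shows "\<gamma> \<noteq> \<beta> \<Longrightarrow> coroot \<gamma> \<bullet> \<beta> \<le> 1" and "\<gamma> \<noteq> - \<beta> \<Longrightarrow> - 1 \<le> coroot \<gamma> \<bullet> \<beta>"
proof -
  have *: "coroot \<eta> \<bullet> \<beta> \<le> 1" if \<eta>: "\<eta> \<in> R" "\<eta> \<noteq> \<beta>" for \<eta>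
  proof (rule ccontr)
    assume "\<not> ?thesis"
    moreover have "coroot \<eta> \<bullet> \<beta> \<in> \<int>" using crystallographic \<eta> \<beta>_in_R by blast
    ultimately have "2 \<le> coroot \<eta> \<bullet> \<beta>" by (auto elim!: Ints_cases)
    moreover have pos: "0 < \<eta> \<bullet> \<eta>" using root_nonzero[OF \<eta>(1)] by simp
    ultimately have "\<eta> \<bullet> \<eta> \<le> \<eta> \<bullet> \<beta>" by (simp add: coroot_def field_simps)
    moreover have "\<beta> \<bullet> \<beta> \<le> \<eta> \<bullet> \<eta>" using \<beta>_short[OF \<eta>(1)] by (simp add: norm_le)
    ultimately have "(\<eta> - \<beta>) \<bullet> (\<eta> - \<beta>) \<le> 0" by (simp add: inner_diff_left inner_diff_right inner_commute)
    then show False using \<eta>(2) inner_ge_zero[of "\<eta> - \<beta>"] by (simp add: order_antisym_conv)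
  qed
  show "coroot \<gamma> \<bullet> \<beta> \<le> 1" if "\<gamma> \<noteq> \<beta>" using *[OF \<gamma> that] .
  show "- 1 \<le> coroot \<gamma> \<bullet> \<beta>" if "\<gamma> \<noteq> - \<beta>"
    using *[of "- \<gamma>"] \<gamma> uminus_in_R that by (fastforce simp: neg_eq_iff_add_eq_0 add_eq_0_iff)
qed

end


context root_datum
begin

section \<open>The affine root system\<close>

definition pos_affine :: "(real \<times> 'a) set" where
  "pos_affine = {a. fst a \<in> \<int> \<and> snd a \<in> R \<and> (0 < fst a \<or> fst a = 0 \<and> snd a \<in> Pos)}"

definition sroot :: "nat \<Rightarrow> real \<times> 'a" where
  "sroot i = (if i = 0 then (1, - \<beta>) else (0, \<alpha> i))"

lemma srefl_eq_aff_refl: "srefl \<alpha> \<beta> i = aff_refl (sroot i)"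
  by (simp add: fun_eq_iff srefl_def sroot_def aff_refl_def ev_def refl_def algebra_simps)

lemma affine_root_eq: "affine_root \<alpha> \<beta> i = (fst (sroot i), coroot (snd (sroot i)))"
  by (simp add: affine_root_def sroot_def)

lemma PhpD: "a \<in> pos_affine \<Longrightarrow> fst a \<in> \<int>" "a \<in> pos_affine \<Longrightarrow> snd a \<in> R" "a \<in> pos_affine \<Longrightarrow> 0 \<le> fst a"
  "a \<in> pos_affine \<Longrightarrow> fst a = 0 \<Longrightarrow> snd a \<in> Pos"
  by (auto simp: pos_affine_def)

lemma snd_pos_affine_nonzero: "a \<in> pos_affine \<Longrightarrow> snd a \<noteq> 0"
  using PhpD(2) root_nonzero by blast

lemma sroot_in_pos_affine: "i \<in> {0..DIM('a)} \<Longrightarrow> sroot i \<in> pos_affine"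
  using \<beta>_in_R uminus_in_R simple_in_Pos[of i] Pos_subset by (auto simp: pos_affine_def sroot_def)

lemma sroot_nonzero: "i \<in> {0..DIM('a)} \<Longrightarrow> snd (sroot i) \<noteq> 0"
  using sroot_in_pos_affine snd_pos_affine_nonzero by blast

lemma srefl_srefl: "i \<in> {0..DIM('a)} \<Longrightarrow> srefl \<alpha> \<beta> i (srefl \<alpha> \<beta> i x) = x"
  by (simp add: srefl_eq_aff_refl aff_refl_aff_refl sroot_nonzero)

text \<open>For i = 0 the level r becomes r + t, where t is the Cartan integer against \<beta>. It
  is at least -1 except in the direction -\<beta>, where t = -2 and the root of level 1 is the
  excluded one. Dominance of \<beta> settles the cases in which the old or the new level is
  0.\<close>

lemma aff_image_sroot_pos_affine:
  assumes i: "i \<in> {0..DIM('a)}" and a: "a \<in> pos_affine" "a \<noteq> sroot i"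
  shows "aff_image (sroot i) a \<in> pos_affine"
proof (cases "i = 0")
  case False
  then have i': "i \<in> {1..DIM('a)}" using i by simp
  have "refl (\<alpha> i) (snd a) \<in> R" using a refl_in_R simple_in_R i' PhpD by blast
  moreover have "refl (\<alpha> i) (snd a) \<in> Pos" if "fst a = 0"
    using that a simple_reflection_Pos[OF i'] PhpD False
    by (metis prod.collapse sroot_def)
  ultimately show ?thesis using a False by (auto simp: aff_image_def sroot_def pos_affine_def)
next
  case True
  define r \<gamma> t where "r = fst a" and "\<gamma> = snd a" and "t = coroot \<gamma> \<bullet> \<beta>"
  have \<gamma>: "\<gamma> \<in> R" and r: "r \<in> \<int>" "0 \<le> r" using a PhpD by (auto simp: r_def \<gamma>_def)
  have t: "t \<in> \<int>" using crystallographic \<gamma> \<beta>_in_R by (simp add: t_def)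
  have eq: "aff_image (sroot i) a = (r + t, refl \<beta> \<gamma>)"
    by (simp add: True aff_image_def sroot_def r_def \<gamma>_def t_def)
  have refl_R: "refl \<beta> \<gamma> \<in> R" using refl_in_R \<gamma> \<beta>_in_R by blast
  have sgn: "0 < \<gamma> \<bullet> \<beta> \<longleftrightarrow> 0 < t" "\<gamma> \<bullet> \<beta> = 0 \<longleftrightarrow> t = 0"
    using root_nonzero[OF \<gamma>] inner_ge_zero[of \<gamma>]
    by (auto simp: t_def coroot_def zero_less_divide_iff simp del: inner_ge_zero)
  have "0 < r + t \<or> r + t = 0 \<and> refl \<beta> \<gamma> \<in> Pos"
  proof (cases "r = 0")
    case True
    then have "\<gamma> \<in> Pos" using a PhpD by (simp add: r_def \<gamma>_def)
    then have "0 < \<gamma> \<bullet> \<beta> \<or> \<gamma> \<bullet> \<beta> = 0" using \<beta>_dominant by fastforce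
    moreover have "refl \<beta> \<gamma> = \<gamma>" if "\<gamma> \<bullet> \<beta> = 0"
      using that by (simp add: refl_def coroot_def inner_commute)
    ultimately show ?thesis using True sgn \<open>\<gamma> \<in> Pos\<close> by auto
  next
    case False
    then have r1: "1 \<le> r" using r by (auto elim!: Ints_cases)
    show ?thesis
    proof (cases "\<gamma> = - \<beta>")
      case True
      then have "r \<noteq> 1" using a(2) \<open>i = 0\<close> by (auto simp: sroot_def r_def \<gamma>_def prod_eq_iff)
      then have "2 \<le> r" using r r1 by (auto elim!: Ints_cases)
      moreover have "t = - 2" using True root_nonzero[OF \<beta>_in_R] by (simp add: t_def coroot_self)
      moreover have "refl \<beta> \<gamma> = \<beta>"
        by (simp add: True refl_self linear_neg[OF linear_refl])
      ultimately show ?thesis using \<beta>_in_Pos by auto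
    next
      case ne: False
      then have "- 1 \<le> t" using coroot_\<beta>_bound(2) \<gamma> by (simp add: t_def)
      moreover have "refl \<beta> \<gamma> \<in> Pos" if "r + t = 0"
      proof (rule ccontr)
        assume "refl \<beta> \<gamma> \<notin> Pos"
        then have "0 \<le> - refl \<beta> \<gamma> \<bullet> \<beta>" using pos_or_neg refl_R \<beta>_dominant by blast
        then have "0 \<le> \<gamma> \<bullet> \<beta>" by (simp add: refl_inner_commute refl_self)
        then show False using sgn that r1 by linarith
      qed
      ultimately show ?thesis using r1 by linarith
    qed
  qed
  then show ?thesis using eq refl_R r t by (simp add: pos_affine_def)
qed

lemma ev_Ints: "a \<in> pos_affine \<Longrightarrow> \<mu> \<in> P \<Longrightarrow> ev a \<mu> \<in> \<int>"
  by (simp add: ev_def pos_affine_def weight_lattice_def)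

lemma aff_refl_weight: "a \<in> pos_affine \<Longrightarrow> \<mu> \<in> P \<Longrightarrow> aff_refl a \<mu> \<in> P"
  using ev_Ints[of a \<mu>] crystallographic PhpD(2)[of a]
  by (auto simp: aff_refl_def weight_lattice_def inner_diff_right)

lemma srefl_weight: "i \<in> {0..DIM('a)} \<Longrightarrow> \<mu> \<in> P \<Longrightarrow> srefl \<alpha> \<beta> i \<mu> \<in> P"
  by (simp add: srefl_eq_aff_refl aff_refl_weight sroot_in_pos_affine)


section \<open>Shortest elements\<close>

text \<open>\<open>word_map\<close> applies the last letter of a word first, \<open>fold\<close> the
  first letter; since letters are involutions the two maps are mutually inverse. So
  \<open>fold\<close> along a word for w runs from the minuscule weight back to the given
  one.\<close>

lemma fold_srefl_word_map:
  "set ws \<subseteq> {0..DIM('a)} \<Longrightarrow> fold (srefl \<alpha> \<beta>) ws (word_map (srefl \<alpha> \<beta>) ws x) = x"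
  by (induction ws arbitrary: x) (auto simp: srefl_srefl)

lemma word_map_fold_srefl:
  "set ws \<subseteq> {0..DIM('a)} \<Longrightarrow> word_map (srefl \<alpha> \<beta>) ws (fold (srefl \<alpha> \<beta>) ws x) = x"
  by (induction ws arbitrary: x) (auto simp: srefl_srefl)

text \<open>Minuscule weights lie in the closed fundamental alcove: a coroot contributes at least
  -1, which a level of at least 1 compensates, and at level 0 the root is positive.\<close>

lemma minuscule_alcove:
  assumes \<mu>: "\<mu> \<in> minuscule_weights R \<alpha>" and a: "a \<in> pos_affine"
  shows "0 \<le> ev a \<mu>"
proof (cases "fst a = 0")
  case True
  then show ?thesis using \<mu> PhpD(4)[OF a] by (fastforce simp: ev_def minuscule_weights_def)
next
  case False
  then have "1 \<le> fst a" using PhpD(1,3)[OF a] by (auto elim!: Ints_cases)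
  moreover have "coroot (snd a) \<bullet> \<mu> \<in> {-1, 0, 1}"
  proof (cases "snd a \<in> Pos")
    case True
    then show ?thesis using \<mu> by (auto simp: minuscule_weights_def)
  next
    case False
    then have "- snd a \<in> Pos" using pos_or_neg PhpD(2)[OF a] by blast
    then have "coroot (- snd a) \<bullet> \<mu> \<in> {0, 1}" using \<mu> unfolding minuscule_weights_def by blast
    then show ?thesis by (simp, linarith)
  qed
  ultimately show ?thesis by (auto simp: ev_def)
qed

text \<open>The strong exchange property for points of an orbit instead of group elements. If
  \<open>a\<close> is the last simple root, delete the last letter; otherwise its image under the
  last reflection is still positive and is negative at the previous point, so induction
  applies.\<close>

lemma strong_exchange:
  assumes "\<And>a. a \<in> pos_affine \<Longrightarrow> 0 \<le> ev a x"
    and "set ws \<subseteq> {0..DIM('a)}" "a \<in> pos_affine" "ev a (fold (srefl \<alpha> \<beta>) ws x) < 0"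
  shows "\<exists>vs. set vs \<subseteq> {0..DIM('a)} \<and> length vs < length ws \<and>
    fold (srefl \<alpha> \<beta>) vs x = aff_refl a (fold (srefl \<alpha> \<beta>) ws x)"
  using assms(2-4)
proof (induction ws arbitrary: a rule: rev_induct)
  case Nil
  then show ?case using assms(1)[of a] by simp
next
  case (snoc i ws)
  let ?y = "fold (srefl \<alpha> \<beta>) ws x" and ?b = "sroot i"
  have i: "i \<in> {0..DIM('a)}" and ws: "set ws \<subseteq> {0..DIM('a)}" using snoc.prems by auto
  have si: "srefl \<alpha> \<beta> i = aff_refl ?b" by (rule srefl_eq_aff_refl)
  show ?case
  proof (cases "a = ?b")
    case True
    then show ?thesis using ws by (auto intro!: exI[of _ ws] simp: si aff_refl_aff_refl
        sroot_nonzero[OF i])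
  next
    case False
    have "ev (aff_image ?b a) ?y < 0" using snoc.prems(3) by (simp add: ev_aff_image si)
    with snoc.IH[OF ws aff_image_sroot_pos_affine[OF i snoc.prems(2) False]] obtain vs where
      vs: "set vs \<subseteq> {0..DIM('a)}" "length vs < length ws"
        "fold (srefl \<alpha> \<beta>) vs x = aff_refl (aff_image ?b a) ?y" by blast
    have "fold (srefl \<alpha> \<beta>) (vs @ [i]) x = aff_refl ?b (aff_refl (aff_image ?b a) ?y)"
      by (simp add: vs(3) si)
    also have "\<dots> = aff_refl a (aff_refl ?b ?y)"
      using aff_refl_aff_image[OF sroot_nonzero[OF i], of a "aff_refl ?b ?y"]
      by (simp add: aff_refl_aff_refl[OF sroot_nonzero[OF i]])
    finally show ?thesis using vs i
      by (intro exI[of _ "vs @ [i]"]) (simp add: si)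
  qed
qed

text \<open>If step j failed to increase, the point it reaches would be attainable with at most j
  letters: by the preceding ones if the reflection fixes the point, by an exchanged word if it moves
  the point down. Splicing this into the rest gives a shorter path from the minuscule weight to
  \<open>lam\<close>, against the choice of \<open>w\<close>.\<close>

lemma reduced_expression_increasing:
  assumes w: "shortest_to_minuscule R \<alpha> \<beta> lam w" and ws: "reduced_expression \<alpha> \<beta> ws w"
    and j: "j < length ws"
  shows "0 < ev (sroot (ws ! j)) (partial_weight \<alpha> \<beta> ws (w lam) j)"
proof (rule ccontr)
  assume not_pos: "\<not> ?thesis"
  let ?i = "ws ! j" and ?y = "partial_weight \<alpha> \<beta> ws (w lam) j"
  have ws': "set ws \<subseteq> {0..DIM('a)}" "w = word_map (srefl \<alpha> \<beta>) ws" "length ws = wlen \<alpha> \<beta> w"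
    using ws by (auto simp: reduced_expression_def expression_def)
  have lam: "fold (srefl \<alpha> \<beta>) ws (w lam) = lam"
    using ws' fold_srefl_word_map by simp
  \<comment> \<open>Any word joining the two weights yields a competitor of \<open>w\<close> that
    carries \<open>lam\<close> to the same minuscule weight.\<close>
  have min: "length ws \<le> length vs"
    if vs: "set vs \<subseteq> {0..DIM('a)}" "fold (srefl \<alpha> \<beta>) vs (w lam) = lam" for vs
  proof -
    let ?v = "word_map (srefl \<alpha> \<beta>) vs"
    have "?v lam = w lam" using word_map_fold_srefl[OF vs(1), of "w lam"] vs(2) by simp
    moreover have "?v \<in> W \<alpha> \<beta>" using vs(1) by (auto simp: W_def)
    ultimately have "wlen \<alpha> \<beta> w \<le> wlen \<alpha> \<beta> ?v"
      using w unfolding shortest_to_minuscule_def by simp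
    also have "\<dots> \<le> length vs" unfolding wlen_def
      by (rule Least_le) (use vs(1) in \<open>auto simp: expression_def\<close>)
    finally show ?thesis using ws' by simp
  qed
  have split: "fold (srefl \<alpha> \<beta>) (drop (Suc j) ws) (srefl \<alpha> \<beta> ?i ?y) = lam"
  proof -
    have "ws = take j ws @ ?i # drop (Suc j) ws" using j by (simp add: id_take_nth_drop)
    then have "lam = fold (srefl \<alpha> \<beta>) (take j ws @ ?i # drop (Suc j) ws) (w lam)" using lam by simp
    then show ?thesis by (simp add: partial_weight_def)
  qed
  have i: "?i \<in> {0..DIM('a)}" using ws'(1) j nth_mem by blast
  have sub: "set (take j ws) \<subseteq> {0..DIM('a)}" "set (drop (Suc j) ws) \<subseteq> {0..DIM('a)}"
    using ws'(1) set_take_subset set_drop_subset by (metis subset_trans)+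
  have "\<exists>vs. set vs \<subseteq> {0..DIM('a)} \<and> length vs \<le> j \<and> fold (srefl \<alpha> \<beta>) vs (w lam) = srefl \<alpha> \<beta> ?i ?y"
  proof (cases "ev (sroot ?i) ?y = 0")
    case True
    then show ?thesis using sub by (intro exI[of _ "take j ws"]) (simp add: srefl_eq_aff_refl
        aff_refl_fixed partial_weight_def)
  next
    case False
    then have neg: "ev (sroot ?i) (fold (srefl \<alpha> \<beta>) (take j ws) (w lam)) < 0"
      using not_pos by (simp add: partial_weight_def)
    have alcove: "0 \<le> ev a (w lam)" if "a \<in> pos_affine" for a
      using w minuscule_alcove that unfolding shortest_to_minuscule_def by blast
    obtain vs where "set vs \<subseteq> {0..DIM('a)}" "length vs < length (take j ws)"
      "fold (srefl \<alpha> \<beta>) vs (w lam) = aff_refl (sroot ?i) (fold (srefl \<alpha> \<beta>) (take j ws) (w lam))"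
      using strong_exchange[OF alcove sub(1) sroot_in_pos_affine[OF i] neg] by blast
    then show ?thesis by (intro exI[of _ vs]) (auto simp: srefl_eq_aff_refl partial_weight_def)
  qed
  then obtain vs where vs: "set vs \<subseteq> {0..DIM('a)}" "length vs \<le> j"
    "fold (srefl \<alpha> \<beta>) vs (w lam) = srefl \<alpha> \<beta> ?i ?y" by blast
  have "length ws \<le> length (vs @ drop (Suc j) ws)"
    by (rule min) (use vs sub split in auto)
  then show False using vs(2) j by simp
qed


section \<open>The Bruhat order on weights\<close>

text \<open>An upward step passes from the positive to the negative side of a hyperplane, away from
  the alcove. Within a \<open>W0\<close>-orbit this order runs against dominance: the dominant
  weight is the lowest.\<close>

definition up :: "'a \<Rightarrow> 'a \<Rightarrow> bool" where
  "up x y \<longleftrightarrow> (\<exists>a\<in>pos_affine. 0 < ev a x \<and> y = aff_refl a x)"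

abbreviation wle :: "'a \<Rightarrow> 'a \<Rightarrow> bool" where
  "wle \<equiv> up\<^sup>*\<^sup>*"

lemma up_srefl: "i \<in> {0..DIM('a)} \<Longrightarrow> 0 < ev (sroot i) x \<Longrightarrow> up x (srefl \<alpha> \<beta> i x)"
  unfolding up_def srefl_eq_aff_refl using sroot_in_pos_affine by blast

lemma wle_srefl: "i \<in> {0..DIM('a)} \<Longrightarrow> 0 \<le> ev (sroot i) x \<Longrightarrow> wle x (srefl \<alpha> \<beta> i x)"
  using up_srefl[of i x] aff_refl_fixed[of "sroot i" x]
  by (cases "ev (sroot i) x = 0") (auto simp: srefl_eq_aff_refl)

lemma ev_srefl: "i \<in> {0..DIM('a)} \<Longrightarrow> ev (sroot i) (srefl \<alpha> \<beta> i x) = - ev (sroot i) x"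
  by (simp add: srefl_eq_aff_refl ev_aff_refl_self sroot_nonzero)

text \<open>Conjugation by s_i turns a step along \<open>a\<close> into one along the image of
  \<open>a\<close>, which is again positive unless \<open>a\<close> is the simple root
  itself.\<close>

lemma up_simple:
  assumes i: "i \<in> {0..DIM('a)}" and "up x y"
  shows "y = srefl \<alpha> \<beta> i x \<or> up (srefl \<alpha> \<beta> i x) (srefl \<alpha> \<beta> i y)"
proof -
  obtain a where a: "a \<in> pos_affine" "0 < ev a x" "y = aff_refl a x" using assms(2)
      by (auto simp: up_def)
  show ?thesis
  proof (cases "a = sroot i")
    case False
    let ?b = "sroot i"
    have "ev (aff_image ?b a) (aff_refl ?b x) = ev a x" "aff_refl (aff_image ?b a) (aff_refl ?b x)
        = aff_refl ?b y"
      using a sroot_nonzero[OF i] by (simp_all add: ev_aff_image aff_refl_aff_refl aff_refl_aff_image)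
    then have "up (aff_refl ?b x) (aff_refl ?b y)"
      unfolding up_def using aff_image_sroot_pos_affine[OF i a(1) False] a(2) by metis
    then show ?thesis by (simp add: srefl_eq_aff_refl)
  qed (use a in \<open>simp add: srefl_eq_aff_refl\<close>)
qed

text \<open>The lifting property: a chain is transported by s_i until it contains the step of s_i
  itself, and then the upward step from y closes the gap. It controls the support after s_i is
  applied to an eigenvector.\<close>

lemma wle_lift:
  assumes i: "i \<in> {0..DIM('a)}" and le: "wle x y" and pos: "0 < ev (sroot i) y"
  shows "wle (srefl \<alpha> \<beta> i x) (srefl \<alpha> \<beta> i y)"
  using le
proof (induction rule: converse_rtranclp_induct)
  case (step x z)
  from up_simple[OF i step.hyps(1)] show ?case
  proof
    assume "z = srefl \<alpha> \<beta> i x"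
    then show ?thesis using step.hyps(2) up_srefl[OF i pos] by (metis rtranclp.rtrancl_into_rtrancl)
  next
    assume "up (srefl \<alpha> \<beta> i x) (srefl \<alpha> \<beta> i z)"
    then show ?thesis using step.IH by (rule converse_rtranclp_into_rtranclp)
  qed
qed simp

definition lower :: "nat \<Rightarrow> 'a \<Rightarrow> 'a" where
  "lower i x = (if 0 \<le> ev (sroot i) x then x else srefl \<alpha> \<beta> i x)"

text \<open>Companion of the lifting property for the lower member of each pair x, s_i x; it makes
  dominant weights minimal in their orbits.\<close>

lemma wle_lower:
  assumes i: "i \<in> {0..DIM('a)}" and le: "wle x y"
  shows "wle (lower i x) (lower i y)"
  using le
proof (induction rule: rtranclp_induct)
  case (step y z)
  let ?s = "srefl \<alpha> \<beta> i"
  have "wle (lower i y) (lower i z)"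
    using up_simple[OF i step.hyps(2)]
  proof
    assume z: "z = ?s y"
    then have "lower i y = lower i z"
      using ev_srefl[OF i, of y] srefl_srefl[OF i, of y] aff_refl_fixed[of "sroot i" y]
      by (cases "ev (sroot i) y = 0") (auto simp: lower_def srefl_eq_aff_refl)
    then show ?thesis by simp
  next
    assume s: "up (?s y) (?s z)"
    have "wle (?s y) y" if "\<not> 0 \<le> ev (sroot i) y"
      using wle_srefl[OF i, of "?s y"] that by (simp add: ev_srefl[OF i] srefl_srefl[OF i])
    then show ?thesis using s step.hyps(2) wle_srefl[OF i, of y]
      by (auto simp: lower_def intro: rtranclp.rtrancl_into_rtrancl)
  qed
  then show ?case using step.IH by (rule rtranclp_trans[rotated])
qed simp

text \<open>A step along (r, \<gamma>) with value p at x places x on the \<gamma>-string between y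
  and its reflection, p steps from y and r steps from the reflection. Both descriptions are recorded
  because the sign of a transformed \<gamma> decides which one is useful. The last equation shows
  that the norm grows exactly when r > 0.\<close>

lemma up_cases:
  assumes "up x y" "x \<in> P"
  obtains r \<gamma> p where "r \<in> \<int>" "0 \<le> r" "p \<in> \<int>" "0 < p" "\<gamma> \<in> R" "r = 0 \<Longrightarrow> \<gamma> \<in> Pos"
    "x = y + p *\<^sub>R \<gamma>" "x = refl \<gamma> y - r *\<^sub>R \<gamma>" "y \<bullet> y = x \<bullet> x + (\<gamma> \<bullet> \<gamma>) * p * r"
proof -
  obtain a where a: "a \<in> pos_affine" "0 < ev a x" "y = aff_refl a x" using assms(1)
      by (auto simp: up_def)
  define r \<gamma> p where "r = fst a" and "\<gamma> = snd a" and "p = ev a x"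
  have \<gamma>: "\<gamma> \<in> R" "\<gamma> \<noteq> 0" using a PhpD snd_pos_affine_nonzero by (auto simp: \<gamma>_def)
  have y: "y = x - p *\<^sub>R \<gamma>" by (simp add: a(3) aff_refl_def p_def \<gamma>_def)
  have p: "p = r + coroot \<gamma> \<bullet> x" by (simp add: p_def ev_def r_def \<gamma>_def)
  have 1: "x = y + p *\<^sub>R \<gamma>" by (simp add: y)
  have "refl \<gamma> y = refl \<gamma> x + p *\<^sub>R \<gamma>"
    by (simp add: y linear_diff[OF linear_refl] linear_scale[OF linear_refl] refl_self)
  then have 2: "x = refl \<gamma> y - r *\<^sub>R \<gamma>" by (simp add: refl_def p algebra_simps)
  have x: "\<gamma> \<bullet> x = (p - r) * (\<gamma> \<bullet> \<gamma>) / 2"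
    using \<gamma>(2) by (simp add: p coroot_def)
  have "y \<bullet> y = x \<bullet> x - 2 * p * (\<gamma> \<bullet> x) + p * p * (\<gamma> \<bullet> \<gamma>)"
    by (simp add: y inner_diff_left inner_diff_right inner_commute)
  also have "\<dots> = x \<bullet> x + (\<gamma> \<bullet> \<gamma>) * p * r"
    unfolding x by (simp add: field_simps)
  finally have 3: "y \<bullet> y = x \<bullet> x + (\<gamma> \<bullet> \<gamma>) * p * r" .
  show thesis
  proof (rule that[OF _ _ _ _ \<gamma>(1) _ 1 2 3])
    show "r \<in> \<int>" "0 \<le> r" using PhpD(1,3)[OF a(1)] by (simp_all add: r_def)
    show "p \<in> \<int>" using ev_Ints[OF a(1) assms(2)] by (simp add: p_def)
    show "0 < p" using a(2) by (simp add: p_def)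
    show "\<gamma> \<in> Pos" if "r = 0" using PhpD(4)[OF a(1)] that by (simp add: r_def \<gamma>_def)
  qed
qed

lemma up_weight: "up x y \<Longrightarrow> x \<in> P \<Longrightarrow> y \<in> P"
  using aff_refl_weight by (auto simp: up_def)

lemma wle_weight: "wle x y \<Longrightarrow> x \<in> P \<Longrightarrow> y \<in> P"
  by (induction rule: rtranclp_induct) (auto intro: up_weight)

text \<open>Where the norm stays constant all steps have level 0, so they are ordinary reflections,
  each subtracting a positive multiple of a positive root.\<close>

lemma wle_inner:
  assumes "wle x y" "x \<in> P"
  shows "x \<bullet> x \<le> y \<bullet> y \<and> (x \<bullet> x = y \<bullet> y \<longrightarrow> x - y \<in> root_cone)"
  using assms(1)
proof (induction rule: rtranclp_induct)
  case base
  show ?case using root_cone_0 by simp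
next
  case (step y z)
  have y: "y \<in> P" using step.hyps(1) assms(2) wle_weight by blast
  obtain r \<gamma> p where c: "r \<in> \<int>" "0 \<le> r" "p \<in> \<int>" "0 < p" "\<gamma> \<in> R" "r = 0 \<Longrightarrow> \<gamma> \<in> Pos"
    "y = z + p *\<^sub>R \<gamma>" "z \<bullet> z = y \<bullet> y + (\<gamma> \<bullet> \<gamma>) * p * r"
    using up_cases[OF step.hyps(2) y] by metis
  have pos: "0 < (\<gamma> \<bullet> \<gamma>) * p" using c root_nonzero by simp
  then have "0 \<le> (\<gamma> \<bullet> \<gamma>) * p * r" using c(2) by simp
  moreover have "x - z \<in> root_cone" if "x \<bullet> x = z \<bullet> z"
  proof -
    have "(\<gamma> \<bullet> \<gamma>) * p * r = 0" and eq: "x \<bullet> x = y \<bullet> y"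
      using that step.IH c(8) calculation by linarith+
    then have "r = 0" using pos by (metis mult_eq_0_iff order_less_irrefl)
    then have "p *\<^sub>R \<gamma> \<in> root_cone" using root_cone_scaled_root c by simp
    moreover have "x - z = (x - y) + p *\<^sub>R \<gamma>" using c(7) by simp
    ultimately show ?thesis using root_cone_add step.IH eq by metis
  qed
  ultimately show ?case using step.IH c(8) by linarith
qed

lemma wle_antisym:
  assumes "wle x y" "wle y x" "x \<in> P" shows "x = y"
proof -
  have "y \<in> P" using assms wle_weight by blast
  have "x \<bullet> x = y \<bullet> y" using wle_inner[OF assms(1,3)] wle_inner[OF assms(2) \<open>y \<in> P\<close>] by linarith
  then have "x - y \<in> root_cone" "- (x - y) \<in> root_cone"
      using wle_inner[OF assms(1,3)] wle_inner[OF assms(2) \<open>y \<in> P\<close>] by auto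
  then show ?thesis using root_cone_antisym by fastforce
qed


section \<open>Dominant weights and orbits\<close>

lemma dominant_weight: "lam \<in> dominant_weights R \<alpha> \<Longrightarrow> lam \<in> P"
  by (simp add: dominant_weights_def)

text \<open>A dominant weight is lowest in its orbit for \<open>wle\<close>; as the norm is constant
  on the orbit, \<open>wle_inner\<close> converts this into dominance.\<close>

lemma dominant_minus_orbit:
  assumes lam: "lam \<in> dominant_weights R \<alpha>" and u: "u \<in> W0 \<alpha>"
  shows "lam - u lam \<in> root_cone"
proof -
  have "wle lam (u lam)" using u
  proof (induction rule: W0_induct)
    case (step i u)
    have i: "i \<in> {0..DIM('a)}" and i0: "i \<noteq> 0" using step.hyps(1) by auto
    have s: "(refl (\<alpha> i) \<circ> u) lam = srefl \<alpha> \<beta> i (u lam)" using i0 by (simp add: srefl_def)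
    show ?case
    proof (cases "0 \<le> ev (sroot i) (u lam)")
      case True
      then show ?thesis unfolding s using wle_srefl[OF i] step.IH by (meson rtranclp_trans)
    next
      case False
      have "0 \<le> ev (sroot i) lam" using lam simple_in_Pos[OF step.hyps(1)] i0
        by (simp add: ev_def sroot_def dominant_weights_def)
      then show ?thesis unfolding s using wle_lower[OF i step.IH] False by (simp add: lower_def)
    qed
  qed simp
  from wle_inner[OF this dominant_weight[OF lam]] show ?thesis using inner_W0[OF u] by simp
qed

text \<open>One step puts x between z and its reflection on a \<gamma>-string. Hence u x is
  dominated by u applied to the reflection of z if u \<gamma> is positive, and by u z
  otherwise.\<close>

lemma below_saturated:
  assumes "wle x y" "x \<in> P" "\<And>u. u \<in> W0 \<alpha> \<Longrightarrow> lam - u y \<in> root_cone" "u \<in> W0 \<alpha>"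
  shows "lam - u x \<in> root_cone"
  using assms(1,2,4)
proof (induction arbitrary: u rule: converse_rtranclp_induct)
  case base
  then show ?case using assms(3) by blast
next
  case (step x z)
  note u = step.prems(2)
  have z: "z \<in> P" using up_weight step by blast
  obtain r \<gamma> p where c: "r \<in> \<int>" "0 \<le> r" "p \<in> \<int>" "0 < p" "\<gamma> \<in> R"
    "x = z + p *\<^sub>R \<gamma>" "x = refl \<gamma> z - r *\<^sub>R \<gamma>"
    using up_cases[OF step.hyps(1) step.prems(1)] by metis
  note lin = linear_add[OF linear_W0[OF u]] linear_diff[OF linear_W0[OF u]] linear_scale[OF
      linear_W0[OF u]]
  show ?case
  proof (cases "u \<gamma> \<in> Pos")
    case True
    have "lam - u x = (lam - (u \<circ> refl \<gamma>) z) + r *\<^sub>R u \<gamma>"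
      by (subst c(7)) (simp add: lin)
    moreover have "lam - (u \<circ> refl \<gamma>) z \<in> root_cone" using step.IH z W0_comp u refl_in_W0 c(5) by blast
    ultimately show ?thesis using root_cone_add root_cone_scaled_root True c by metis
  next
    case False
    then have "- u \<gamma> \<in> Pos" using pos_or_neg W0_in_R u c(5) by blast
    moreover have "lam - u x = (lam - u z) + p *\<^sub>R (- u \<gamma>)"
      by (subst c(6)) (simp add: lin)
    ultimately show ?thesis using root_cone_add root_cone_scaled_root step.IH z u c
        by (metis less_imp_le)
  qed
qed

text \<open>Take an orbit point of greatest height: a negative pairing with a simple root could be
  exploited by reflecting to increase the height.\<close>

lemma dominant_representative:
  assumes "\<nu> \<in> P" shows "\<exists>u\<in>W0 \<alpha>. u \<nu> \<in> dominant_weights R \<alpha>"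
proof -
  let ?S = "(\<lambda>u. two_rho \<bullet> u \<nu>) ` W0 \<alpha>"
  obtain u where u: "u \<in> W0 \<alpha>" and max: "two_rho \<bullet> u \<nu> = Max ?S"
    by (rule obtains_MAX[of "W0 \<alpha>" "\<lambda>u. two_rho \<bullet> u \<nu>"]) (use finite_W0 id_in_W0 in auto)
  have simple_nonneg: "0 \<le> \<alpha> i \<bullet> u \<nu>" if i: "i \<in> {1..DIM('a)}" for i
  proof -
    have "two_rho \<bullet> (refl (\<alpha> i) \<circ> u) \<nu> \<in> ?S"
      using W0_comp[OF simple_refl_in_W0[OF i] u] by (rule imageI)
    then have "two_rho \<bullet> refl (\<alpha> i) (u \<nu>) \<le> two_rho \<bullet> u \<nu>"
      unfolding max using finite_W0 by (intro Max_ge) auto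
    then have "0 \<le> (coroot (\<alpha> i) \<bullet> u \<nu>) * (two_rho \<bullet> \<alpha> i)"
      by (simp add: refl_def inner_diff_right)
    then have "0 \<le> coroot (\<alpha> i) \<bullet> u \<nu>" using two_rho_simple[OF i] by (simp add: zero_le_mult_iff)
    then show ?thesis using root_nonzero[OF simple_in_R[OF i]]
      by (auto simp: coroot_def zero_le_divide_iff dest: order_antisym[OF _ inner_ge_zero])
  qed
  have "0 \<le> coroot \<gamma> \<bullet> u \<nu>" if "\<gamma> \<in> Pos" for \<gamma>
  proof -
    obtain c where c: "\<gamma> = (\<Sum>j\<in>{1..DIM('a)}. real (c j) *\<^sub>R \<alpha> j)"
      using \<open>\<gamma> \<in> Pos\<close> by (rule PosE)
    have "\<gamma> \<bullet> u \<nu> = (\<Sum>j\<in>{1..DIM('a)}. real (c j) * (\<alpha> j \<bullet> u \<nu>))"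
      by (subst c) (simp add: inner_sum_left)
    also have "\<dots> \<ge> 0" using simple_nonneg by (intro sum_nonneg mult_nonneg_nonneg) auto
    finally show ?thesis by (simp add: coroot_def)
  qed
  then show ?thesis using u W0_weight assms by (auto simp: dominant_weights_def)
qed

section \<open>Orbits, stabilizers and orbit sums\<close>

lemma finite_orbit: "finite (W0_orbit \<alpha> \<mu>)"
  by (simp add: W0_orbit_def finite_W0)

lemma orbit_eq:
  assumes "u \<in> W0 \<alpha>" shows "W0_orbit \<alpha> (u \<mu>) = W0_orbit \<alpha> \<mu>"
proof -
  obtain v where v: "v \<in> W0 \<alpha>" "v \<circ> u = id" using W0_inverse assms by blast
  have "t \<mu> \<in> (\<lambda>t. t (u \<mu>)) ` W0 \<alpha>" if "t \<in> W0 \<alpha>" for t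
  proof (rule image_eqI)
    show "t \<mu> = (t \<circ> v) (u \<mu>)" using v(2) by (metis comp_apply id_apply)
    show "t \<circ> v \<in> W0 \<alpha>" using that v W0_comp by blast
  qed
  moreover have "t (u \<mu>) \<in> (\<lambda>t. t \<mu>) ` W0 \<alpha>" if "t \<in> W0 \<alpha>" for t
    using W0_comp[OF that assms] by (metis comp_apply image_eqI)
  ultimately show ?thesis unfolding W0_orbit_def by blast
qed

lemma card_W0_pos: "0 < card (W0 \<alpha>)"
  using finite_W0 id_in_W0 card_gt_0_iff by blast

lemma bij_W0_comp:
  assumes "v \<in> W0 \<alpha>" shows "bij_betw (\<lambda>u. v \<circ> u) (W0 \<alpha>) (W0 \<alpha>)"
proof -
  obtain v' where "v' \<in> W0 \<alpha>" "v' \<circ> v = id" "v \<circ> v' = id" using W0_inverse assms by blast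
  then show ?thesis using W0_comp assms
    by (intro bij_betw_byWitness[where f' = "\<lambda>u. v' \<circ> u"]) (auto simp flip: comp_assoc)
qed

text \<open>All fibres of u \<mapsto> u \<nu> are translates of the stabilizer, whose order is
  therefore the displayed quotient. This is the source of the normalising factor in the
  theorem.\<close>

lemma stabilizer_sum:
  "(\<Sum>u\<in>W0 \<alpha>. gexp (u \<nu>)) = gscale (of_nat (card (W0 \<alpha>)) / of_nat (card (W0_orbit \<alpha> \<nu>))) (orbit_sum \<alpha>
      \<nu> :: 'a \<Rightarrow>\<^sub>0 'f::field_char_0)"
proof -
  let ?O = "W0_orbit \<alpha> \<nu>"
  define s where "s = card {u \<in> W0 \<alpha>. u \<nu> = \<nu>}"
  have fibre: "card {u \<in> W0 \<alpha>. u \<nu> = \<kappa>} = s" if "\<kappa> \<in> ?O" for \<kappa>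
  proof -
    obtain v where v: "v \<in> W0 \<alpha>" "\<kappa> = v \<nu>" using \<open>\<kappa> \<in> ?O\<close> by (auto simp: W0_orbit_def)
    obtain v' where v': "v' \<in> W0 \<alpha>" "v' \<circ> v = id" "v \<circ> v' = id" using W0_inverse v by blast
    have "v' (v x) = x" for x using v'(2) by (metis comp_apply id_apply)
    then have "bij_betw (\<lambda>u. v \<circ> u) {u \<in> W0 \<alpha>. u \<nu> = \<nu>} {u \<in> W0 \<alpha>. u \<nu> = \<kappa>}"
      using v v' W0_comp
      by (intro bij_betw_byWitness[where f' = "\<lambda>u. v' \<circ> u"]) (auto simp flip: comp_assoc)
    then show ?thesis unfolding s_def by (rule bij_betw_same_card[symmetric])
  qed
  have "card (W0 \<alpha>) = (\<Sum>\<kappa>\<in>?O. card {u \<in> W0 \<alpha>. u \<nu> = \<kappa>})"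
    using sum.group[of "W0 \<alpha>" ?O "\<lambda>u. u \<nu>" "\<lambda>_. 1::nat"] finite_W0 finite_orbit
    by (simp add: W0_orbit_def)
  then have card: "card (W0 \<alpha>) = card ?O * s" using fibre by simp
  then have "card ?O \<noteq> 0" using card_W0_pos by auto
  then have s: "of_nat (card (W0 \<alpha>)) / of_nat (card ?O) = (of_nat s :: 'f)" by (simp add: card)
  have "(\<Sum>u\<in>W0 \<alpha>. gexp (u \<nu>) :: 'a \<Rightarrow>\<^sub>0 'f) = (\<Sum>\<kappa>\<in>?O. \<Sum>u\<in>{u \<in> W0 \<alpha>. u \<nu> = \<kappa>}. gexp (u \<nu>))"
    by (rule sum.group[symmetric]) (auto simp: finite_W0 finite_orbit W0_orbit_def)
  also have "\<dots> = (\<Sum>\<kappa>\<in>?O. gscale (of_nat s) (gexp \<kappa>))"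
  proof (rule sum.cong)
    fix \<kappa> assume "\<kappa> \<in> ?O"
    have "(\<Sum>u\<in>{u \<in> W0 \<alpha>. u \<nu> = \<kappa>}. gexp (u \<nu>)) = of_nat s * (gexp \<kappa> :: 'a \<Rightarrow>\<^sub>0 'f)"
      using fibre[OF \<open>\<kappa> \<in> ?O\<close>] by simp
    then show "(\<Sum>u\<in>{u \<in> W0 \<alpha>. u \<nu> = \<kappa>}. gexp (u \<nu>)) = gscale (of_nat s) (gexp \<kappa> :: 'a \<Rightarrow>\<^sub>0 'f)"
      by (simp add: gscale_conv_mult)
  qed simp
  finally show ?thesis by (simp add: s orbit_sum_def gscale_sum_right)
qed

end


section \<open>Dunkl--Cherednik operators\<close>

locale HO_datum = root_datum R \<alpha> \<beta>
  for R :: "'a::euclidean_space set" and \<alpha> \<beta> +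
  fixes orb :: "'a \<Rightarrow> 'o::linorder"
  assumes orbit_labels: "orbit_labelling R \<alpha> orb"
begin

abbreviation k :: "'a \<Rightarrow> 'o ratfun" where "k \<equiv> kpar orb"

lemma k_W0: "u \<in> W0 \<alpha> \<Longrightarrow> \<gamma> \<in> R \<Longrightarrow> k (u \<gamma>) = k \<gamma>"
  using orbit_labels W0_in_R[of u \<gamma>]
  unfolding orbit_labelling_def kpar_def W0_orbit_def by (metis image_eqI)

lemma k_refl: "\<gamma> \<in> R \<Longrightarrow> \<eta> \<in> R \<Longrightarrow> k (refl \<gamma> \<eta>) = k \<eta>"
  using k_W0 refl_in_W0 by blast

lemma k_uminus: "\<gamma> \<in> R \<Longrightarrow> k (- \<gamma>) = k \<gamma>"
  using k_refl[of \<gamma> \<gamma>] by (simp add: refl_self)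

lemma kidx_eq: "kidx \<alpha> \<beta> orb i = k (snd (sroot i))"
  using k_uminus[OF \<beta>_in_R] by (simp add: kidx_def sroot_def)

text \<open>\<open>demazure \<gamma> \<mu>\<close> is the quotient of \<open>e\<^sup>\<mu> - e\<^sup>\<nu>\<close>, where \<open>\<nu>\<close> is the reflection of \<open>\<mu>\<close>, by
  \<open>1 - exp(-\<gamma>)\<close>.\<close>

definition demazure :: "'a \<Rightarrow> 'a \<Rightarrow> 'a \<Rightarrow>\<^sub>0 'o ratfun" where
  "demazure \<gamma> \<mu> = (let n = \<lfloor>coroot \<gamma> \<bullet> \<mu>\<rfloor> in
     if 0 < n then \<Sum>j<nat n. gexp (\<mu> - real j *\<^sub>R \<gamma>)
     else - (\<Sum>j=1..nat (- n). gexp (\<mu> + real j *\<^sub>R \<gamma>)))"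

lemma gexp_mult: "gexp \<mu> * gexp \<nu> = (gexp (\<mu> + \<nu>) :: 'a \<Rightarrow>\<^sub>0 'f::field)"
  by (simp add: gexp_def mult_single)

text \<open>A telescoping geometric sum for each sign of the Cartan integer; for value 0 the sum is
  empty, in accordance with \<mu> being fixed.\<close>

lemma demazure_mult:
  assumes "\<gamma> \<in> R" "\<mu> \<in> P"
  shows "(1 - gexp (- \<gamma>)) * demazure \<gamma> \<mu> = gexp \<mu> - gexp (refl \<gamma> \<mu>)"
proof -
  obtain n where n: "coroot \<gamma> \<bullet> \<mu> = of_int n"
    using assms by (auto simp: weight_lattice_def elim: Ints_cases)
  have down: "(1 - gexp (- \<gamma>)) * (\<Sum>j<m. gexp (\<mu> - real j *\<^sub>R \<gamma>))
      = (gexp \<mu> - gexp (\<mu> - real m *\<^sub>R \<gamma>) :: 'a \<Rightarrow>\<^sub>0 'o ratfun)" for m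
  proof (induction m)
    case (Suc m)
    have "gexp (- \<gamma>) * gexp (\<mu> - real m *\<^sub>R \<gamma>) = (gexp (\<mu> - real (Suc m) *\<^sub>R \<gamma>) :: 'a \<Rightarrow>\<^sub>0 'o ratfun)"
      by (simp add: gexp_mult algebra_simps)
    then show ?case using Suc by (simp only: sum.lessThan_Suc distrib_left left_diff_distrib) simp
  qed simp
  have up: "(1 - gexp (- \<gamma>)) * - (\<Sum>j=1..m. gexp (\<mu> + real j *\<^sub>R \<gamma>))
      = (gexp \<mu> - gexp (\<mu> + real m *\<^sub>R \<gamma>) :: 'a \<Rightarrow>\<^sub>0 'o ratfun)" for m
  proof (induction m)
    case (Suc m)
    have "gexp (- \<gamma>) * gexp (\<mu> + real (Suc m) *\<^sub>R \<gamma>) = (gexp (\<mu> + real m *\<^sub>R \<gamma>) :: 'a \<Rightarrow>\<^sub>0 'o ratfun)"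
      by (simp add: gexp_mult algebra_simps)
    moreover have "(\<Sum>j=1..Suc m. gexp (\<mu> + real j *\<^sub>R \<gamma>))
        = (\<Sum>j=1..m. gexp (\<mu> + real j *\<^sub>R \<gamma>)) + (gexp (\<mu> + real (Suc m) *\<^sub>R \<gamma>) :: 'a \<Rightarrow>\<^sub>0 'o ratfun)"
      by simp
    ultimately show ?case using Suc
      by (simp only: minus_add_distrib distrib_left left_diff_distrib mult_minus_right) simp
  qed simp
  show ?thesis
  proof (cases "0 < n")
    case True
    then show ?thesis using down[of "nat n"] by (simp add: demazure_def n refl_def)
  next
    case False
    then show ?thesis using up[of "nat (- n)"] by (simp add: demazure_def n refl_def)
  qed
qed

text \<open>The Cherednik operator \<partial>_y + sum of k_\<gamma> (y, \<gamma>) (1 -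
  s_\<gamma>)/(1 - e^(-\<gamma>)) - (\<rho>, y) on an exponential; the halves add up to the shift by
  \<rho>.\<close>

definition Dunkl_exp :: "'a \<Rightarrow> 'a \<Rightarrow> 'a \<Rightarrow>\<^sub>0 'o ratfun" where
  "Dunkl_exp y \<mu> = gscale (const (y \<bullet> \<mu>)) (gexp \<mu>) +
     (\<Sum>\<gamma>\<in>Pos. gscale (k \<gamma> * const (y \<bullet> \<gamma>)) (demazure \<gamma> \<mu> - gscale (1/2) (gexp \<mu>)))"

definition Dunkl :: "'a \<Rightarrow> ('a \<Rightarrow>\<^sub>0 'o ratfun) \<Rightarrow> 'a \<Rightarrow>\<^sub>0 'o ratfun" where
  "Dunkl y = linext (Dunkl_exp y)"

section \<open>The operators in terms of affine roots\<close>

definition nonpos_affine :: "'a \<Rightarrow> (real \<times> 'a) set" where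
  "nonpos_affine \<mu> = {a \<in> pos_affine. ev a \<mu> \<le> 0}"

text \<open>A root vanishing at \<mu> contributes a multiple of e^\<mu> itself. Its weight 1/2
  merges the term e^\<mu> of the divided difference, present or absent, with the shift by one
  half.\<close>

definition wt :: "real \<Rightarrow> 'o ratfun" where
  "wt t = (if t = 0 then 1/2 else 1)"

lemma finite_nonpos_affine: "finite (nonpos_affine \<mu>)"
proof (rule finite_subset)
  show "nonpos_affine \<mu> \<subseteq> (\<Union>\<gamma>\<in>R. (\<lambda>r. (of_int r, \<gamma>)) ` {0..\<lfloor>- (coroot \<gamma> \<bullet> \<mu>)\<rfloor>})"
  proof
    fix a assume a: "a \<in> nonpos_affine \<mu>"
    then have "fst a \<in> \<int>" using PhpD(1) by (simp add: nonpos_affine_def)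
    then obtain r where r: "fst a = of_int r" by (rule Ints_cases)
    have "0 \<le> r" "r \<le> \<lfloor>- (coroot (snd a) \<bullet> \<mu>)\<rfloor>" "snd a \<in> R"
      using a r PhpD(2,3)[of a] by (auto simp: nonpos_affine_def ev_def le_floor_iff)
    then show "a \<in> (\<Union>\<gamma>\<in>R. (\<lambda>r. (of_int r, \<gamma>)) ` {0..\<lfloor>- (coroot \<gamma> \<bullet> \<mu>)\<rfloor>})"
      using r by (auto simp: prod_eq_iff intro!: bexI[of _ "snd a"] image_eqI[of _ _ r])
  qed
qed (use finite_R in auto)

text \<open>Only the direction -\<gamma> can be nonpositive at \<mu>, with levels 1 to m; level 0 is
  missing because -\<gamma> is not positive. The index j is minus the value of the affine root at
  \<mu>.\<close>

lemma nonpos_affine_string_pos: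
  assumes \<gamma>: "\<gamma> \<in> Pos" and n: "coroot \<gamma> \<bullet> \<mu> = real m" "0 < m"
  shows "{a \<in> nonpos_affine \<mu>. (if snd a \<in> Pos then snd a else - snd a) = \<gamma>} = (\<lambda>j. (real m
      - real j, - \<gamma>)) ` {..<m}"
proof (intro set_eqI iffI)
  fix a assume "a \<in> {a \<in> nonpos_affine \<mu>. (if snd a \<in> Pos then snd a else - snd a) = \<gamma>}"
  then have a: "a \<in> pos_affine" "ev a \<mu> \<le> 0" "(if snd a \<in> Pos then snd a else - snd a) = \<gamma>"
      by (auto simp: nonpos_affine_def)
  have "snd a \<noteq> \<gamma>" using a(2) n PhpD(3)[OF a(1)] by (auto simp: ev_def)
  then have s: "snd a = - \<gamma>" using a(3) by (auto split: if_splits)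
  then have "snd a \<notin> Pos" using Pos_not_neg \<gamma> by simp
  then have "fst a \<noteq> 0" using PhpD(4)[OF a(1)] by auto
  moreover obtain r where r: "fst a = of_int r" using PhpD(1)[OF a(1)] by (auto elim: Ints_cases)
  ultimately have "0 < r" "r \<le> int m" using a(2) s n PhpD(3)[OF a(1)] by (auto simp: ev_def)
  then show "a \<in> (\<lambda>j. (real m - real j, - \<gamma>)) ` {..<m}"
    using r s by (intro image_eqI[of _ _ "nat (int m - r)"]) (auto simp: prod_eq_iff)
next
  fix a assume "a \<in> (\<lambda>j. (real m - real j, - \<gamma>)) ` {..<m}"
  then obtain j where "j < m" "a = (real m - real j, - \<gamma>)" by auto
  then show "a \<in> {a \<in> nonpos_affine \<mu>. (if snd a \<in> Pos then snd a else - snd a) = \<gamma>}"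
    using \<gamma> n Pos_not_neg[OF \<gamma>] uminus_in_R Pos_subset
        by (auto simp: nonpos_affine_def pos_affine_def ev_def)
qed

text \<open>Now the direction is \<gamma>, for which level 0 does occur; hence \<open>{..m}\<close>
  in place of \<open>{..<m}\<close>.\<close>

lemma nonpos_affine_string_nonpos:
  assumes \<gamma>: "\<gamma> \<in> Pos" and n: "coroot \<gamma> \<bullet> \<mu> = - real m"
  shows "{a \<in> nonpos_affine \<mu>. (if snd a \<in> Pos then snd a else - snd a) = \<gamma>} = (\<lambda>j. (real m
      - real j, \<gamma>)) ` {..m}"
proof (intro set_eqI iffI)
  fix a assume "a \<in> {a \<in> nonpos_affine \<mu>. (if snd a \<in> Pos then snd a else - snd a) = \<gamma>}"
  then have a: "a \<in> pos_affine" "ev a \<mu> \<le> 0" "(if snd a \<in> Pos then snd a else - snd a) = \<gamma>"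
      by (auto simp: nonpos_affine_def)
  have s: "snd a = \<gamma>"
  proof (rule ccontr)
    assume "snd a \<noteq> \<gamma>"
    then have s: "snd a = - \<gamma>" using a(3) by (auto split: if_splits)
    then have "snd a \<notin> Pos" using Pos_not_neg \<gamma> by simp
    then have "0 < fst a" using PhpD(3,4)[OF a(1)] by fastforce
    then show False using a(2) s n by (simp add: ev_def)
  qed
  obtain r where r: "fst a = of_int r" using PhpD(1)[OF a(1)] by (auto elim: Ints_cases)
  then have "0 \<le> r" "r \<le> int m" using a(2) s n PhpD(3)[OF a(1)] by (auto simp: ev_def)
  then show "a \<in> (\<lambda>j. (real m - real j, \<gamma>)) ` {..m}"
    using r s by (intro image_eqI[of _ _ "nat (int m - r)"]) (auto simp: prod_eq_iff)
next
  fix a assume "a \<in> (\<lambda>j. (real m - real j, \<gamma>)) ` {..m}"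
  then obtain j where "j \<le> m" "a = (real m - real j, \<gamma>)" by auto
  then show "a \<in> {a \<in> nonpos_affine \<mu>. (if snd a \<in> Pos then snd a else - snd a) = \<gamma>}"
    using \<gamma> n Pos_subset by (auto simp: nonpos_affine_def pos_affine_def ev_def)
qed

text \<open>The affine reflections in the directions \<gamma> and -\<gamma> send \<mu> to the
  exponents of \<open>demazure \<gamma> \<mu>\<close> and to \<mu> itself; the direction that occurs
  accounts for the opposite signs in the two cases of the divided difference.\<close>

lemma string_sum:
  assumes \<gamma>: "\<gamma> \<in> Pos" and \<mu>: "\<mu> \<in> P"
  shows "(\<Sum>a\<in>{a \<in> nonpos_affine \<mu>. (if snd a \<in> Pos then snd a else - snd a) = \<gamma>}.
      gscale (k (snd a) * const (y \<bullet> snd a) * wt (ev a \<mu>)) (gexp (aff_refl a \<mu>)))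
    = - gscale (k \<gamma> * const (y \<bullet> \<gamma>)) (demazure \<gamma> \<mu> - gscale (1/2) (gexp \<mu>))"
proof -
  have \<gamma>R: "\<gamma> \<in> R" using \<gamma> Pos_subset by auto
  let ?K = "k \<gamma> * const (y \<bullet> \<gamma>) :: 'o ratfun"
  obtain n where n: "coroot \<gamma> \<bullet> \<mu> = of_int n"
    using \<mu> \<gamma>R by (auto simp: weight_lattice_def elim: Ints_cases)
  show ?thesis
  proof (cases "0 < n")
    case True
    define m where "m = nat n"
    have m: "coroot \<gamma> \<bullet> \<mu> = real m" "0 < m" using True n by (auto simp: m_def)
    have inj: "inj_on (\<lambda>j. (real m - real j, - \<gamma>)) {..<m}" by (auto intro: inj_onI)
    have wt: "wt (- real j) = 1 - (if j = 0 then 1/2 else 0)" for j by (simp add: wt_def)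
    have ev: "ev (real m - real j, - \<gamma>) \<mu> = - real j" for j using m by (simp add: ev_def)
    have "(\<Sum>a\<in>{a \<in> nonpos_affine \<mu>. (if snd a \<in> Pos then snd a else - snd a) = \<gamma>}.
        gscale (k (snd a) * const (y \<bullet> snd a) * wt (ev a \<mu>)) (gexp (aff_refl a \<mu>)))
      = (\<Sum>j<m. gscale (- ?K * wt (- real j)) (gexp (\<mu> - real j *\<^sub>R \<gamma>)))"
      unfolding nonpos_affine_string_pos[OF \<gamma> m]
      by (subst sum.reindex[OF inj]) (simp add: ev aff_refl_def k_uminus[OF \<gamma>R] const_uminus)
    also have "\<dots> = (\<Sum>j<m. gscale (- ?K) (gexp (\<mu> - real j *\<^sub>R \<gamma>)) - (if j
        = 0 then gscale (- ?K * (1/2)) (gexp \<mu>) else 0))"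
      by (rule sum.cong[OF refl]) (simp add: wt right_diff_distrib gscale_diff_left gscale_uminus_left)
    also have "\<dots> = gscale (- ?K) (\<Sum>j<m. gexp (\<mu> - real j *\<^sub>R \<gamma>)) - gscale (- ?K * (1/2)) (gexp \<mu>)"
      using m(2) by (simp add: sum_subtractf gscale_sum_right)
    also have "\<dots> = - gscale ?K (demazure \<gamma> \<mu> - gscale (1/2) (gexp \<mu>))"
      using True by (simp add: demazure_def n m_def gscale_lin)
    finally show ?thesis .
  next
    case False
    define m where "m = nat (- n)"
    have m: "coroot \<gamma> \<bullet> \<mu> = - real m" using False n by (auto simp: m_def)
    have inj: "inj_on (\<lambda>j. (real m - real j, \<gamma>)) {..m}" by (auto intro: inj_onI)
    have ev: "ev (real m - real j, \<gamma>) \<mu> = - real j" for j using m by (simp add: ev_def)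
    have "(\<Sum>a\<in>{a \<in> nonpos_affine \<mu>. (if snd a \<in> Pos then snd a else - snd a) = \<gamma>}.
        gscale (k (snd a) * const (y \<bullet> snd a) * wt (ev a \<mu>)) (gexp (aff_refl a \<mu>)))
      = (\<Sum>j\<le>m. gscale (?K * wt (- real j)) (gexp (\<mu> + real j *\<^sub>R \<gamma>)))"
      unfolding nonpos_affine_string_nonpos[OF \<gamma> m]
      by (subst sum.reindex[OF inj]) (simp add: ev aff_refl_def)
    also have "\<dots> = gscale (?K * (1/2)) (gexp \<mu>) + (\<Sum>j=1..m. gscale (?K * wt (- real j)) (gexp (\<mu>
        + real j *\<^sub>R \<gamma>)))"
      by (simp add: atMost_atLeast0 sum.atLeast_Suc_atMost wt_def)
    also have "(\<Sum>j=1..m. gscale (?K * wt (- real j)) (gexp (\<mu> + real j *\<^sub>R \<gamma>)))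
      = gscale ?K (\<Sum>j=1..m. gexp (\<mu> + real j *\<^sub>R \<gamma>))"
      unfolding gscale_sum_right by (rule sum.cong) (auto simp: wt_def)
    also have "gscale (?K * (1/2)) (gexp \<mu>) + \<dots> = - gscale ?K (demazure \<gamma> \<mu> - gscale (1/2) (gexp \<mu>))"
      using False by (simp add: demazure_def n m_def gscale_lin)
    finally show ?thesis .
  qed
qed

text \<open>The key formula: in terms of affine roots, all simple reflections, including the affine one,
    permute the
  terms of the sum with a single exception.\<close>

lemma Dunkl_exp_nonpos_affine:
  assumes \<mu>: "\<mu> \<in> P"
  shows "Dunkl_exp y \<mu> = gscale (const (y \<bullet> \<mu>)) (gexp \<mu>) -
    (\<Sum>a\<in>nonpos_affine \<mu>. gscale (k (snd a) * const (y \<bullet> snd a) * wt (ev a \<mu>)) (gexp (aff_refl a \<mu>)))"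
proof -
  have "(\<Sum>a\<in>nonpos_affine \<mu>. gscale (k (snd a) * const (y \<bullet> snd a) * wt (ev a \<mu>)) (gexp (aff_refl a \<mu>)))
    = (\<Sum>\<gamma>\<in>Pos. \<Sum>a\<in>{a \<in> nonpos_affine \<mu>. (if snd a \<in> Pos then snd a else - snd a) = \<gamma>}.
        gscale (k (snd a) * const (y \<bullet> snd a) * wt (ev a \<mu>)) (gexp (aff_refl a \<mu>)))"
    by (rule sum.group[symmetric])
       (use finite_nonpos_affine finite_Pos pos_or_neg PhpD(2) in \<open>auto simp: nonpos_affine_def\<close>)
  also have "\<dots> = (\<Sum>\<gamma>\<in>Pos. - gscale (k \<gamma> * const (y \<bullet> \<gamma>)) (demazure \<gamma> \<mu> - gscale (1/2) (gexp \<mu>)))"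
    using string_sum[OF _ \<mu>] by (intro sum.cong) auto
  finally show ?thesis by (simp add: Dunkl_exp_def sum_negf)
qed

lemma aff_image_sroot_ne:
  assumes i: "i \<in> {0..DIM('a)}" and a: "a \<in> pos_affine" shows "aff_image (sroot i) a \<noteq> sroot i"
proof
  assume "aff_image (sroot i) a = sroot i"
  then have "a = (- fst (sroot i), - snd (sroot i))"
    using aff_image_aff_image aff_image_self sroot_nonzero[OF i] by metis
  then show False using a PhpD(3)[OF a] PhpD(3,4)[OF sroot_in_pos_affine[OF i]] PhpD(4)[OF a]
      Pos_not_neg by fastforce
qed

text \<open>All terms except that of a_i are matched by conjugation. The root a_i is nonpositive at
  exactly one of \<mu> and s_i \<mu>, or vanishes at both and is counted half twice; so it always
  leaves the same multiple of e^\<mu>. The other correction is the translation part of s_i.\<close>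

lemma Dunkl_exp_srefl:
  assumes i: "i \<in> {0..DIM('a)}" and \<mu>: "\<mu> \<in> P"
  shows "act (srefl \<alpha> \<beta> i) (Dunkl_exp y \<mu>) = Dunkl_exp (refl (snd (sroot i)) y) (srefl \<alpha> \<beta> i \<mu>)
    - gscale (const (fst (sroot i) * (y \<bullet> snd (sroot i)))) (gexp (srefl \<alpha> \<beta> i \<mu>))
    - gscale (k (snd (sroot i)) * const (y \<bullet> snd (sroot i))) (gexp \<mu>)"
proof -
  define b s where "b = sroot i" and "s = aff_refl b"
  have b: "b \<in> pos_affine" "snd b \<noteq> 0" "snd b \<in> R" using sroot_in_pos_affine sroot_nonzero i PhpD(2)
      by (auto simp: b_def)
  have s\<mu>: "s \<mu> \<in> P" using aff_refl_weight b \<mu> by (simp add: s_def)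
  have ss: "s (s x) = x" for x using aff_refl_aff_refl b by (simp add: s_def)
  let ?y' = "refl (snd b) y"
  define F where "F a = gscale (k (snd a) * const (y \<bullet> snd a) * wt (ev a \<mu>)) (gexp (s (aff_refl a
      \<mu>)) :: 'a \<Rightarrow>\<^sub>0 'o ratfun)" for a
  define G where "G a = gscale (k (snd a) * const (?y' \<bullet> snd a) * wt (ev a (s \<mu>))) (gexp (aff_refl a
      (s \<mu>)) :: 'a \<Rightarrow>\<^sub>0 'o ratfun)" for a
  have FG: "(\<Sum>a\<in>nonpos_affine \<mu> - {b}. F a) = (\<Sum>a\<in>nonpos_affine (s \<mu>) - {b}. G a)"
  proof (rule sum.reindex_bij_witness[of _ "aff_image b" "aff_image b"])
    fix a assume a: "a \<in> nonpos_affine \<mu> - {b}"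
    then have aP: "a \<in> pos_affine" by (simp add: nonpos_affine_def)
    show "aff_image b (aff_image b a) = a" using aff_image_aff_image b by blast
    have e: "ev (aff_image b a) (s \<mu>) = ev a \<mu>" using ss by (simp add: ev_aff_image s_def)
    then show "aff_image b a \<in> nonpos_affine (s \<mu>) - {b}"
      using a aff_image_sroot_pos_affine[OF i aP] aff_image_sroot_ne[OF i aP]
          by (auto simp: nonpos_affine_def b_def)
    have "snd (aff_image b a) = refl (snd b) (snd a)" by (simp add: aff_image_def)
    moreover have "aff_refl (aff_image b a) (s \<mu>) = s (aff_refl a \<mu>)" using aff_refl_aff_image b
        by (simp add: s_def)
    ultimately show "G (aff_image b a) = F a"
      using e k_refl[OF b(3) PhpD(2)[OF aP]] by (simp add: F_def G_def refl_inner)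
  next
    fix a assume a: "a \<in> nonpos_affine (s \<mu>) - {b}"
    then have aP: "a \<in> pos_affine" by (simp add: nonpos_affine_def)
    show "aff_image b (aff_image b a) = a" using aff_image_aff_image b by blast
    have "ev (aff_image b a) \<mu> = ev a (s \<mu>)" by (simp add: ev_aff_image s_def)
    then show "aff_image b a \<in> nonpos_affine \<mu> - {b}"
      using a aff_image_sroot_pos_affine[OF i aP] aff_image_sroot_ne[OF i aP]
          by (auto simp: nonpos_affine_def b_def)
  qed
  have split: "sum H (nonpos_affine \<nu>) = sum H (nonpos_affine \<nu> - {b}) + (if ev b \<nu> \<le> 0 then H b else 0)"
    for H :: "real \<times> 'a \<Rightarrow> 'a \<Rightarrow>\<^sub>0 'o ratfun" and \<nu>
  proof (cases "b \<in> nonpos_affine \<nu>")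
    case True
    then show ?thesis using sum.remove[OF finite_nonpos_affine True, of H]
        by (simp add: nonpos_affine_def add.commute)
  qed (use b in \<open>simp add: nonpos_affine_def\<close>)
  have ev: "ev b (s \<mu>) = - ev b \<mu>" using ev_aff_refl_self b by (simp add: s_def)
  have y': "?y' \<bullet> snd b = - (y \<bullet> snd b)" by (simp add: refl_inner_commute refl_self)
  have y's: "?y' \<bullet> s \<mu> = y \<bullet> \<mu> + fst b * (y \<bullet> snd b)"
    by (simp add: refl_inner_commute s_def aff_refl_eq_refl linear_diff[OF linear_refl]
      linear_scale[OF linear_refl] refl_self inner_add_right)
  let ?K = "k (snd b) * const (y \<bullet> snd b) :: 'o ratfun"
  have last: "(if ev b \<mu> \<le> 0 then F b else 0) = (if ev b (s \<mu>) \<le> 0 then G b else 0) + gscale ?K (gexp \<mu>)"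
  proof -
    have Fb: "F b = gscale (?K * wt (ev b \<mu>)) (gexp \<mu>)"
      and Gb: "G b = gscale (- ?K * wt (ev b \<mu>)) (gexp \<mu>)"
      using ss by (simp_all add: F_def G_def ev y' wt_def const_uminus flip: s_def)
    show ?thesis
    proof (cases "ev b \<mu> = 0")
      case True
      have "F b - G b = gscale (?K * wt 0 - - ?K * wt 0) (gexp \<mu>)"
        by (simp only: Fb Gb True gscale_diff_left)
      also have "?K * wt 0 - - ?K * wt 0 = ?K" by (simp add: wt_def)
      finally show ?thesis by (simp add: True ev algebra_simps)
    next
      case False
      then show ?thesis by (auto simp: Fb Gb ev wt_def gscale_uminus_left)
    qed
  qed
  have "act s (Dunkl_exp y \<mu>) = gscale (const (y \<bullet> \<mu>)) (gexp (s \<mu>)) - sum F (nonpos_affine \<mu>)"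
    by (simp add: Dunkl_exp_nonpos_affine[OF \<mu>] linop_diff linop_sum linop_gscale F_def)
  also have "\<dots> = gscale (const (y \<bullet> \<mu>)) (gexp (s \<mu>)) - sum G (nonpos_affine (s \<mu>)) - gscale ?K (gexp \<mu>)"
    using FG last by (simp add: split)
  also have "gscale (const (y \<bullet> \<mu>)) (gexp (s \<mu>)) - sum G (nonpos_affine (s \<mu>))
    = Dunkl_exp ?y' (s \<mu>) - gscale (const (fst b * (y \<bullet> snd b))) (gexp (s \<mu>))"
    by (simp add: Dunkl_exp_nonpos_affine[OF s\<mu>] G_def y's const_add gscale_lin)
  finally show ?thesis by (simp add: s_def b_def flip: srefl_eq_aff_refl)
qed

lemma linop_Dunkl [simp]: "linop (Dunkl y)"
  by (simp add: Dunkl_def)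

lemma Dunkl_gexp: "Dunkl y (gexp \<mu>) = Dunkl_exp y \<mu>"
  by (simp add: Dunkl_def)

lemma Dunkl_srefl:
  assumes i: "i \<in> {0..DIM('a)}" and f: "supp f \<subseteq> P"
  shows "act (srefl \<alpha> \<beta> i) (Dunkl y f) = Dunkl (refl (snd (sroot i)) y) (act (srefl \<alpha> \<beta> i) f)
    - gscale (const (fst (sroot i) * (y \<bullet> snd (sroot i)))) (act (srefl \<alpha> \<beta> i) f)
    - gscale (k (snd (sroot i)) * const (y \<bullet> snd (sroot i))) f"
proof -
  let ?T = "\<lambda>f. act (srefl \<alpha> \<beta> i) (Dunkl y f)"
  let ?U = "\<lambda>f. Dunkl (refl (snd (sroot i)) y) (act (srefl \<alpha> \<beta> i) f)
    - gscale (const (fst (sroot i) * (y \<bullet> snd (sroot i)))) (act (srefl \<alpha> \<beta> i) f)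
    - gscale (k (snd (sroot i)) * const (y \<bullet> snd (sroot i))) f"
  show ?thesis
  proof (rule linop_eq[of ?T ?U])
    show "linop ?T" by (rule linop_comp) simp_all
    show "linop ?U"
      by (intro linop_minus linop_scale linop_ident linop_act linop_comp[OF linop_Dunkl linop_act])
    show "?T (gexp \<mu>) = ?U (gexp \<mu>)" if "\<mu> \<in> supp f" for \<mu>
      using Dunkl_exp_srefl[OF i] f that by (auto simp: Dunkl_gexp)
  qed
qed

lemma supp_Dunkl_exp:
  assumes "\<mu> \<in> P" shows "supp (Dunkl_exp y \<mu>) \<subseteq> P"
proof -
  have "coef (Dunkl_exp y \<mu>) \<nu> = 0" if "\<nu> \<notin> P" for \<nu>
  proof -
    have "\<mu> \<noteq> \<nu>" "\<And>a. a \<in> nonpos_affine \<mu> \<Longrightarrow> aff_refl a \<mu> \<noteq> \<nu>"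
      using that assms aff_refl_weight by (auto simp: nonpos_affine_def)
    then show ?thesis by (simp add: Dunkl_exp_nonpos_affine[OF assms] lookup_minus lookup_sum
        lookup_gexp)
  qed
  then show ?thesis by (auto simp: in_keys_iff)
qed

lemma supp_Dunkl: "supp f \<subseteq> P \<Longrightarrow> supp (Dunkl y f) \<subseteq> P"
  unfolding Dunkl_def linext_def
  by (intro supp_sum_subset order.trans[OF supp_gscale] supp_Dunkl_exp) auto


section \<open>Eigenvalues\<close>

definition zero_affine :: "'a \<Rightarrow> (real \<times> 'a) set" where
  "zero_affine \<mu> = {a \<in> pos_affine. ev a \<mu> = 0}"

text \<open>The pairing of y with the shifted weight, written through the affine roots vanishing at
  \<mu>, a form in which the effect of s_i is visible.\<close>

definition tilde_pairing :: "'a \<Rightarrow> 'a \<Rightarrow> 'o ratfun" where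
  "tilde_pairing y \<mu> = const (y \<bullet> \<mu>) - 1/2 * (\<Sum>a\<in>zero_affine \<mu>. k (snd a) * const (y \<bullet> snd a))"

text \<open>With t the pairing of \<mu> with the coroot of \<gamma>, exactly one positive affine
  root in the directions \<gamma>, -\<gamma> vanishes at \<mu>: (-t, \<gamma>) if t \<le> 0 and (t,
  -\<gamma>) if t > 0. The sign -1 at t = 0 expresses that (0, \<gamma>) is positive.\<close>

lemma tilde_pairing_Pos:
  assumes \<mu>: "\<mu> \<in> P"
  shows "tilde_pairing y \<mu> = const (y \<bullet> \<mu>) + 1/2 * (\<Sum>\<gamma>\<in>Pos. k \<gamma> * eps (coroot \<gamma> \<bullet> \<mu>) * const (y \<bullet> \<gamma>))"
proof -
  let ?h = "\<lambda>\<gamma>. if 0 < coroot \<gamma> \<bullet> \<mu> then (coroot \<gamma> \<bullet> \<mu>, - \<gamma>) else (- (coroot \<gamma> \<bullet> \<mu>), \<gamma>)"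
  let ?g = "\<lambda>a :: real \<times> 'a. if snd a \<in> Pos then snd a else - snd a"
  have "(\<Sum>a\<in>zero_affine \<mu>. k (snd a) * const (y \<bullet> snd a))
      = (\<Sum>\<gamma>\<in>Pos. - (k \<gamma> * eps (coroot \<gamma> \<bullet> \<mu>) * const (y \<bullet> \<gamma>)) :: 'o ratfun)"
  proof (rule sum.reindex_bij_witness[of _ ?h ?g])
    fix a assume "a \<in> zero_affine \<mu>"
    then have a: "a \<in> pos_affine" and "ev a \<mu> = 0" by (auto simp: zero_affine_def)
    then have e: "coroot (snd a) \<bullet> \<mu> = - fst a" by (simp add: ev_def)
    have neg: "- snd a \<in> Pos" "0 < fst a" if "snd a \<notin> Pos"
      using that PhpD[OF a] pos_or_neg by (auto simp: less_le)
    show "?h (?g a) = a" using e PhpD(3)[OF a] neg by (auto simp: prod_eq_iff)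
    show "?g a \<in> Pos" using neg by auto
    show "- (k (?g a) * eps (coroot (?g a) \<bullet> \<mu>) * const (y \<bullet> ?g a)) = k (snd a) * const (y \<bullet> snd a)"
      using e PhpD(3)[OF a] neg k_uminus[OF PhpD(2)[OF a]] by (auto simp: eps_def const_uminus)
  next
    fix \<gamma> assume \<gamma>: "\<gamma> \<in> Pos"
    then have "\<gamma> \<in> R" "- \<gamma> \<notin> Pos" using Pos_subset Pos_not_neg by auto
    then show "?g (?h \<gamma>) = \<gamma>" "?h \<gamma> \<in> zero_affine \<mu>"
      using \<gamma> \<mu> uminus_in_R by (auto simp: zero_affine_def pos_affine_def ev_def weight_lattice_def
          not_less le_less)
  qed
  then show ?thesis by (simp add: tilde_pairing_def sum_negf)
qed

lemma const_inner: "const (x \<bullet> y) = (\<Sum>b\<in>Basis. const (x \<bullet> b) * (const (y \<bullet> b) :: 'o ratfun))"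
    for x y :: 'a
  by (subst euclidean_inner) (simp add: const_sum const_mult)

lemma pairF_tilde:
  assumes "\<mu> \<in> P" shows "pairF y (tilde R \<alpha> orb \<mu>) = tilde_pairing y \<mu>"
proof -
  have "pairF y (tilde R \<alpha> orb \<mu>) = (\<Sum>b\<in>Basis. const (y \<bullet> b) * const (\<mu> \<bullet> b))
     + 1/2 * (\<Sum>b\<in>Basis. \<Sum>\<gamma>\<in>Pos. k \<gamma> * eps (coroot \<gamma> \<bullet> \<mu>) * (const (y \<bullet> b) * const (\<gamma> \<bullet> b)))"
    by (simp add: pairF_def tilde_def distrib_left sum.distrib sum_distrib_left mult_ac)
  also have "\<dots> = const (y \<bullet> \<mu>) + 1/2 * (\<Sum>\<gamma>\<in>Pos. k \<gamma> * eps (coroot \<gamma> \<bullet> \<mu>) * const (y \<bullet> \<gamma>))"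
    by (subst sum.swap) (simp only: sum_distrib_left[symmetric] const_inner[symmetric])
  finally show ?thesis using tilde_pairing_Pos[OF assms] by simp
qed

lemma tilde_pairing_diff_scale: "tilde_pairing (x - r *\<^sub>R y) \<mu> = tilde_pairing x \<mu>
    - const r * tilde_pairing y \<mu>"
  by (simp add: tilde_pairing_def inner_diff_left const_diff const_mult right_diff_distrib sum_subtractf
      sum_distrib_left mult_ac)

text \<open>As a_i does not vanish at \<mu>, s_i maps the positive affine roots vanishing at \<mu>
  bijectively to those vanishing at s_i \<mu>; the extra term is the translation part of
  s_i.\<close>

lemma tilde_pairing_srefl:
  assumes i: "i \<in> {0..DIM('a)}" and ne: "ev (sroot i) \<mu> \<noteq> 0"
  shows "tilde_pairing y (srefl \<alpha> \<beta> i \<mu>) = tilde_pairing (refl (snd (sroot i)) y) \<mu>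
      - const (fst (sroot i) * (y \<bullet> snd (sroot i)))"
proof -
  let ?b = "sroot i"
  have b: "snd ?b \<noteq> 0" "snd ?b \<in> R" using sroot_nonzero i sroot_in_pos_affine PhpD(2) by blast+
  have "(\<Sum>a\<in>zero_affine (aff_refl ?b \<mu>). k (snd a) * const (y \<bullet> snd a))
      = (\<Sum>a\<in>zero_affine \<mu>. k (snd a) * const (refl (snd ?b) y \<bullet> snd a) :: 'o ratfun)"
  proof (rule sum.reindex_bij_witness[of _ "aff_image ?b" "aff_image ?b"])
    fix a assume a: "a \<in> zero_affine (aff_refl ?b \<mu>)"
    then have aP: "a \<in> pos_affine" by (simp add: zero_affine_def)
    show "aff_image ?b (aff_image ?b a) = a" using aff_image_aff_image b by blast
    have "a \<noteq> ?b" using a ne ev_aff_refl_self[OF b(1), of \<mu>] by (auto simp: zero_affine_def)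
    then show "aff_image ?b a \<in> zero_affine \<mu>" using a aff_image_sroot_pos_affine[OF i aP]
        by (simp add: zero_affine_def ev_aff_image)
    show "k (snd (aff_image ?b a)) * const (refl (snd ?b) y \<bullet> snd (aff_image ?b a))
        = k (snd a) * const (y \<bullet> snd a)"
      using k_refl[OF b(2) PhpD(2)[OF aP]] by (simp add: aff_image_def refl_inner)
  next
    fix a assume a: "a \<in> zero_affine \<mu>"
    then have aP: "a \<in> pos_affine" by (simp add: zero_affine_def)
    show "aff_image ?b (aff_image ?b a) = a" using aff_image_aff_image b by blast
    have "a \<noteq> ?b" using a ne by (auto simp: zero_affine_def)
    then show "aff_image ?b a \<in> zero_affine (aff_refl ?b \<mu>)"
        using a aff_image_sroot_pos_affine[OF i aP] aff_refl_aff_refl[OF b(1)]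
      by (simp add: zero_affine_def ev_aff_image)
  qed
  moreover have "y \<bullet> aff_refl ?b \<mu> = refl (snd ?b) y \<bullet> \<mu> - fst ?b * (y \<bullet> snd ?b)"
    by (simp add: aff_refl_eq_refl refl_inner_commute inner_diff_right)
  ultimately show ?thesis by (simp add: tilde_pairing_def srefl_eq_aff_refl const_diff)
qed

text \<open>The constant term of this polynomial in the parameters is a_i(\<mu>).\<close>

lemma intertwiner_denominator:
  assumes i: "i \<in> {0..DIM('a)}" and \<mu>: "\<mu> \<in> P" and ne: "ev (sroot i) \<mu> \<noteq> 0"
  shows "const (fst (sroot i)) + tilde_pairing (coroot (snd (sroot i))) \<mu> \<noteq> 0"
proof
  let ?y = "coroot (snd (sroot i))"
  assume 0: "const (fst (sroot i)) + tilde_pairing ?y \<mu> = 0"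
  have "const (fst (sroot i)) + tilde_pairing ?y \<mu> = const (ev (sroot i) \<mu>)
      + (\<Sum>\<gamma>\<in>Pos. k \<gamma> * const ((if 0 < coroot \<gamma> \<bullet> \<mu> then 1 else - 1) * (?y \<bullet> \<gamma>) / 2))"
    unfolding tilde_pairing_Pos[OF \<mu>] sum_distrib_left ev_def const_add add.assoc
    by (intro arg_cong2[where f = "(+)"] refl sum.cong)
       (auto simp: eps_def const_uminus const_divide_numeral)
  from affine_in_parameters_eq_0(1)[OF finite_Pos trans[OF this[symmetric] 0]] ne show False
    by contradiction
qed

text \<open>On the alcove the nonpositive affine roots are the vanishing ones, and their reflections
  fix \<mu>, so every term is a multiple of e^\<mu>.\<close>

lemma Dunkl_minuscule:
  assumes \<mu>: "\<mu> \<in> minuscule_weights R \<alpha>"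
  shows "Dunkl y (gexp \<mu>) = gscale (tilde_pairing y \<mu>) (gexp \<mu>)"
proof -
  have P: "\<mu> \<in> P" using \<mu> by (simp add: minuscule_weights_def)
  have "nonpos_affine \<mu> = zero_affine \<mu>" using minuscule_alcove[OF \<mu>]
      by (force simp: nonpos_affine_def zero_affine_def)
  then have "(\<Sum>a\<in>nonpos_affine \<mu>. gscale (k (snd a) * const (y \<bullet> snd a) * wt (ev a \<mu>)) (gexp
      (aff_refl a \<mu>)))
    = (\<Sum>a\<in>zero_affine \<mu>. gscale (1/2 * (k (snd a) * const (y \<bullet> snd a))) (gexp \<mu>))"
    by (intro sum.cong) (auto simp: zero_affine_def wt_def aff_refl_fixed)
  then show ?thesis
    by (simp add: Dunkl_gexp Dunkl_exp_nonpos_affine[OF P] tilde_pairing_def gscale_diff_left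
        gscale_sum_left sum_distrib_left)
qed

text \<open>Moving \<open>Dunkl y\<close> past s_i leaves -k (y, \<gamma>) f, while c times the
  difference of the eigenvalues at \<mu> and s_i \<mu> is k (y, \<gamma>); the choice of c makes the
  two cancel.\<close>

lemma Dunkl_intertwiner:
  assumes i: "i \<in> {0..DIM('a)}" and \<mu>: "\<mu> \<in> P" and ne: "ev (sroot i) \<mu> \<noteq> 0"
    and f: "supp f \<subseteq> P" and eig: "\<And>y. Dunkl y f = gscale (tilde_pairing y \<mu>) f"
    and c: "c = k (snd (sroot i)) * inverse (const (fst (sroot i))
        + tilde_pairing (coroot (snd (sroot i))) \<mu>)"
  shows "Dunkl y (act (srefl \<alpha> \<beta> i) f + gscale c f)
    = gscale (tilde_pairing y (srefl \<alpha> \<beta> i \<mu>)) (act (srefl \<alpha> \<beta> i) f + gscale c f)"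
proof -
  define \<gamma> q where "\<gamma> = snd (sroot i)" and "q = fst (sroot i)"
  let ?s = "act (srefl \<alpha> \<beta> i)" and ?y = "refl \<gamma> y"
  have y: "?y \<bullet> \<gamma> = - (y \<bullet> \<gamma>)" by (simp add: refl_inner_commute refl_self)
  have "gscale (tilde_pairing ?y \<mu>) (?s f) = Dunkl y (?s f) + gscale (const (q * (y \<bullet> \<gamma>))) (?s f)
      + gscale (k \<gamma> * const (y \<bullet> \<gamma>)) f"
    using Dunkl_srefl[OF i f, of ?y]
    by (simp add: eig linop_gscale y const_uminus gscale_uminus_left flip: \<gamma>_def q_def)
  then have 1: "Dunkl y (?s f) = gscale (tilde_pairing y (srefl \<alpha> \<beta> i \<mu>)) (?s f)
      - gscale (k \<gamma> * const (y \<bullet> \<gamma>)) f"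
    by (simp add: tilde_pairing_srefl[OF i ne] gscale_diff_left algebra_simps flip: \<gamma>_def q_def)
  have y_eq: "?y = y - (y \<bullet> \<gamma>) *\<^sub>R coroot \<gamma>" by (simp add: refl_def coroot_def inner_commute)
  have "tilde_pairing ?y \<mu> = tilde_pairing y \<mu> - const (y \<bullet> \<gamma>) * tilde_pairing (coroot \<gamma>) \<mu>"
    unfolding y_eq by (rule tilde_pairing_diff_scale)
  then have d: "tilde_pairing y (srefl \<alpha> \<beta> i \<mu>) = tilde_pairing y \<mu> - const (y \<bullet> \<gamma>) * (const q
      + tilde_pairing (coroot \<gamma>) \<mu>)"
    by (simp add: tilde_pairing_srefl[OF i ne] const_mult algebra_simps flip: \<gamma>_def q_def)
  have e: "c * (const q + tilde_pairing (coroot \<gamma>) \<mu>) = k \<gamma>"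
    using intertwiner_denominator[OF i \<mu> ne] by (simp add: c flip: \<gamma>_def q_def)
  have "c * tilde_pairing y (srefl \<alpha> \<beta> i \<mu>) = c * tilde_pairing y \<mu> - const (y \<bullet> \<gamma>) * (c * (const q
      + tilde_pairing (coroot \<gamma>) \<mu>))"
    unfolding d right_diff_distrib by (simp only: mult.left_commute)
  then have 2: "c * tilde_pairing y (srefl \<alpha> \<beta> i \<mu>) = c * tilde_pairing y \<mu> - k \<gamma> * const (y \<bullet> \<gamma>)"
    by (simp only: e mult.commute)
  have "Dunkl y (gscale c f) = gscale (c * tilde_pairing y (srefl \<alpha> \<beta> i \<mu>) + k \<gamma> * const (y \<bullet> \<gamma>)) f"
    by (simp add: linop_gscale eig 2)
  then show ?thesis
    by (simp add: linop_add 1 gscale_lin mult.commute)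
qed

text \<open>One induction along the word for all properties. The strict increase at each step
  supplies the nonzero denominator, the hypothesis of the lifting property and the leading
  coefficient.\<close>

lemma intertwined_exp_properties:
  fixes lam w ws
  assumes w: "shortest_to_minuscule R \<alpha> \<beta> lam w" and ws: "reduced_expression \<alpha> \<beta> ws w"
    and lam: "lam \<in> P"
  shows "Dunkl y (intertwined_exp R \<alpha> \<beta> orb ws (w lam))
      = gscale (tilde_pairing y lam) (intertwined_exp R \<alpha> \<beta> orb ws (w lam))"
    and "\<nu> \<in> supp (intertwined_exp R \<alpha> \<beta> orb ws (w lam)) \<Longrightarrow> \<nu> \<in> P \<and> wle \<nu> lam"
    and "coef (intertwined_exp R \<alpha> \<beta> orb ws (w lam)) lam = 1"
proof -
  let ?x = "w lam"
  define E where "E m = fold (\<lambda>j f. act (srefl \<alpha> \<beta> (ws ! j)) f + gscale (coeff_c R \<alpha> \<beta> orb ws ?x j) f)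
       [0..<m] (gexp ?x)" for m
  define X where "X m = partial_weight \<alpha> \<beta> ws ?x m" for m
  have ws': "set ws \<subseteq> {0..DIM('a)}" "w = word_map (srefl \<alpha> \<beta>) ws"
    using ws by (auto simp: reduced_expression_def expression_def)
  have x: "?x \<in> minuscule_weights R \<alpha>" using w by (simp add: shortest_to_minuscule_def)
  have X_end: "X (length ws) = lam"
    using fold_srefl_word_map[OF ws'(1), of lam] ws'(2) by (simp add: X_def partial_weight_def)
  have X_Suc: "X (Suc m) = srefl \<alpha> \<beta> (ws ! m) (X m)" if "m < length ws" for m
    using that by (simp add: X_def partial_weight_def take_Suc_conv_app_nth)
  have "X m \<in> P \<and> supp (E m) \<subseteq> {\<nu> \<in> P. wle \<nu> (X m)} \<and> coef (E m) (X m) = 1 \<and>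
      (\<forall>y. Dunkl y (E m) = gscale (tilde_pairing y (X m)) (E m))" if "m \<le> length ws" for m
    using that
  proof (induction m)
    case 0
    then show ?case using x Dunkl_minuscule
      by (simp add: X_def E_def partial_weight_def minuscule_weights_def lookup_gexp)
  next
    case (Suc m)
    let ?i = "ws ! m"
    have m: "m < length ws" using Suc by simp
    have i: "?i \<in> {0..DIM('a)}" using ws'(1) m nth_mem by blast
    let ?s = "srefl \<alpha> \<beta> ?i" and ?c = "coeff_c R \<alpha> \<beta> orb ws ?x m"
    have IH: "X m \<in> P" "supp (E m) \<subseteq> {\<nu> \<in> P. wle \<nu> (X m)}" "coef (E m) (X m) = 1"
      "\<And>y. Dunkl y (E m) = gscale (tilde_pairing y (X m)) (E m)" using Suc by auto
    have pos: "0 < ev (sroot ?i) (X m)"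
      using reduced_expression_increasing[OF w ws m] by (simp add: X_def)
    have ES: "E (Suc m) = act ?s (E m) + gscale ?c (E m)" by (simp add: E_def)
    have c: "?c = k (snd (sroot ?i)) * inverse (const (fst (sroot ?i))
        + tilde_pairing (coroot (snd (sroot ?i))) (X m))"
      using IH(1) by (simp add: coeff_c_def kidx_eq affpairF_def affine_root_eq pairF_tilde flip: X_def)
    have XP: "X (Suc m) \<in> P" using X_Suc[OF m] srefl_weight[OF i IH(1)] by simp
    have le: "wle (X m) (X (Suc m))" using up_srefl[OF i pos] X_Suc[OF m] by auto
    have "supp (act ?s (E m)) \<subseteq> {\<nu> \<in> P. wle \<nu> (X (Suc m))}"
    proof
      fix \<nu> assume "\<nu> \<in> supp (act ?s (E m))"
      then obtain \<kappa> where "\<kappa> \<in> supp (E m)" "\<nu> = ?s \<kappa>" using supp_act[of ?s "E m"] by blast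
      then show "\<nu> \<in> {\<nu> \<in> P. wle \<nu> (X (Suc m))}"
        using IH(2) wle_lift[OF i _ pos] srefl_weight[OF i] X_Suc[OF m] by auto
    qed
    moreover have "supp (gscale ?c (E m)) \<subseteq> {\<nu> \<in> P. wle \<nu> (X (Suc m))}"
      using supp_gscale[of ?c "E m"] IH(2) rtranclp_trans[OF _ le] by blast
    ultimately have supp: "supp (E (Suc m)) \<subseteq> {\<nu> \<in> P. wle \<nu> (X (Suc m))}"
      unfolding ES using keys_add[of "act ?s (E m)" "gscale ?c (E m)"] by blast
    \<comment> \<open>Since the new weight is not below the old one, \<open>gscale ?c (E m)\<close>
      contributes nothing to its coefficient.\<close>
    have "\<not> wle (X (Suc m)) (X m)"
    proof
      assume "wle (X (Suc m)) (X m)"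
      then have "X m = ?s (X m)" using wle_antisym[OF le _ IH(1)] X_Suc[OF m] by simp
      then have "ev (sroot ?i) (X m) = - ev (sroot ?i) (X m)" using ev_srefl[OF i, of "X m"] by simp
      then show False using pos by simp
    qed
    then have "coef (E m) (X (Suc m)) = 0" using IH(2) by (auto simp: in_keys_iff)
    moreover have "bij ?s" using srefl_srefl[OF i] by (intro o_bij[of ?s]) (auto simp: fun_eq_iff)
    then have "coef (act ?s (E m)) (X (Suc m)) = 1"
      using lookup_act_bij[of ?s "E m" "X m"] IH(3) X_Suc[OF m] by simp
    ultimately have "coef (E (Suc m)) (X (Suc m)) = 1" by (simp add: ES lookup_add)
    moreover have "Dunkl y (E (Suc m)) = gscale (tilde_pairing y (X (Suc m))) (E (Suc m))" for y
      unfolding ES X_Suc[OF m]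
      by (rule Dunkl_intertwiner[OF i IH(1) _ _ IH(4) c]) (use pos IH(2) in auto)
    ultimately show ?case using XP supp by blast
  qed
  from this[of "length ws"] X_end
  show "Dunkl y (intertwined_exp R \<alpha> \<beta> orb ws (w lam))
      = gscale (tilde_pairing y lam) (intertwined_exp R \<alpha> \<beta> orb ws (w lam))"
    and "\<nu> \<in> supp (intertwined_exp R \<alpha> \<beta> orb ws (w lam)) \<Longrightarrow> \<nu> \<in> P \<and> wle \<nu> lam"
    and "coef (intertwined_exp R \<alpha> \<beta> orb ws (w lam)) lam = 1"
    by (auto simp: E_def intertwined_exp_def)
qed

end


context HO_datum
begin

section \<open>The sum of squares of the Dunkl--Cherednik operators\<close>

lemma Dunkl_exp_add_scale: "Dunkl_exp (x + r *\<^sub>R y) \<mu> = Dunkl_exp x \<mu> + gscale (const r) (Dunkl_exp y \<mu>)"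
  by (rule poly_mapping_eqI)
     (simp add: Dunkl_exp_def lookup_add lookup_sum lookup_minus inner_add_left const_add const_mult
        distrib_left distrib_right sum.distrib sum_distrib_left mult_ac)

lemma Dunkl_add_scale: "Dunkl (x + r *\<^sub>R y) f = Dunkl x f + gscale (const r) (Dunkl y f)"
  by (simp add: Dunkl_def linext_def Dunkl_exp_add_scale gscale_add_right sum.distrib
      gscale_sum_right mult.commute)

lemma Dunkl_0: "Dunkl 0 f = 0"
  using Dunkl_add_scale[of 0 1 0 f] by simp

lemma Dunkl_expansion: "(\<Sum>b\<in>Basis. gscale (const (b \<bullet> x)) (Dunkl b f)) = Dunkl x f"
proof -
  have "Dunkl (\<Sum>b\<in>B. (b \<bullet> x) *\<^sub>R b) f = (\<Sum>b\<in>B. gscale (const (b \<bullet> x)) (Dunkl b f))" if "finite B" for B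
    using that
  proof (induction B)
    case (insert b B)
    show ?case
      unfolding sum.insert[OF insert.hyps] add.commute[of "(b \<bullet> x) *\<^sub>R b"] Dunkl_add_scale insert.IH
      by (rule add.commute)
  qed (simp add: Dunkl_0)
  from this[of Basis] show ?thesis by (simp add: inner_commute[of _ x] euclidean_representation)
qed

definition Dunkl_laplacian :: "('a \<Rightarrow>\<^sub>0 'o ratfun) \<Rightarrow> 'a \<Rightarrow>\<^sub>0 'o ratfun" where
  "Dunkl_laplacian f = (\<Sum>b\<in>Basis. Dunkl b (Dunkl b f))"

lemma linop_Dunkl_laplacian: "linop Dunkl_laplacian"
  unfolding Dunkl_laplacian_def[abs_def] by (intro linop_sum_ops linop_comp[OF linop_Dunkl linop_Dunkl])

text \<open>Moving s past both factors and summing over the basis leaves D_\<gamma> D_\<gamma> s f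
  with coefficient -2c + c^2 (\<gamma>, \<gamma>) and D_\<gamma> f with coefficient -2k + c k
  (\<gamma>, \<gamma>), where D stands for \<open>Dunkl\<close>. Both vanish because c (\<gamma>,
  \<gamma>) = 2.\<close>

lemma Dunkl_laplacian_simple_reflection:
  assumes i: "i \<in> {1..DIM('a)}" and f: "supp f \<subseteq> P"
  shows "act (refl (\<alpha> i)) (Dunkl_laplacian f) = Dunkl_laplacian (act (refl (\<alpha> i)) f)"
proof -
  define \<gamma> where "\<gamma> = \<alpha> i"
  define c where "c = 2 / (\<gamma> \<bullet> \<gamma>)"
  have \<gamma>: "\<gamma> \<noteq> 0" using i simple_in_R root_nonzero by (auto simp: \<gamma>_def)
  let ?s = "act (refl \<gamma>)"
  have i': "i \<in> {0..DIM('a)}" and sr: "sroot i = (0, \<gamma>)" and si: "srefl \<alpha> \<beta> i = refl \<gamma>"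
    using i by (auto simp: sroot_def srefl_def \<gamma>_def)
  have comm: "?s (Dunkl y h) = Dunkl y (?s h) - gscale (const (c * (y \<bullet> \<gamma>))) (Dunkl \<gamma> (?s h))
      - gscale (k \<gamma> * const (y \<bullet> \<gamma>)) h" if h: "supp h \<subseteq> P" for y h
  proof -
    have "refl \<gamma> y = y + (- c * (y \<bullet> \<gamma>)) *\<^sub>R \<gamma>"
      by (simp add: refl_def coroot_def c_def inner_commute)
    then have "Dunkl (refl \<gamma> y) (?s h) = Dunkl y (?s h)
        + gscale (const (- c * (y \<bullet> \<gamma>))) (Dunkl \<gamma> (?s h))"
      by (simp only: Dunkl_add_scale)
    then show ?thesis using Dunkl_srefl[OF i' h, of y]
      by (simp add: sr si const_uminus gscale_uminus_left)
  qed
  define g where "g = ?s f"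
  define e where "e = Dunkl \<gamma> g"
  have summand: "?s (Dunkl b (Dunkl b f)) = Dunkl b (Dunkl b g)
      - gscale (const c) (gscale (const (b \<bullet> \<gamma>)) (Dunkl b e))
      - gscale (k \<gamma>) (gscale (const (b \<bullet> \<gamma>)) (Dunkl b f))
      - gscale (const c) (Dunkl \<gamma> (gscale (const (b \<bullet> \<gamma>)) (Dunkl b g)))
      + gscale (const c * const c * (const (b \<bullet> \<gamma>) * const (b \<bullet> \<gamma>))) (Dunkl \<gamma> e)
      + gscale (const c * k \<gamma> * (const (b \<bullet> \<gamma>) * const (b \<bullet> \<gamma>))) (Dunkl \<gamma> f)
      - gscale (k \<gamma>) (gscale (const (b \<bullet> \<gamma>)) (Dunkl b f))" for b
  proof -
    have "?s (Dunkl b (Dunkl b f)) = Dunkl b (?s (Dunkl b f))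
        - gscale (const (c * (b \<bullet> \<gamma>))) (Dunkl \<gamma> (?s (Dunkl b f)))
            - gscale (k \<gamma> * const (b \<bullet> \<gamma>)) (Dunkl b f)"
      by (rule comm) (rule supp_Dunkl[OF f])
    also have "?s (Dunkl b f) = Dunkl b g - gscale (const (c * (b \<bullet> \<gamma>))) e
        - gscale (k \<gamma> * const (b \<bullet> \<gamma>)) f"
      unfolding g_def e_def by (rule comm[OF f])
    finally show ?thesis
      by (simp only: linop_diff[OF linop_Dunkl] linop_gscale[OF linop_Dunkl] const_mult gscale_diff_right
          gscale_gscale mult_ac) simp
  qed
  have norm: "(\<Sum>b\<in>Basis. const (b \<bullet> \<gamma>) * const (b \<bullet> \<gamma>)) = (const (\<gamma> \<bullet> \<gamma>) :: 'o ratfun)"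
    by (simp add: const_inner[of \<gamma> \<gamma>] inner_commute)
  have c2: "const c * const (\<gamma> \<bullet> \<gamma>) = (2 :: 'o ratfun)"
    using \<gamma> by (simp add: c_def flip: const_mult)
  have "?s (Dunkl_laplacian f) = (\<Sum>b\<in>Basis. ?s (Dunkl b (Dunkl b f)))"
    by (simp add: Dunkl_laplacian_def linop_sum)
  also have "\<dots> = Dunkl_laplacian g - gscale (const c) (Dunkl \<gamma> e) - gscale (k \<gamma>) (Dunkl \<gamma> f)
      - gscale (const c) (Dunkl \<gamma> e)
      + gscale (const c * const c * const (\<gamma> \<bullet> \<gamma>)) (Dunkl \<gamma> e)
      + gscale (const c * k \<gamma> * const (\<gamma> \<bullet> \<gamma>)) (Dunkl \<gamma> f) - gscale (k \<gamma>) (Dunkl \<gamma> f)"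
  proof -
    have "(\<Sum>b\<in>Basis. gscale (const c) (gscale (const (b \<bullet> \<gamma>)) (Dunkl b e)))
        = gscale (const c) (Dunkl \<gamma> e)"
      and "(\<Sum>b\<in>Basis. gscale (k \<gamma>) (gscale (const (b \<bullet> \<gamma>)) (Dunkl b f))) = gscale (k \<gamma>) (Dunkl \<gamma> f)"
      by (simp_all only: gscale_sum_right[symmetric] Dunkl_expansion)
    moreover have "(\<Sum>b\<in>Basis. gscale (const c) (Dunkl \<gamma> (gscale (const (b \<bullet> \<gamma>)) (Dunkl b g))))
        = gscale (const c) (Dunkl \<gamma> e)"
      by (simp only: gscale_sum_right[symmetric] linop_sum[OF linop_Dunkl, symmetric]
          Dunkl_expansion e_def)
    moreover have "(\<Sum>b\<in>Basis. gscale (t * (const (b \<bullet> \<gamma>) * const (b \<bullet> \<gamma>))) h)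
        = gscale (t * const (\<gamma> \<bullet> \<gamma>)) h"
      for t :: "'o ratfun" and h :: "'a \<Rightarrow>\<^sub>0 'o ratfun"
      by (simp only: gscale_sum_left[symmetric] sum_distrib_left[symmetric] norm)
    ultimately show ?thesis
      by (simp only: summand sum.distrib sum_subtractf Dunkl_laplacian_def)
  qed
  also have "const c * const c * const (\<gamma> \<bullet> \<gamma>) = const c * (2 :: 'o ratfun)"
    by (simp only: mult.assoc c2)
  also have "const c * k \<gamma> * const (\<gamma> \<bullet> \<gamma>) = k \<gamma> * (const c * const (\<gamma> \<bullet> \<gamma>))"
    by (simp only: mult_ac)
  also have "\<dots> = k \<gamma> * 2" by (simp only: c2)
  finally have "?s (Dunkl_laplacian f) = Dunkl_laplacian g - gscale (const c) (Dunkl \<gamma> e)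
      - gscale (k \<gamma>) (Dunkl \<gamma> f)
      - gscale (const c) (Dunkl \<gamma> e) + gscale (const c * 2) (Dunkl \<gamma> e) + gscale (k \<gamma> * 2) (Dunkl \<gamma> f)
      - gscale (k \<gamma>) (Dunkl \<gamma> f)" .
  moreover have "gscale (t * 2) h = gscale t h + gscale t h"
      for t :: "'o ratfun" and h :: "'a \<Rightarrow>\<^sub>0 'o ratfun"
    unfolding gscale_add_left[symmetric] by (simp add: mult.commute[of _ 2])
  ultimately show ?thesis by (simp add: g_def \<gamma>_def)
qed

lemma act_weights: "u \<in> W0 \<alpha> \<Longrightarrow> supp f \<subseteq> P \<Longrightarrow> supp (act u f) \<subseteq> P" for f :: "'a \<Rightarrow>\<^sub>0 'o ratfun"
  using supp_act[of u f] W0_weight by fastforce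

lemma Dunkl_laplacian_W0:
  assumes u: "u \<in> W0 \<alpha>" and f: "supp f \<subseteq> P"
  shows "act u (Dunkl_laplacian f) = Dunkl_laplacian (act u f)"
  using u
proof (induction rule: W0_induct)
  case (step i u)
  show ?case unfolding act_act[symmetric] step.IH
    by (rule Dunkl_laplacian_simple_reflection[OF step.hyps(1) act_weights[OF step.hyps(2) f]])
qed (simp only: act_id)


section \<open>The Heckman--Opdam operator on invariants\<close>

definition demazure_op :: "'a \<Rightarrow> ('a \<Rightarrow>\<^sub>0 'o ratfun) \<Rightarrow> 'a \<Rightarrow>\<^sub>0 'o ratfun" where
  "demazure_op \<gamma> = linext (demazure \<gamma>)"

definition rho_pairing :: "'a \<Rightarrow> 'o ratfun" where
  "rho_pairing y = 1/2 * (\<Sum>\<gamma>\<in>Pos. k \<gamma> * const (y \<bullet> \<gamma>))"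

lemma demazure_op_mult:
  assumes \<gamma>: "\<gamma> \<in> R" and f: "supp f \<subseteq> P"
  shows "(1 - gexp (- \<gamma>)) * demazure_op \<gamma> f = f - act (refl \<gamma>) f"
proof -
  let ?T = "\<lambda>f. (1 - gexp (- \<gamma>)) * demazure_op \<gamma> f"
  let ?U = "\<lambda>f :: 'a \<Rightarrow>\<^sub>0 'o ratfun. f - act (refl \<gamma>) f"
  show ?thesis
  proof (rule linop_eq[of ?T ?U])
    show "linop ?T" by (rule linop_comp[OF linop_mult_left]) (simp add: demazure_op_def)
    show "linop ?U" by (intro linop_minus linop_ident linop_act)
    show "?T (gexp \<mu>) = ?U (gexp \<mu>)" if "\<mu> \<in> supp f" for \<mu>
      using demazure_mult[OF \<gamma>] f that by (auto simp: demazure_op_def)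
  qed
qed

lemma Dunkl_demazure_op:
  "Dunkl y f = deriv_along y f + (\<Sum>\<gamma>\<in>Pos. gscale (k \<gamma> * const (y \<bullet> \<gamma>)) (demazure_op \<gamma> f))
      - gscale (rho_pairing y) f"
proof -
  let ?U = "\<lambda>f. deriv_along y f + (\<Sum>\<gamma>\<in>Pos. gscale (k \<gamma> * const (y \<bullet> \<gamma>)) (demazure_op \<gamma> f))
      - gscale (rho_pairing y) f"
  show ?thesis
  proof (rule linop_eq[of _ ?U])
    show "linop ?U"
      by (intro linop_minus linop_plus linop_sum_ops linop_scale linop_ident linop_deriv_along)
         (simp add: demazure_op_def)
    show "Dunkl y (gexp \<mu>) = ?U (gexp \<mu>)" for \<mu>
      by (simp add: Dunkl_gexp Dunkl_exp_def deriv_along_gexp demazure_op_def rho_pairing_def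
          gscale_diff_right
          sum_subtractf gscale_sum_left sum_distrib_left mult_ac)
  qed simp
qed

lemma act_deriv_along:
  assumes "\<gamma> \<in> R"
  shows "act (refl \<gamma>) (deriv_along y f) = deriv_along (refl \<gamma> y) (act (refl \<gamma>) f)"
  by (rule linop_eq[OF linop_comp[OF linop_act linop_deriv_along] linop_comp[OF linop_deriv_along
      linop_act]])
     (simp add: deriv_along_gexp linop_gscale refl_inner)

lemma deriv_along_diff_scale:
  "deriv_along (x - r *\<^sub>R y) f = deriv_along x f - gscale (const r) (deriv_along y f)"
  by (rule poly_mapping_eqI)
     (simp add: lookup_deriv_along lookup_minus inner_diff_left const_diff const_mult algebra_simps)

lemma invariantsD:
  assumes "f \<in> invariants R \<alpha>"
  shows "supp f \<subseteq> P" and "\<And>u. u \<in> W0 \<alpha> \<Longrightarrow> act u f = f"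
  using assms by (auto simp: invariants_def group_algebra_def)

definition HO_quot :: "'a \<Rightarrow> ('a \<Rightarrow>\<^sub>0 'o ratfun) \<Rightarrow> 'a \<Rightarrow>\<^sub>0 'o ratfun" where
  "HO_quot \<gamma> f = exact_quot (deriv_along \<gamma> f) (1 - gexp (- \<gamma>))"

text \<open>For invariant f the difference of \<partial>_y f and its reflection is a multiple of
  \<partial>_\<gamma> f, so the divided difference of \<partial>_y f is a multiple of the quotient
  occurring in L. The case y = \<gamma> proves the divisibility that makes \<open>exact_quot\<close>
  meaningful.\<close>

lemma demazure_op_invariant:
  assumes f: "f \<in> invariants R \<alpha>" and \<gamma>: "\<gamma> \<in> R"
  shows "demazure_op \<gamma> f = 0"
    and "(1 - gexp (- \<gamma>)) * HO_quot \<gamma> f = deriv_along \<gamma> f"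
    and "demazure_op \<gamma> (deriv_along y f) = gscale (const (coroot \<gamma> \<bullet> y)) (HO_quot \<gamma> f)"
proof -
  note \<gamma>0 = root_nonzero[OF \<gamma>]
  have inv: "act (refl \<gamma>) f = f" using invariantsD(2)[OF f] refl_in_W0[OF \<gamma>] by blast
  have dP: "supp (deriv_along z f) \<subseteq> P" for z using supp_deriv_along[of z f] invariantsD(1)[OF f]
      by blast
  have "(1 - gexp (- \<gamma>)) * demazure_op \<gamma> f = (1 - gexp (- \<gamma>)) * 0"
    using demazure_op_mult[OF \<gamma> invariantsD(1)[OF f]] inv by simp
  then show "demazure_op \<gamma> f = 0" by (rule one_minus_gexp_cancel[OF \<gamma>0])
  have D: "(1 - gexp (- \<gamma>)) * demazure_op \<gamma> (deriv_along z f)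
      = gscale (const (coroot \<gamma> \<bullet> z)) (deriv_along \<gamma> f)" for z
    using demazure_op_mult[OF \<gamma> dP[of z]]
    by (simp add: act_deriv_along[OF \<gamma>] inv) (simp add: refl_def[of \<gamma> z] deriv_along_diff_scale)
  have scale: "g * gscale a h = gscale a (g * h)" for g h :: "'a \<Rightarrow>\<^sub>0 'o ratfun" and a
    by (simp add: gscale_conv_mult mult.left_commute)
  \<comment> \<open>The factor 1/2 compensates that \<gamma> pairs to 2 with its own coroot.\<close>
  have "(1 - gexp (- \<gamma>)) * gscale (1/2) (demazure_op \<gamma> (deriv_along \<gamma> f)) = deriv_along \<gamma> f"
    by (simp add: scale D coroot_self[OF \<gamma>0])
  from exact_quot_eq[OF \<gamma>0 this] this
  show HO_quot: "(1 - gexp (- \<gamma>)) * HO_quot \<gamma> f = deriv_along \<gamma> f" by (simp add: HO_quot_def)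
  show "demazure_op \<gamma> (deriv_along y f) = gscale (const (coroot \<gamma> \<bullet> y)) (HO_quot \<gamma> f)"
    by (rule one_minus_gexp_cancel[OF \<gamma>0]) (simp add: D scale HO_quot)
qed

text \<open>On invariants \<open>Dunkl y\<close> is \<partial>_y - (\<rho>, y); applying it again
  brings in the divided differences of derivatives. Summing over the basis gives 2/(1 -
  e^(-\<gamma>)) - 1 = (1 + e^(-\<gamma>))/(1 - e^(-\<gamma>)) as the factor of k_\<gamma>
  \<partial>_\<gamma>, where -1 stems from the cross terms with \<rho>.\<close>

lemma Dunkl_laplacian_invariant:
  assumes f: "f \<in> invariants R \<alpha>"
  shows "Dunkl_laplacian f = HO_operator R \<alpha> orb f + gscale (\<Sum>b\<in>Basis. rho_pairing b * rho_pairing b) f"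
proof -
  have PosR: "\<gamma> \<in> R" if "\<gamma> \<in> Pos" for \<gamma> using that Pos_subset by blast
  have D1: "Dunkl y f = deriv_along y f - gscale (rho_pairing y) f" for y
    using demazure_op_invariant(1)[OF f] PosR by (simp add: Dunkl_demazure_op)
  have D2: "Dunkl y (Dunkl y f) = deriv_along y (deriv_along y f)
      + (\<Sum>\<gamma>\<in>Pos. gscale (k \<gamma> * (const (\<gamma> \<bullet> y) * const (coroot \<gamma> \<bullet> y))) (HO_quot \<gamma> f))
      - gscale (rho_pairing y) (deriv_along y f) - gscale (rho_pairing y) (deriv_along y f)
          + gscale (rho_pairing y * rho_pairing y) f" for y
  proof -
    have "Dunkl y (deriv_along y f) = deriv_along y (deriv_along y f)
      + (\<Sum>\<gamma>\<in>Pos. gscale (k \<gamma> * (const (\<gamma> \<bullet> y) * const (coroot \<gamma> \<bullet> y))) (HO_quot \<gamma> f))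
      - gscale (rho_pairing y) (deriv_along y f)"
      using demazure_op_invariant(3)[OF f PosR] by (simp add: Dunkl_demazure_op[of y "deriv_along y
          f"] inner_commute mult_ac)
    moreover have "Dunkl y (Dunkl y f) = Dunkl y (deriv_along y f) - gscale (rho_pairing y) (Dunkl y f)"
      by (simp only: D1[of y] linop_diff[OF linop_Dunkl] linop_gscale[OF linop_Dunkl])
    moreover have "gscale (rho_pairing y) (Dunkl y f) = gscale (rho_pairing y) (deriv_along y f)
        - gscale (rho_pairing y * rho_pairing y) f"
      by (simp add: D1 gscale_diff_right)
    ultimately show ?thesis by simp
  qed
  have d_expand: "(\<Sum>b\<in>Basis. gscale (const (b \<bullet> x)) (deriv_along b f)) = deriv_along x f" for x
  proof (rule poly_mapping_eqI)
    fix \<kappa>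
    have "coef (\<Sum>b\<in>Basis. gscale (const (b \<bullet> x)) (deriv_along b f)) \<kappa>
        = (\<Sum>b\<in>Basis. const (x \<bullet> b) * const (\<kappa> \<bullet> b)) * coef f \<kappa>"
      by (simp add: lookup_sum lookup_deriv_along inner_commute[of _ x] inner_commute[of _ \<kappa>]
          sum_distrib_right mult.assoc)
    then show "coef (\<Sum>b\<in>Basis. gscale (const (b \<bullet> x)) (deriv_along b f)) \<kappa> = coef (deriv_along x f) \<kappa>"
      by (simp only: const_inner[symmetric] lookup_deriv_along)
  qed
  have A: "(\<Sum>b\<in>Basis. \<Sum>\<gamma>\<in>Pos. gscale (k \<gamma> * (const (\<gamma> \<bullet> b) * const (coroot \<gamma> \<bullet> b))) (HO_quot \<gamma> f))
      = (\<Sum>\<gamma>\<in>Pos. gscale (k \<gamma> * 2) (HO_quot \<gamma> f))"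
  proof (subst sum.swap, rule sum.cong)
    fix \<gamma> assume "\<gamma> \<in> Pos"
    then have "\<gamma> \<bullet> coroot \<gamma> = 2" using coroot_self root_nonzero PosR by (metis inner_commute)
    then have "(\<Sum>b\<in>Basis. const (\<gamma> \<bullet> b) * const (coroot \<gamma> \<bullet> b)) = (2 :: 'o ratfun)"
      by (simp flip: const_inner)
    then show "(\<Sum>b\<in>Basis. gscale (k \<gamma> * (const (\<gamma> \<bullet> b) * const (coroot \<gamma> \<bullet> b))) (HO_quot \<gamma> f))
        = gscale (k \<gamma> * 2) (HO_quot \<gamma> f)"
      by (simp only: gscale_sum_left[symmetric] sum_distrib_left[symmetric])
  qed simp
  have B: "(\<Sum>b\<in>Basis. gscale (rho_pairing b) (deriv_along b f))
      + (\<Sum>b\<in>Basis. gscale (rho_pairing b) (deriv_along b f))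
      = (\<Sum>\<gamma>\<in>Pos. gscale (k \<gamma>) (deriv_along \<gamma> f))" (is "?X + ?X = ?K")
  proof -
    have "rho_pairing b + rho_pairing b = (\<Sum>\<gamma>\<in>Pos. k \<gamma> * const (b \<bullet> \<gamma>))" for b
        by (simp add: rho_pairing_def)
    then have "?X + ?X = (\<Sum>b\<in>Basis. \<Sum>\<gamma>\<in>Pos. gscale (k \<gamma>) (gscale (const (b \<bullet> \<gamma>)) (deriv_along b f)))"
      by (simp add: gscale_sum_left flip: sum.distrib gscale_add_left)
    also have "\<dots> = ?K"
      by (subst sum.swap) (simp only: gscale_sum_right[symmetric] d_expand)
    finally show ?thesis .
  qed
  have C: "gscale (k \<gamma>) ((1 + gexp (- \<gamma>)) * HO_quot \<gamma> f) = gscale (k \<gamma> * 2) (HO_quot \<gamma> f)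
      - gscale (k \<gamma>) (deriv_along \<gamma> f)"
    if "\<gamma> \<in> Pos" for \<gamma>
  proof -
    have "gexp (- \<gamma>) * HO_quot \<gamma> f = HO_quot \<gamma> f - deriv_along \<gamma> f"
      using demazure_op_invariant(2)[OF f PosR[OF that]] by (simp add: left_diff_distrib algebra_simps)
    then have "(1 + gexp (- \<gamma>)) * HO_quot \<gamma> f = HO_quot \<gamma> f + HO_quot \<gamma> f - deriv_along \<gamma> f"
      unfolding distrib_right by simp
    moreover have "gscale (k \<gamma> * 2) h = gscale (k \<gamma>) h + gscale (k \<gamma>) h" for h :: "'a \<Rightarrow>\<^sub>0 'o ratfun"
      unfolding gscale_add_left[symmetric] by (simp add: mult.commute[of _ 2])
    ultimately show ?thesis by (simp only: gscale_diff_right gscale_add_right)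
  qed
  have "Dunkl_laplacian f = (\<Sum>b\<in>Basis. deriv_along b (deriv_along b f))
      + (\<Sum>\<gamma>\<in>Pos. gscale (k \<gamma> * 2) (HO_quot \<gamma> f))
      - ?X - ?X + gscale (\<Sum>b\<in>Basis. rho_pairing b * rho_pairing b) f"
    unfolding Dunkl_laplacian_def D2 by (simp only: sum.distrib sum_subtractf A gscale_sum_left)
  also have "\<dots> = (\<Sum>b\<in>Basis. deriv_along b (deriv_along b f)) + ((\<Sum>\<gamma>\<in>Pos. gscale (k \<gamma> * 2) (HO_quot \<gamma> f))
      - ?K) + gscale (\<Sum>b\<in>Basis. rho_pairing b * rho_pairing b) f"
    unfolding B[symmetric] by (simp only: diff_diff_eq add_diff_eq)
  also have "(\<Sum>\<gamma>\<in>Pos. gscale (k \<gamma> * 2) (HO_quot \<gamma> f)) - ?K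
      = (\<Sum>\<gamma>\<in>Pos. gscale (k \<gamma>) ((1 + gexp (- \<gamma>)) * HO_quot \<gamma> f))"
    by (simp only: C sum_subtractf cong: sum.cong)
  finally show ?thesis by (simp only: HO_operator_def HO_quot_def)
qed

text \<open>The coefficients h of the quotient satisfy h(\<kappa>) - h(\<kappa> + \<gamma>) =
  (\<gamma>, \<kappa>) times the coefficient of f at \<kappa>. Beyond \<nu> they are constant along
  the \<gamma>-string, hence zero, and only h(\<nu>) survives.\<close>

lemma HO_operator_top:
  assumes f: "f \<in> invariants R \<alpha>"
    and top: "\<And>\<gamma> j. \<gamma> \<in> Pos \<Longrightarrow> coef f (\<nu> + real (Suc j) *\<^sub>R \<gamma>) = 0"
  shows "coef (HO_operator R \<alpha> orb f) \<nu> = (const (\<nu> \<bullet> \<nu>) + (\<Sum>\<gamma>\<in>Pos. k \<gamma> * const (\<gamma> \<bullet> \<nu>))) * coef f \<nu>"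
proof -
  have "coef ((1 + gexp (- \<gamma>)) * HO_quot \<gamma> f) \<nu> = const (\<gamma> \<bullet> \<nu>) * coef f \<nu>" if \<gamma>: "\<gamma> \<in> Pos" for \<gamma>
  proof -
    have R: "\<gamma> \<in> R" using \<gamma> Pos_subset by blast
    have h: "coef (HO_quot \<gamma> f) \<kappa> - coef (HO_quot \<gamma> f) (\<kappa> + \<gamma>) = const (\<gamma> \<bullet> \<kappa>) * coef f \<kappa>" for \<kappa>
      using demazure_op_invariant(2)[OF f R] lookup_one_minus_gexp_mult[of \<gamma> "HO_quot \<gamma> f" \<kappa>]
      by (simp add: lookup_deriv_along)
    have "coef (HO_quot \<gamma> f) (\<nu> + \<gamma>) = 0"
    proof (rule lookup_vanishes_along_string[OF root_nonzero[OF R]])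
      fix j
      have a: "\<nu> + \<gamma> + real j *\<^sub>R \<gamma> = \<nu> + real (Suc j) *\<^sub>R \<gamma>"
        and b: "\<nu> + \<gamma> + real (Suc j) *\<^sub>R \<gamma> = \<nu> + real (Suc j) *\<^sub>R \<gamma> + \<gamma>"
        by (simp_all add: scaleR_left_distrib)
      show "coef (HO_quot \<gamma> f) (\<nu> + \<gamma> + real j *\<^sub>R \<gamma>) = coef (HO_quot \<gamma> f) (\<nu> + \<gamma> + real (Suc j) *\<^sub>R \<gamma>)"
        unfolding a b using h[of "\<nu> + real (Suc j) *\<^sub>R \<gamma>"] top[OF \<gamma>, of j] by simp
    qed
    then show ?thesis using h[of \<nu>] by (simp add: distrib_right lookup_add lookup_gexp_mult)
  qed
  then have "(\<Sum>\<gamma>\<in>Pos. k \<gamma> * coef ((1 + gexp (- \<gamma>)) * HO_quot \<gamma> f) \<nu>)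
      = (\<Sum>\<gamma>\<in>Pos. k \<gamma> * const (\<gamma> \<bullet> \<nu>)) * coef f \<nu>"
    by (simp add: sum_distrib_right mult.assoc)
  moreover have "(\<Sum>b\<in>Basis. coef (deriv_along b (deriv_along b f)) \<nu>) = const (\<nu> \<bullet> \<nu>) * coef f \<nu>"
  proof -
    have "(\<Sum>b\<in>Basis. coef (deriv_along b (deriv_along b f)) \<nu>)
        = (\<Sum>b\<in>Basis. const (\<nu> \<bullet> b) * const (\<nu> \<bullet> b)) * coef f \<nu>"
      by (simp add: lookup_deriv_along inner_commute[of _ \<nu>] sum_distrib_right mult.assoc)
    then show ?thesis by (simp only: const_inner[symmetric])
  qed
  ultimately show ?thesis
    by (simp only: HO_operator_def HO_quot_def[symmetric] lookup_add lookup_sum lookup_gscale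
        distrib_right[of _ _ "coef f \<nu>"])
qed


section \<open>Characterisation of the Heckman--Opdam polynomials\<close>

lemma invariants_minus: "f \<in> invariants R \<alpha> \<Longrightarrow> g \<in> invariants R \<alpha> \<Longrightarrow> f - g \<in> invariants R \<alpha>"
  for f g :: "'a \<Rightarrow>\<^sub>0 'o ratfun"
proof -
  assume fg: "f \<in> invariants R \<alpha>" "g \<in> invariants R \<alpha>"
  have "supp (f - g) \<subseteq> supp f \<union> supp g" by (auto simp: in_keys_iff lookup_minus)
  then have "supp (f - g) \<subseteq> P" using invariantsD(1)[OF fg(1)] invariantsD(1)[OF fg(2)] by blast
  then show ?thesis using fg by (simp add: invariants_def group_algebra_def linop_diff)
qed

lemma eigenvalue_eq:
  "pairF lam (\<lambda>b. const (lam \<bullet> b) + 2 * rho R \<alpha> orb b) = const (lam \<bullet> lam)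
      + (\<Sum>\<gamma>\<in>Pos. k \<gamma> * const (\<gamma> \<bullet> lam))"
proof -
  have "pairF lam (\<lambda>b. const (lam \<bullet> b) + 2 * rho R \<alpha> orb b)
    = (\<Sum>b\<in>Basis. const (lam \<bullet> b) * const (lam \<bullet> b))
      + (\<Sum>b\<in>Basis. \<Sum>\<gamma>\<in>Pos. k \<gamma> * (const (\<gamma> \<bullet> b) * const (lam \<bullet> b)))"
    by (simp add: pairF_def rho_def distrib_left sum.distrib sum_distrib_left mult_ac)
  also have "\<dots> = const (lam \<bullet> lam) + (\<Sum>\<gamma>\<in>Pos. k \<gamma> * const (\<gamma> \<bullet> lam))"
    by (subst sum.swap) (simp only: sum_distrib_left[symmetric] const_inner[symmetric])
  finally show ?thesis .
qed

lemma supp_orbit_sum: "supp (orbit_sum \<alpha> \<mu> :: 'a \<Rightarrow>\<^sub>0 'o ratfun) \<subseteq> W0_orbit \<alpha> \<mu>"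
  unfolding orbit_sum_def by (intro supp_sum_subset) auto

lemma orbit_self: "\<mu> \<in> W0_orbit \<alpha> \<mu>"
  unfolding W0_orbit_def using id_in_W0 by (rule rev_image_eqI) simp

lemma lookup_orbit_sum: "coef (orbit_sum \<alpha> \<mu> :: 'a \<Rightarrow>\<^sub>0 'o ratfun) \<mu> = 1"
  using finite_orbit orbit_self by (simp add: orbit_sum_def lookup_sum lookup_gexp)

definition below :: "'a \<Rightarrow> 'a set" where
  "below lam = {\<mu> \<in> dominant_weights R \<alpha>. dom_less R \<alpha> \<mu> lam}"

text \<open>Dominant weights have nonnegative height, which bounds every coefficient of a
  decomposition of \<open>lam - \<mu>\<close>. Finiteness matters because a sum over an infinite set
  is 0 by convention.\<close>

lemma finite_below: "finite (below lam)"
proof (rule finite_subset)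
  let ?C = "Pi\<^sub>E Pos (\<lambda>\<gamma>. {..nat \<lfloor>two_rho \<bullet> lam / (two_rho \<bullet> \<gamma>)\<rfloor>})"
  show "finite ((\<lambda>c. lam - (\<Sum>\<gamma>\<in>Pos. real (c \<gamma>) *\<^sub>R \<gamma>)) ` ?C)"
    by (intro finite_imageI finite_PiE finite_Pos) simp
  show "below lam \<subseteq> (\<lambda>c. lam - (\<Sum>\<gamma>\<in>Pos. real (c \<gamma>) *\<^sub>R \<gamma>)) ` ?C"
  proof
    fix \<mu> assume "\<mu> \<in> below lam"
    then have \<mu>: "\<mu> \<in> dominant_weights R \<alpha>" and "dom_le R \<alpha> \<mu> lam"
      by (auto simp: below_def dom_less_def)
    then obtain c :: "'a \<Rightarrow> nat" where c: "lam - \<mu> = (\<Sum>\<gamma>\<in>Pos. real (c \<gamma>) *\<^sub>R \<gamma>)"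
      by (auto simp: dom_le_def)
    have "0 \<le> \<gamma> \<bullet> \<mu>" if \<gamma>: "\<gamma> \<in> Pos" for \<gamma>
    proof -
      have "0 \<le> coroot \<gamma> \<bullet> \<mu>" using \<mu> \<gamma> by (simp add: dominant_weights_def)
      moreover have "\<gamma> \<bullet> \<gamma> > 0" using \<gamma> Pos_subset root_nonzero by auto
      ultimately show ?thesis by (simp add: coroot_def zero_le_divide_iff)
    qed
    then have "0 \<le> two_rho \<bullet> \<mu>" by (simp add: two_rho_def inner_sum_left sum_nonneg)
    then have le: "two_rho \<bullet> (lam - \<mu>) \<le> two_rho \<bullet> lam" by (simp add: inner_diff_right)
    have "restrict c Pos \<in> ?C"
    proof (rule restrict_PiE_iff[THEN iffD2], rule ballI)
      fix \<gamma> assume \<gamma>: "\<gamma> \<in> Pos"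
      have "real (c \<gamma>) * (two_rho \<bullet> \<gamma>) \<le> (\<Sum>\<gamma>\<in>Pos. real (c \<gamma>) * (two_rho \<bullet> \<gamma>))"
        by (rule member_le_sum[OF \<gamma>]) (use finite_Pos two_rho_Pos less_imp_le in \<open>auto simp:
            less_imp_le\<close>)
      also have "\<dots> = two_rho \<bullet> (lam - \<mu>)" by (simp add: c inner_sum_right)
      finally have "real (c \<gamma>) \<le> two_rho \<bullet> lam / (two_rho \<bullet> \<gamma>)"
        using le two_rho_Pos[OF \<gamma>] by (simp add: pos_le_divide_eq)
      then show "c \<gamma> \<in> {..nat \<lfloor>two_rho \<bullet> lam / (two_rho \<bullet> \<gamma>)\<rfloor>}"
        by (simp add: le_nat_floor)
    qed
    moreover have "\<mu> = lam - (\<Sum>\<gamma>\<in>Pos. real (restrict c Pos \<gamma>) *\<^sub>R \<gamma>)"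
      using c by (simp add: algebra_simps cong: sum.cong)
    ultimately show "\<mu> \<in> (\<lambda>c. lam - (\<Sum>\<gamma>\<in>Pos. real (c \<gamma>) *\<^sub>R \<gamma>)) ` ?C" by blast
  qed
qed

lemma below_orbit:
  assumes "\<mu> \<in> below lam" "\<kappa> \<in> W0_orbit \<alpha> \<mu>"
  shows "lam - \<kappa> \<in> root_cone" "\<kappa> \<noteq> lam"
proof -
  obtain u where u: "u \<in> W0 \<alpha>" "\<kappa> = u \<mu>" using assms(2) by (auto simp: W0_orbit_def)
  have \<mu>: "\<mu> \<in> dominant_weights R \<alpha>" "lam - \<mu> \<in> root_cone" "\<mu> \<noteq> lam"
    using assms(1) by (auto simp: below_def dom_less_def dom_le_iff)
  have d: "\<mu> - \<kappa> \<in> root_cone" using dominant_minus_orbit \<mu>(1) u by blast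
  then show "lam - \<kappa> \<in> root_cone" using root_cone_add[OF \<mu>(2) d] by simp
  show "\<kappa> \<noteq> lam"
  proof
    assume "\<kappa> = lam"
    then have "- (lam - \<mu>) \<in> root_cone" using d by simp
    then show False using root_cone_antisym \<mu> by fastforce
  qed
qed

lemma supp_below:
  "supp (\<Sum>\<mu>\<in>below lam. gscale (d \<mu>) (orbit_sum \<alpha> \<mu>) :: 'a \<Rightarrow>\<^sub>0 'o ratfun) \<subseteq> {\<kappa>. lam - \<kappa> \<in> root_cone
      \<and> \<kappa> \<noteq> lam}"
  using below_orbit supp_orbit_sum by (intro supp_sum_subset order.trans[OF supp_gscale]) blast

text \<open>The predicate inside the definite description of \<open>HO_polynomial\<close>, isolated
  so that existence and uniqueness can be treated separately.\<close>

definition HO_spec :: "'a \<Rightarrow> ('a \<Rightarrow>\<^sub>0 'o ratfun) \<Rightarrow> bool" where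
  "HO_spec lam p \<longleftrightarrow> p \<in> invariants R \<alpha> \<and>
     (\<exists>d :: 'a \<Rightarrow> 'o ratfun. p = orbit_sum \<alpha> lam +
        (\<Sum>\<mu> | \<mu> \<in> dominant_weights R \<alpha> \<and> dom_less R \<alpha> \<mu> lam. gscale (d \<mu>) (orbit_sum \<alpha> \<mu>))) \<and>
     HO_operator R \<alpha> orb p = gscale (pairF lam (\<lambda>b. const (lam \<bullet> b) + 2 * rho R \<alpha> orb b)) p"

text \<open>At a highest exponent \<nu> of the difference L acts by its diagonal value, so \<lambda>
  and \<nu> have equal eigenvalues. Comparing the parts linear in the parameters gives equal
  heights, impossible strictly below \<lambda>.\<close>

lemma HO_spec_unique:
  assumes p1: "HO_spec lam p1" and p2: "HO_spec lam p2"
  shows "p1 = p2"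
proof (rule ccontr)
  assume ne: "p1 \<noteq> p2"
  define q where "q = p1 - p2"
  let ?L = "HO_operator R \<alpha> orb"
  let ?e = "\<lambda>\<nu>. const (\<nu> \<bullet> \<nu>) + (\<Sum>\<gamma>\<in>Pos. k \<gamma> * const (\<gamma> \<bullet> \<nu>)) :: 'o ratfun"
  have inv: "p1 \<in> invariants R \<alpha>" "p2 \<in> invariants R \<alpha>" using p1 p2 by (auto simp: HO_spec_def)
  then have q: "q \<in> invariants R \<alpha>" by (simp add: q_def invariants_minus)
  obtain d1 d2 where "p1 = orbit_sum \<alpha> lam + (\<Sum>\<mu>\<in>below lam. gscale (d1 \<mu>) (orbit_sum \<alpha> \<mu>))"
    "p2 = orbit_sum \<alpha> lam + (\<Sum>\<mu>\<in>below lam. gscale (d2 \<mu>) (orbit_sum \<alpha> \<mu>))"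
    using p1 p2 unfolding HO_spec_def below_def by blast
  then have "q = (\<Sum>\<mu>\<in>below lam. gscale (d1 \<mu> - d2 \<mu>) (orbit_sum \<alpha> \<mu>))"
    by (simp add: q_def gscale_diff_left sum_subtractf)
  then have supp_q: "supp q \<subseteq> {\<kappa>. lam - \<kappa> \<in> root_cone \<and> \<kappa> \<noteq> lam}" by (simp only: supp_below)
  \<comment> \<open>The quotient in L is a definite description, so additivity on invariants is
    imported from the sum of squares.\<close>
  have "?L q = ?L p1 - ?L p2"
    using Dunkl_laplacian_invariant[OF q] Dunkl_laplacian_invariant[OF inv(1)]
        Dunkl_laplacian_invariant[OF inv(2)]
    by (simp add: q_def linop_diff[OF linop_Dunkl_laplacian] gscale_diff_right algebra_simps)
  then have Lq: "?L q = gscale (?e lam) q"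
    using p1 p2 by (simp add: HO_spec_def eigenvalue_eq gscale_diff_right q_def)
  have "supp q \<noteq> {}" using ne by (simp add: q_def)
  then obtain \<nu> where \<nu>: "\<nu> \<in> supp q" and max: "two_rho \<bullet> \<nu> = Max ((\<lambda>\<nu>. two_rho \<bullet> \<nu>) ` supp q)"
    using obtains_MAX[of "supp q" "\<lambda>\<nu>. two_rho \<bullet> \<nu>"] finite_keys by metis
  have "coef q (\<nu> + real (Suc j) *\<^sub>R \<gamma>) = 0" if \<gamma>: "\<gamma> \<in> Pos" for \<gamma> j
  proof (rule ccontr)
    assume "coef q (\<nu> + real (Suc j) *\<^sub>R \<gamma>) \<noteq> 0"
    then have "two_rho \<bullet> (\<nu> + real (Suc j) *\<^sub>R \<gamma>) \<le> two_rho \<bullet> \<nu>"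
      unfolding max by (intro Max_ge) (auto simp: in_keys_iff)
    moreover have "0 < real (Suc j) * (two_rho \<bullet> \<gamma>)" using two_rho_Pos[OF \<gamma>] by simp
    ultimately show False by (simp only: inner_add_right inner_scaleR_right)
  qed
  from HO_operator_top[OF q this] have "?e lam * coef q \<nu> = ?e \<nu> * coef q \<nu>" by (simp add: Lq)
  moreover have "coef q \<nu> \<noteq> 0" using \<nu> by (simp add: in_keys_iff)
  ultimately have "?e lam = ?e \<nu>" by simp
  moreover have "?e lam - ?e \<nu> = const (lam \<bullet> lam - \<nu> \<bullet> \<nu>) + (\<Sum>\<gamma>\<in>Pos. k \<gamma> * const (\<gamma> \<bullet> (lam - \<nu>)))"
    by (simp add: const_diff inner_diff_right right_diff_distrib sum_subtractf)
  ultimately have "const (lam \<bullet> lam - \<nu> \<bullet> \<nu>) + (\<Sum>\<gamma>\<in>Pos. k \<gamma> * const (\<gamma> \<bullet> (lam - \<nu>))) = (0 :: 'o ratfun)"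
    by simp
  from affine_in_parameters_eq_0(2)[OF finite_Pos this]
  have "two_rho \<bullet> (lam - \<nu>) = 0" by (simp add: two_rho_def inner_sum_left)
  then show False using root_cone_two_rho(2) supp_q \<nu> by fastforce
qed

lemma HO_polynomial_eqI: "HO_spec lam p \<Longrightarrow> HO_polynomial R \<alpha> orb lam = p"
  unfolding HO_polynomial_def HO_spec_def[symmetric]
  by (rule the_equality) (auto intro: HO_spec_unique)

text \<open>The required shape rests on two facts about the exponents of the joint eigenvector: all
  their \<open>W0\<close>-images are dominated by \<open>lam\<close>, and none of them except
  \<open>lam\<close> lies in the orbit of \<open>lam\<close>.\<close>

lemma symmetrized_HO_spec:
  fixes lam w ws
  assumes w: "shortest_to_minuscule R \<alpha> \<beta> lam w" and ws: "reduced_expression \<alpha> \<beta> ws w"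
    and lam: "lam \<in> dominant_weights R \<alpha>"
  shows "HO_spec lam (gscale (of_nat (card (W0_orbit \<alpha> lam)) / of_nat (card (W0 \<alpha>)))
      (\<Sum>u\<in>W0 \<alpha>. act u (intertwined_exp R \<alpha> \<beta> orb ws (w lam))))"
proof -
  define E where "E = intertwined_exp R \<alpha> \<beta> orb ws (w lam)"
  define N where "N = (of_nat (card (W0_orbit \<alpha> lam)) / of_nat (card (W0 \<alpha>)) :: 'o ratfun)"
  define p where "p = gscale N (\<Sum>u\<in>W0 \<alpha>. act u E)"
  let ?L = "HO_operator R \<alpha> orb"
  have lamP: "lam \<in> P" using lam dominant_weight by blast
  have E_eig: "Dunkl y E = gscale (tilde_pairing y lam) E" for y
    unfolding E_def by (rule intertwined_exp_properties(1)[OF w ws lamP])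
  have E_supp: "\<nu> \<in> P" "wle \<nu> lam" if "\<nu> \<in> supp E" for \<nu>
    using intertwined_exp_properties(2)[OF w ws lamP] that unfolding E_def by blast+
  have E_lam: "coef E lam = 1"
    unfolding E_def by (rule intertwined_exp_properties(3)[OF w ws lamP])
  have EP: "supp E \<subseteq> P" using E_supp by blast

  have "act v p = p" if v: "v \<in> W0 \<alpha>" for v
  proof -
    have "act v (\<Sum>u\<in>W0 \<alpha>. act u E) = (\<Sum>u\<in>W0 \<alpha>. act (v \<circ> u) E)"
      by (simp add: linop_sum act_act)
    also have "\<dots> = (\<Sum>u\<in>W0 \<alpha>. act u E)"
      by (rule sum.reindex_bij_betw[OF bij_W0_comp[OF v]])
    finally show ?thesis by (simp add: p_def linop_gscale)
  qed
  moreover have "supp p \<subseteq> P"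
    unfolding p_def using act_weights[OF _ EP] by (intro order.trans[OF supp_gscale] supp_sum_subset)
  ultimately have p_inv: "p \<in> invariants R \<alpha>" by (simp add: invariants_def group_algebra_def)

  have "Dunkl_laplacian E = gscale (\<Sum>b\<in>Basis. tilde_pairing b lam * tilde_pairing b lam) E"
    by (simp add: Dunkl_laplacian_def E_eig linop_gscale gscale_sum_left)
  then have "Dunkl_laplacian p = gscale (\<Sum>b\<in>Basis. tilde_pairing b lam * tilde_pairing b lam) p"
    by (simp add: p_def linop_gscale linop_sum linop_Dunkl_laplacian Dunkl_laplacian_W0[OF _ EP,
        symmetric] gscale_sum_right mult.commute)
  then have Lp: "?L p = gscale ((\<Sum>b\<in>Basis. tilde_pairing b lam * tilde_pairing b lam)
      - (\<Sum>b\<in>Basis. rho_pairing b * rho_pairing b)) p"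
    using Dunkl_laplacian_invariant[OF p_inv] by (simp add: gscale_diff_left algebra_simps)

  define r where "r \<nu> = (SOME \<mu>. \<mu> \<in> dominant_weights R \<alpha> \<and> (\<exists>u\<in>W0 \<alpha>. \<mu> = u \<nu>))" for \<nu>
  have r: "r \<nu> \<in> dominant_weights R \<alpha>" "\<exists>u\<in>W0 \<alpha>. r \<nu> = u \<nu>" if "\<nu> \<in> P" for \<nu>
    using dominant_representative[OF that]
      someI_ex[of "\<lambda>\<mu>. \<mu> \<in> dominant_weights R \<alpha> \<and> (\<exists>u\<in>W0 \<alpha>. \<mu> = u \<nu>)"]
    unfolding r_def by blast+
  have r_below: "r \<nu> \<in> below lam" if \<nu>: "\<nu> \<in> supp E - {lam}" for \<nu>
  proof -
    have P: "\<nu> \<in> P" and le: "wle \<nu> lam" using E_supp \<nu> by auto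
    obtain u where u: "u \<in> W0 \<alpha>" "r \<nu> = u \<nu>" using r(2)[OF P] by blast
    have sat: "lam - v \<nu> \<in> root_cone" if "v \<in> W0 \<alpha>" for v
      by (rule below_saturated[OF le P _ that]) (rule dominant_minus_orbit[OF lam])
    \<comment> \<open>An exponent in the orbit of \<open>lam\<close> has the same norm, so
      \<open>wle_inner\<close> puts it above \<open>lam\<close> in dominance, while saturation puts
      it below.\<close>
    have "r \<nu> \<noteq> lam"
    proof
      assume "r \<nu> = lam"
      then have "\<nu> \<bullet> \<nu> = lam \<bullet> lam" using inner_W0[OF u(1), of \<nu> \<nu>] u(2) by simp
      then have "\<nu> - lam \<in> root_cone" using wle_inner[OF le P] by simp
      moreover have "- (\<nu> - lam) \<in> root_cone" using sat[OF id_in_W0] by simp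
      ultimately have "\<nu> - lam = 0" by (rule root_cone_antisym)
      then show False using \<nu> by simp
    qed
    then show ?thesis using r(1)[OF P] sat[OF u(1)] u(2) by (simp add: below_def dom_less_def dom_le_iff)
  qed
  have orbit_r: "orbit_sum \<alpha> (r \<nu>) = (orbit_sum \<alpha> \<nu> :: 'a \<Rightarrow>\<^sub>0 'o ratfun)" if "\<nu> \<in> P" for \<nu>
    using r(2)[OF that] orbit_eq by (auto simp: orbit_sum_def)
  \<comment> \<open>The factor after \<open>coef E \<nu>\<close> is the normalisation times the
    order of the stabilizer of \<nu>; at \<open>lam\<close> it equals 1.\<close>
  define a where "a \<nu> = coef E \<nu> * (N * (of_nat (card (W0 \<alpha>)) / of_nat (card (W0_orbit \<alpha> \<nu>))))" for \<nu>
  have a_lam: "a lam = 1"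
  proof -
    have "card (W0_orbit \<alpha> lam) \<noteq> 0" using finite_orbit orbit_self by auto
    then show ?thesis using card_W0_pos by (simp add: a_def E_lam N_def)
  qed
  have "p = (\<Sum>\<nu>\<in>supp E. gscale (a \<nu>) (orbit_sum \<alpha> \<nu>))"
  proof -
    have "(\<Sum>u\<in>W0 \<alpha>. act u E) = (\<Sum>u\<in>W0 \<alpha>. \<Sum>\<nu>\<in>supp E. gscale (coef E \<nu>) (gexp (u \<nu>)))"
      by (simp add: act_eq_linext linext_def)
    also have "\<dots> = (\<Sum>\<nu>\<in>supp E. gscale (coef E \<nu>) (\<Sum>u\<in>W0 \<alpha>. gexp (u \<nu>)))"
      by (subst sum.swap) (simp only: gscale_sum_right)
    finally show ?thesis
      by (simp add: p_def stabilizer_sum gscale_sum_right a_def mult_ac)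
  qed
  also have "\<dots> = gscale (a lam) (orbit_sum \<alpha> lam) + (\<Sum>\<nu>\<in>supp E - {lam}. gscale (a \<nu>) (orbit_sum \<alpha> \<nu>))"
    by (rule sum.remove) (use E_lam in \<open>auto simp: in_keys_iff\<close>)
  also have "(\<Sum>\<nu>\<in>supp E - {lam}. gscale (a \<nu>) (orbit_sum \<alpha> \<nu>))
      = (\<Sum>\<mu>\<in>below lam. \<Sum>\<nu>\<in>{\<nu> \<in> supp E - {lam}. r \<nu> = \<mu>}. gscale (a \<nu>) (orbit_sum \<alpha> \<nu>))"
    by (rule sum.group[symmetric]) (use r_below finite_below in auto)
  also have "\<dots> = (\<Sum>\<mu>\<in>below lam. gscale (\<Sum>\<nu>\<in>{\<nu> \<in> supp E - {lam}. r \<nu> = \<mu>}. a \<nu>) (orbit_sum \<alpha> \<mu>))"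
    unfolding gscale_sum_left
    by (intro sum.cong refl) (use orbit_r E_supp(1) in auto)
  finally have p_exp: "p = orbit_sum \<alpha> lam
      + (\<Sum>\<mu>\<in>below lam. gscale (\<Sum>\<nu>\<in>{\<nu> \<in> supp E - {lam}. r \<nu> = \<mu>}. a \<nu>) (orbit_sum \<alpha> \<mu>))"
    by (simp add: a_lam)

  let ?q = "\<Sum>\<mu>\<in>below lam. gscale (\<Sum>\<nu>\<in>{\<nu> \<in> supp E - {lam}. r \<nu> = \<mu>}. a \<nu>) (orbit_sum \<alpha> \<mu>)"
  have "lam \<notin> supp ?q" by (rule contra_subsetD[OF supp_below]) simp
  then have "coef ?q lam = 0" by (simp only: in_keys_iff not_not)
  then have p_lam: "coef p lam = 1" by (simp only: p_exp lookup_add lookup_orbit_sum) simp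
  have "supp (orbit_sum \<alpha> lam :: 'a \<Rightarrow>\<^sub>0 'o ratfun) \<subseteq> {\<kappa>. lam - \<kappa> \<in> root_cone}"
    using supp_orbit_sum[of lam] dominant_minus_orbit[OF lam] by (auto simp: W0_orbit_def)
  moreover have "supp ?q \<subseteq> {\<kappa>. lam - \<kappa> \<in> root_cone}" by (rule order.trans[OF supp_below]) auto
  ultimately have p_supp: "supp p \<subseteq> {\<kappa>. lam - \<kappa> \<in> root_cone}"
    using keys_add[of "orbit_sum \<alpha> lam" ?q] unfolding p_exp[symmetric] by blast
  have top: "coef p (lam + real (Suc j) *\<^sub>R \<gamma>) = 0" if \<gamma>: "\<gamma> \<in> Pos" for \<gamma> j
  proof (rule ccontr)
    assume "coef p (lam + real (Suc j) *\<^sub>R \<gamma>) \<noteq> 0"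
    then have "lam - (lam + real (Suc j) *\<^sub>R \<gamma>) \<in> root_cone" using p_supp by (auto simp: in_keys_iff)
    from root_cone_two_rho(1)[OF this] have "real (Suc j) * (two_rho \<bullet> \<gamma>) \<le> 0"
      by (simp only: inner_diff_right inner_add_right inner_scaleR_right)
    moreover have "0 < real (Suc j) * (two_rho \<bullet> \<gamma>)" using two_rho_Pos[OF \<gamma>] by simp
    ultimately show False by simp
  qed
  text \<open>The eigenvalue is read off from the leading coefficient.\<close>
  have "(\<Sum>b\<in>Basis. tilde_pairing b lam * tilde_pairing b lam) - (\<Sum>b\<in>Basis. rho_pairing b * rho_pairing b)
      = const (lam \<bullet> lam) + (\<Sum>\<gamma>\<in>Pos. k \<gamma> * const (\<gamma> \<bullet> lam))"
    using HO_operator_top[OF p_inv top] by (simp add: Lp p_lam)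
  with Lp have "?L p = gscale (pairF lam (\<lambda>b. const (lam \<bullet> b) + 2 * rho R \<alpha> orb b)) p"
    by (simp add: eigenvalue_eq)
  moreover have "\<exists>d. p = orbit_sum \<alpha> lam + (\<Sum>\<mu>\<in>below lam. gscale (d \<mu>) (orbit_sum \<alpha> \<mu>))"
    by (rule exI[of _ "\<lambda>\<mu>. \<Sum>\<nu>\<in>{\<nu> \<in> supp E - {lam}. r \<nu> = \<mu>}. a \<nu>"]) (rule p_exp)
  ultimately have "HO_spec lam p" using p_inv by (simp only: HO_spec_def below_def simp_thms)
  then show ?thesis by (simp only: p_def N_def E_def)
qed

end

theorem theorem1p3:
  fixes R :: "'a::euclidean_space set" and \<alpha> :: "nat \<Rightarrow> 'a" and \<beta> lam :: 'a
    and orb :: "'a \<Rightarrow> 'o::linorder" and w :: "'a \<Rightarrow> 'a" and ws :: "nat list"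
  assumes "simple_lie_root_system R"
    and "simple_roots R \<alpha>"
    and "highest_short_root R \<alpha> \<beta>"
    and "orbit_labelling R \<alpha> orb"
    and "lam \<in> dominant_weights R \<alpha>"
    and "shortest_to_minuscule R \<alpha> \<beta> lam w"
    and "reduced_expression \<alpha> \<beta> ws w"
  shows "HO_polynomial R \<alpha> orb lam =
    gscale (of_nat (card (W0_orbit \<alpha> lam)) / of_nat (card (W0 \<alpha>)))
      (\<Sum>u\<in>W0 \<alpha>. act u (intertwined_exp R \<alpha> \<beta> orb ws (w lam)))"
proof -
  interpret HO_datum R \<alpha> \<beta> orb
    using assms(1-4) by unfold_locales
  show ?thesis
    using assms(5-7) by (intro HO_polynomial_eqI symmetrized_HO_spec)
qed

end
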